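(* Let $\alpha\in(0,1)$, $\omega>0$ and $\varepsilon>0$, and let $u\ge 0$ be a local minimizer of $I_\varepsilon$ in the unit ball $B_1\subset\mathbb{R}^{n+1}$. Then there exists a constant $C_0>0$ (possibly depending on $\varepsilon$) such that for all $x\in B^n_{1/2}(0)\cap\{u>0\}$, $$u(x,0)\ge C_0\,\mathrm{dist}(x,\partial\{u>0\})^\alpha.$$
   Context: Points of $\mathbb{R}^{n+1}$ are written $(x,y)$ with $x\in\mathbb{R}^n$, $y\in\mathbb{R}$; $\mathbb{R}^n$ is identified with $\{y=0\}$; $\mathbb{R}^{n+1}_+=\{y>0\}$; $\mathcal{L}^n$ is $n$-dimensional Lebesgue measure. Put $\beta=1-2\alpha\in(-1,1)$. $B_1$ is the unit ball of $\mathbb{R}^{n+1}$ centered at the origin and $B^n_r(x)$ is the ball of $\mathbb{R}^n$ of radius $r$ centered at $x$. For open $\Omega\subset\mathbb{R}^{n+1}$, $H^1(\beta,\Omega)=\{u\in L^2(\Omega\cap\mathbb{R}^{n+1}_+): |y|^{\beta/2}\nabla u\in L^2(\Omega)\}$, and for $u\in H^1(\beta,\Omega)$ $$I_\varepsilon(u,\Omega)=\int_\Omega|y|^\beta|\nabla u|^2\,dx\,dy+f_\varepsilon\big(\mathcal{L}^n(\{u>0\}\cap\mathbb{R}^n\cap\Omega)\big),$$ where $f_\varepsilon(s)=\frac1\varepsilon(s-\omega)$ for $s\ge\omega$ and $f_\varepsilon(s)=\varepsilon(s-\omega)$ for $s\le\omega$. A function $u\in H^1(\beta,B_1)$ is a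 local minimizer of $I_\varepsilon$ in $B_1$ if for every ball $B\subset B_1$ and every $v\in H^1(\beta,B)$ with $v=u$ on $\partial B$ one has $I_\varepsilon(u,B)\le I_\varepsilon(v,B)$. Local minimizers are continuous in $B_1$ (locally $C^{0,\alpha}$), and $u$ denotes the continuous representative. In the claim $\{u>0\}$ denotes $\{x\in B_1^n(0):u(x,0)>0\}$ and $\partial\{u>0\}$ its boundary in $\mathbb{R}^n$. *)

theory Defs
  imports "HOL-Analysis.Analysis"
begin

text \<open>
  A point of \<open>\<real>\<^sup>n\<^sup>+\<^sup>1\<close> is a pair \<open>(x, y)\<close> with \<open>x :: real ^ 'n\<close> and \<open>y :: real\<close>; the norm of the product
  type is the Euclidean one.  Functions on a subset of \<open>\<real>\<^sup>n\<^sup>+\<^sup>1\<close> are total functions whose values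
  outside the subset are irrelevant.
\<close>

type_synonym 'n pt = "(real ^ 'n) \<times> real"

definition square_integrable_on :: "'a::euclidean_space set \<Rightarrow> ('a \<Rightarrow> 'b::euclidean_space) \<Rightarrow> bool" where
  "square_integrable_on S f \<longleftrightarrow>
     f \<in> borel_measurable (lebesgue_on S) \<and> (\<lambda>z. (norm (f z))\<^sup>2) absolutely_integrable_on S"

definition locally_integrable_on :: "'a::euclidean_space set \<Rightarrow> ('a \<Rightarrow> 'b::euclidean_space) \<Rightarrow> bool" where
  "locally_integrable_on \<Omega> f \<longleftrightarrow> (\<forall>K. compact K \<longrightarrow> K \<subseteq> \<Omega> \<longrightarrow> f absolutely_integrable_on K)"

text \<open>\<open>\<phi> \<in> C\<^sup>1\<^sub>c(\<Omega>)\<close> with gradient \<open>D\<close>.\<close>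

definition test_function :: "'a::euclidean_space set \<Rightarrow> ('a \<Rightarrow> real) \<Rightarrow> ('a \<Rightarrow> 'a) \<Rightarrow> bool" where
  "test_function \<Omega> \<phi> D \<longleftrightarrow>
     (\<forall>z. GDERIV \<phi> z :> D z) \<and> continuous_on UNIV D \<and>
     (\<exists>K. compact K \<and> K \<subseteq> \<Omega> \<and> (\<forall>z. z \<notin> K \<longrightarrow> \<phi> z = 0))"

text \<open>Test functions of class \<open>C\<^sup>1\<^sub>c\<close> and \<open>C\<^sup>\<infinity>\<^sub>c\<close> give the same weak gradients, by mollification.\<close>

definition has_weak_gradient ::
  "'a::euclidean_space set \<Rightarrow> ('a \<Rightarrow> real) \<Rightarrow> ('a \<Rightarrow> 'a) \<Rightarrow> bool" where
  "has_weak_gradient \<Omega> u G \<longleftrightarrow>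
     locally_integrable_on \<Omega> u \<and> locally_integrable_on \<Omega> G \<and>
     (\<forall>\<phi> D. test_function \<Omega> \<phi> D \<longrightarrow>
        (LINT z:\<Omega>|lebesgue. u z *\<^sub>R D z) = - (LINT z:\<Omega>|lebesgue. \<phi> z *\<^sub>R G z))"

text \<open>Determined up to null sets of the open set \<open>\<Omega>\<close>; only integrals of it are used below.\<close>

definition weak_gradient :: "'a::euclidean_space set \<Rightarrow> ('a \<Rightarrow> real) \<Rightarrow> 'a \<Rightarrow> 'a" where
  "weak_gradient \<Omega> u = (SOME G. has_weak_gradient \<Omega> u G)"

definition upper_half_space :: "'n::finite pt set" where
  "upper_half_space = {z. snd z > 0}"

definition H1 :: "real \<Rightarrow> 'n::finite pt set \<Rightarrow> ('n pt \<Rightarrow> real) set" where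
  "H1 \<beta> \<Omega> = {u. (\<exists>G. has_weak_gradient \<Omega> u G) \<and>
     square_integrable_on (\<Omega> \<inter> upper_half_space) u \<and>
     square_integrable_on \<Omega> (\<lambda>z. \<bar>snd z\<bar> powr (\<beta> / 2) *\<^sub>R weak_gradient \<Omega> u z)}"

text \<open>
  The trace of \<open>v\<close>, a function on the open set \<open>U\<close>, at a point \<open>z\<close> of the closure of \<open>U\<close>, is the number
  \<open>t\<close> whose mean distance from \<open>v\<close> over \<open>ball z r \<inter> U\<close> tends to \<open>0\<close>.  For \<open>z \<in> U\<close> it is the value of
  the precise representative of \<open>v\<close> at the Lebesgue point \<open>z\<close>, hence \<open>v z\<close> if \<open>v\<close> is continuous there.
  If \<open>\<bar>\<beta>\<bar> < 1\<close>, the functions in \<open>H1 \<beta> U\<close> on a ball \<open>U\<close> are in \<open>W\<^sup>1\<^sup>,\<^sup>1(U)\<close>, so they have a trace at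
  almost every point of \<open>U \<inter> {y = 0}\<close> and of the sphere, with respect to \<open>n\<close>-dimensional measure.
  The integrability condition excludes the default value \<open>0\<close> of undefined integrals.
\<close>

definition has_trace_at ::
  "'a::euclidean_space set \<Rightarrow> ('a \<Rightarrow> real) \<Rightarrow> 'a \<Rightarrow> real \<Rightarrow> bool" where
  "has_trace_at U v z t \<longleftrightarrow>
     (\<forall>\<^sub>F r in at_right 0. v absolutely_integrable_on (ball z r \<inter> U)) \<and>
     ((\<lambda>r. (LINT w:ball z r \<inter> U|lebesgue. \<bar>v w - t\<bar>) / measure lebesgue (ball z r \<inter> U))
        \<longlongrightarrow> 0) (at_right 0)"

text \<open>
  The surface measure of a subset of the sphere is a fixed multiple of the Lebesgue measure of the
  cone over it with apex the centre.
\<close>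

definition surface_null :: "'a::euclidean_space \<Rightarrow> 'a set \<Rightarrow> bool" where
  "surface_null c N \<longleftrightarrow> negligible {c + s *\<^sub>R (z - c) | s z. 0 \<le> s \<and> s \<le> 1 \<and> z \<in> N}"

text \<open>\<open>v = u\<close> on the boundary of the ball, in the sense of traces.\<close>

definition eq_on_sphere ::
  "'a::euclidean_space \<Rightarrow> real \<Rightarrow> ('a \<Rightarrow> real) \<Rightarrow> ('a \<Rightarrow> real) \<Rightarrow> bool" where
  "eq_on_sphere c \<rho> v u \<longleftrightarrow>
     surface_null c {z \<in> sphere c \<rho>.
       \<not> (\<exists>t. has_trace_at (ball c \<rho>) v z t \<and> has_trace_at (ball c \<rho>) u z t)}"

definition f_eps :: "real \<Rightarrow> real \<Rightarrow> real \<Rightarrow> real" where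
  "f_eps \<omega> \<epsilon> s = (if s \<ge> \<omega> then 1 / \<epsilon> * (s - \<omega>) else \<epsilon> * (s - \<omega>))"

text \<open>\<open>{u > 0} \<inter> \<real>\<^sup>n \<inter> \<Omega>\<close>, where \<open>u\<close> is evaluated on \<open>{y = 0}\<close> through its trace.\<close>

definition positivity_trace :: "'n::finite pt set \<Rightarrow> ('n pt \<Rightarrow> real) \<Rightarrow> (real ^ 'n) set" where
  "positivity_trace \<Omega> u = {x. (x, 0) \<in> \<Omega> \<and> (\<exists>t>0. has_trace_at \<Omega> u (x, 0) t)}"

definition I_eps ::
  "real \<Rightarrow> real \<Rightarrow> real \<Rightarrow> ('n::finite pt \<Rightarrow> real) \<Rightarrow> 'n pt set \<Rightarrow> real" where
  "I_eps \<beta> \<omega> \<epsilon> u \<Omega> =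
     (LINT z:\<Omega>|lebesgue. \<bar>snd z\<bar> powr \<beta> * (norm (weak_gradient \<Omega> u z))\<^sup>2)
     + f_eps \<omega> \<epsilon> (measure lebesgue (positivity_trace \<Omega> u))"

definition local_minimizer ::
  "real \<Rightarrow> real \<Rightarrow> real \<Rightarrow> ('n::finite pt \<Rightarrow> real) \<Rightarrow> bool" where
  "local_minimizer \<beta> \<omega> \<epsilon> u \<longleftrightarrow>
     u \<in> H1 \<beta> (ball 0 1) \<and>
     (\<forall>c \<rho>. 0 < \<rho> \<longrightarrow> ball c \<rho> \<subseteq> ball 0 1 \<longrightarrow>
        (\<forall>v \<in> H1 \<beta> (ball c \<rho>). eq_on_sphere c \<rho> v u \<longrightarrow>
           I_eps \<beta> \<omega> \<epsilon> u (ball c \<rho>) \<le> I_eps \<beta> \<omega> \<epsilon> v (ball c \<rho>)))"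

definition positivity_set :: "('n::finite pt \<Rightarrow> real) \<Rightarrow> (real ^ 'n) set" where
  "positivity_set u = {x \<in> ball 0 1. u (x, 0) > 0}"

end

theory Submission
  imports Defs
begin

text \<open>
  Write \<open>\<beta> = 1 - 2\<alpha>\<close>, let \<open>q\<close> be the squared distance from a point of \<open>{y = 0}\<close> and \<open>p(t) = (max 0 t)\<^sup>2\<close>.
  Minimality is tested with competitors \<open>u + \<phi>\<close>, where \<open>\<phi>\<close> is a \<open>C\<^sup>1\<^sub>c\<close> function.

  If \<open>u > 0\<close> on the disc cut out of \<open>{y = 0}\<close> by a ball \<open>B\<close>, then adding \<open>t \<phi>\<close> cannot enlarge the
  positivity set in \<open>B\<close>, so \<open>u\<close> minimizes the weighted Dirichlet energy among these competitors and
  \<open>div (\<bar>y\<bar>\<^sup>\<beta> \<nabla>u) = 0\<close> weakly in \<open>B\<close> (\<open>minimizer_weighted_harmonic\<close>).  Such functions have an exact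
  mean value property at the points of \<open>{y = 0}\<close>, because \<open>\<bar>y\<bar>\<^sup>\<beta>\<close> is homogeneous with respect to these
  points.  Testing with a radial function gives \<open>\<gamma> A(t) = t A'(t)\<close> for
  \<open>A(t) = \<integral> \<bar>y\<bar>\<^sup>\<beta> u p(t - q)\<close>, with \<open>2 \<gamma> = n + 1 + \<beta> + 4\<close> (\<open>radial_identity\<close>), so \<open>A(t)\<close> is a constant
  multiple of \<open>t\<^sup>\<gamma>\<close>.  The same holds for the function 1, and comparison as \<open>t \<longrightarrow> 0\<close> yields
  \<open>A(t) = u(x,0) c t\<^sup>\<gamma>\<close> with a constant \<open>c > 0\<close> depending only on \<open>n\<close> and \<open>\<beta>\<close>
  (\<open>weighted_mean_value\<close>).

  Let \<open>M = u(x\<^sub>0,0)\<close> and suppose that \<open>u > 0\<close> on the disc of radius \<open>\<rho>\<close> about \<open>x\<^sub>0\<close>.  Comparing the mean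
  values at \<open>x\<close> and at \<open>x\<^sub>0\<close> bounds \<open>u(x,0)\<close> by \<open>C\<^sub>1 M\<close> for \<open>\<bar>x - x\<^sub>0\<bar> \<le> \<rho>/4\<close>
  (\<open>weighted_harmonic_sup_bound\<close>).  Now subtract from \<open>u\<close> a bump \<open>C\<^sub>1 M \<eta>\<close> with \<open>\<eta> \<ge> 1\<close> on the disc of
  radius \<open>\<rho>/8\<close>.  The competitor is not positive on that smaller disc, which lowers the volume
  term by at least a multiple of \<open>\<rho>\<^sup>n\<close>; by the Euler-Lagrange equation the mixed term in the energy
  vanishes, and the energy grows by \<open>C\<^sub>1\<^sup>2 M\<^sup>2 \<integral> \<bar>y\<bar>\<^sup>\<beta> \<bar>\<nabla>\<eta>\<bar>\<^sup>2\<close> only, a multiple of \<open>M\<^sup>2 \<rho>\<^sup>n\<^sup>-\<^sup>2\<^sup>\<alpha>\<close>.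
  Minimality forces \<open>M \<ge> C \<rho>\<^sup>\<alpha>\<close> (\<open>minimizer_scale_estimate\<close>), and \<open>\<rho>\<close> may be taken to be a quarter of the
  distance from \<open>x\<^sub>0\<close> to the free boundary.

  The energy refers to an arbitrarily chosen weak gradient on each ball.  It can be computed with
  any weak gradient because weak gradients are unique up to null sets
  (\<open>fundamental_lemma_calculus_of_variations\<close>).  Traces are point values because the functions compared
  are continuous up to the boundary of the ball (\<open>has_trace_at_iff\<close>).
\<close>

section \<open>Test functions\<close>

text \<open>Powers of the positive part with exponent at least 2 are \<open>C\<^sup>1\<close>; they serve as radial cutoffs with
  explicit derivatives.\<close>

lemma DERIV_pos_part_power:
  fixes t :: real
  shows "((\<lambda>t. (max 0 t) ^ (n + 2)) has_real_derivative real (n + 2) * (max 0 t) ^ (n + 1)) (at t)"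
proof -
  consider "t < 0" | "t > 0" | "t = 0" by linarith
  then show ?thesis
  proof cases
    case 1
    have "((\<lambda>t. 0) has_real_derivative 0) (at t)" by simp
    then have "((\<lambda>t. (max 0 t) ^ (n + 2)) has_real_derivative 0) (at t)"
      by (rule has_field_derivative_transform_within_open[of _ _ _ "{..<0}"]) (use 1 in auto)
    with 1 show ?thesis by simp
  next
    case 2
    have "((\<lambda>t. t ^ (n + 2)) has_real_derivative real (n + 2) * t ^ (n + 1)) (at t)"
      using DERIV_pow[of "n + 2" t] by simp
    then have "((\<lambda>t. (max 0 t) ^ (n + 2)) has_real_derivative real (n + 2) * t ^ (n + 1)) (at t)"
      by (rule has_field_derivative_transform_within_open[of _ _ _ "{0<..}"]) (use 2 in auto)
    with 2 show ?thesis by simp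
  next
    case 3
    have "((\<lambda>h. \<bar>h\<bar> ^ (n + 1)) \<longlongrightarrow> \<bar>0::real\<bar> ^ (n + 1)) (at 0)"
      by (intro tendsto_intros)
    then have lim: "((\<lambda>h::real. \<bar>h\<bar> ^ (n + 1)) \<longlongrightarrow> 0) (at 0)" by simp
    have "((\<lambda>h. (max 0 h) ^ (n + 2) / h) \<longlongrightarrow> 0) (at (0::real))"
    proof (rule Lim_null_comparison[OF _ lim])
      have "norm (max 0 h ^ (n + 2) / h) \<le> \<bar>h\<bar> ^ (n + 1)" for h :: real
        using zero_le_power[OF abs_ge_zero, of h "n + 1"]
        by (cases "h > 0") (simp_all add: max_absorb1 max_absorb2)
      then show "\<forall>\<^sub>F h in at 0. norm (max 0 h ^ (n + 2) / h) \<le> \<bar>h\<bar> ^ (n + 1)" by simp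
    qed
    with 3 show ?thesis by (simp add: DERIV_def)
  qed
qed

lemma GDERIV_norm_power2: "GDERIV (\<lambda>z. (norm (z - \<zeta>))\<^sup>2) z :> 2 *\<^sub>R (z - \<zeta>)"
  unfolding gderiv_def power2_norm_eq_inner
  by (auto intro!: derivative_eq_intros simp: inner_commute algebra_simps)

lemma test_function_radial:
  fixes F F' :: "real \<Rightarrow> real"
  assumes F: "\<And>q. (F has_real_derivative F' q) (at q)" and F': "continuous_on UNIV F'"
    and "\<And>q. q \<ge> \<tau> \<Longrightarrow> F q = 0" and "cball \<zeta> (sqrt \<tau>) \<subseteq> \<Omega>"
  shows "test_function \<Omega> (\<lambda>z. F ((norm (z - \<zeta>))\<^sup>2)) (\<lambda>z. (2 * F' ((norm (z - \<zeta>))\<^sup>2)) *\<^sub>R (z - \<zeta>))"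
  unfolding test_function_def
proof (intro conjI allI exI)
  fix z
  have "GDERIV (\<lambda>z. F ((norm (z - \<zeta>))\<^sup>2)) z :> F' ((norm (z - \<zeta>))\<^sup>2) *\<^sub>R (2 *\<^sub>R (z - \<zeta>))"
    by (rule GDERIV_DERIV_compose[OF GDERIV_norm_power2 F])
  then show "GDERIV (\<lambda>z. F ((norm (z - \<zeta>))\<^sup>2)) z :> (2 * F' ((norm (z - \<zeta>))\<^sup>2)) *\<^sub>R (z - \<zeta>)"
    by (simp add: mult.commute)
  show "continuous_on UNIV (\<lambda>z. (2 * F' ((norm (z - \<zeta>))\<^sup>2)) *\<^sub>R (z - \<zeta>))"
    by (intro continuous_intros continuous_on_compose2[OF F']) auto
  show "z \<notin> cball \<zeta> (sqrt \<tau>) \<longrightarrow> F ((norm (z - \<zeta>))\<^sup>2) = 0"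
    using sqrt_le_D[of \<tau> "norm (z - \<zeta>)"] by (auto simp: dist_norm norm_minus_commute intro!: assms(3))
qed (use assms in auto)

lemma test_function_cutoff:
  assumes "cball \<zeta> (sqrt \<tau>) \<subseteq> \<Omega>"
  shows "test_function \<Omega> (\<lambda>z. (max 0 (\<tau> - (norm (z - \<zeta>))\<^sup>2)) ^ (n + 2))
      (\<lambda>z. (- 2 * real (n + 2) * (max 0 (\<tau> - (norm (z - \<zeta>))\<^sup>2)) ^ (n + 1)) *\<^sub>R (z - \<zeta>))"
proof -
  have "test_function \<Omega> (\<lambda>z. (max 0 (\<tau> - (norm (z - \<zeta>))\<^sup>2)) ^ (n + 2))
      (\<lambda>z. (2 * (- real (n + 2) * (max 0 (\<tau> - (norm (z - \<zeta>))\<^sup>2)) ^ (n + 1))) *\<^sub>R (z - \<zeta>))"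
  proof (rule test_function_radial[where F = "\<lambda>q. (max 0 (\<tau> - q)) ^ (n + 2)" 
        and F' = "\<lambda>q. - real (n + 2) * (max 0 (\<tau> - q)) ^ (n + 1)"])
    fix q
    have "((\<lambda>q. (max 0 (\<tau> - q)) ^ (n + 2)) has_real_derivative 
        real (n + 2) * (max 0 (\<tau> - q)) ^ (n + 1) * (- 1)) (at q)"
      by (rule DERIV_chain2[OF DERIV_pos_part_power]) (auto intro!: derivative_eq_intros)
    then show "((\<lambda>q. (max 0 (\<tau> - q)) ^ (n + 2)) has_real_derivative 
        - real (n + 2) * (max 0 (\<tau> - q)) ^ (n + 1)) (at q)"
      by (simp only: mult_minus_right mult_minus_left mult_1_right)
  qed (use assms in \<open>auto intro!: continuous_intros\<close>)
  then show ?thesis by (simp only: mult_minus_left mult_minus_right mult.assoc)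
qed

lemma test_function_mono: "test_function \<Omega> \<phi> D \<Longrightarrow> \<Omega> \<subseteq> \<Omega>' \<Longrightarrow> test_function \<Omega>' \<phi> D"
  unfolding test_function_def by (meson order_trans)

lemma test_function_cmult:
  "test_function \<Omega> \<phi> D \<Longrightarrow> test_function \<Omega> (\<lambda>z. c * \<phi> z) (\<lambda>z. c *\<^sub>R D z)"
  unfolding test_function_def
  using GDERIV_mult[OF GDERIV_const, of \<phi> _ _ c] 
  by (auto intro!: continuous_intros; meson mult_zero_right)

lemma test_function_mult_C1:
  assumes "test_function \<Omega> \<phi> D" "\<And>z. GDERIV \<psi> z :> E z" "continuous_on UNIV E"
  shows "test_function \<Omega> (\<lambda>z. \<phi> z * \<psi> z) (\<lambda>z. \<phi> z *\<^sub>R E z + \<psi> z *\<^sub>R D z)"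
proof -
  have c: "continuous_on UNIV f" if "\<And>z. GDERIV f z :> E z" for f :: "'a \<Rightarrow> real" and E
    using that[unfolded gderiv_def, THEN has_derivative_continuous]
    by (simp add: continuous_at_imp_continuous_on)
  have \<phi>: "\<And>z. GDERIV \<phi> z :> D z" "continuous_on UNIV D"
    "\<exists>K. compact K \<and> K \<subseteq> \<Omega> \<and> (\<forall>z. z \<notin> K \<longrightarrow> \<phi> z = 0)"
    using assms(1) unfolding test_function_def by blast+
  show ?thesis
    unfolding test_function_def
  proof (intro conjI allI)
    show "GDERIV (\<lambda>z. \<phi> z * \<psi> z) z :> \<phi> z *\<^sub>R E z + \<psi> z *\<^sub>R D z" for z
      by (rule GDERIV_mult[OF \<phi>(1) assms(2)])
    show "continuous_on UNIV (\<lambda>z. \<phi> z *\<^sub>R E z + \<psi> z *\<^sub>R D z)"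
      by (intro continuous_intros \<phi>(2) assms(3) c[OF \<phi>(1)] c[OF assms(2)])
    show "\<exists>K. compact K \<and> K \<subseteq> \<Omega> \<and> (\<forall>z. z \<notin> K \<longrightarrow> \<phi> z * \<psi> z = 0)"
      using \<phi>(3) by auto
  qed
qed

lemma test_function_continuous: "test_function \<Omega> \<phi> D \<Longrightarrow> continuous_on S \<phi>"
  unfolding test_function_def gderiv_def
  by (auto intro!: continuous_at_imp_continuous_on dest: has_derivative_continuous)

lemma test_function_gradient_support:
  assumes "test_function \<Omega> \<phi> D"
  obtains K where "compact K" "K \<subseteq> \<Omega>" "\<And>z. z \<notin> K \<Longrightarrow> \<phi> z = 0" "\<And>z. z \<notin> K \<Longrightarrow> D z = 0"
proof -
  obtain K where K: "compact K" "K \<subseteq> \<Omega>" "\<And>z. z \<notin> K \<Longrightarrow> \<phi> z = 0"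
    using assms unfolding test_function_def by blast
  have "D z = 0" if "z \<notin> K" for z
  proof -
    have "(\<phi> has_derivative (\<lambda>h. inner h (D z))) (at z)"
      using assms unfolding test_function_def gderiv_def by blast
    moreover have "(\<phi> has_derivative (\<lambda>h. 0)) (at z)"
      by (rule has_derivative_transform_within_open[OF has_derivative_const, of "- K" _ 0])
         (use K that compact_imp_closed in auto)
    ultimately have "(\<lambda>h. inner h (D z)) = (\<lambda>h. 0)"
      by (rule has_derivative_unique)
    then show ?thesis by (metis inner_eq_zero_iff)
  qed
  with K show ?thesis using that by blast
qed

text \<open>
  By translation invariance the difference quotients of \<open>\<phi>\<close> in a coordinate direction have integral 0,
  and they converge to the partial derivative, dominated by a Lipschitz constant on a bounded set.
\<close>

lemma test_function_integral_gradient: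
  fixes \<phi> :: "'a::euclidean_space \<Rightarrow> real"
  assumes \<phi>: "test_function \<Omega> \<phi> D"
  shows "(LINT z:\<Omega>|lebesgue. D z) = 0"
proof -
  obtain K where K: "compact K" "K \<subseteq> \<Omega>" "\<And>z. z \<notin> K \<Longrightarrow> \<phi> z = 0" "\<And>z. z \<notin> K \<Longrightarrow> D z = 0"
    using test_function_gradient_support[OF \<phi>] by blast
  have D: "continuous_on UNIV D" and der: "\<And>z. (\<phi> has_derivative (\<lambda>h. inner h (D z))) (at z)"
    using \<phi> unfolding test_function_def gderiv_def by auto
  have \<phi>m: "\<phi> \<in> borel_measurable borel"
    using test_function_continuous[OF \<phi>] by (rule borel_measurable_continuous_onI)
  have Dm: "D \<in> borel_measurable borel"
    using D by (rule borel_measurable_continuous_onI)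
  obtain R where R: "R > 0" "K \<subseteq> ball 0 R"
    using K(1) compact_imp_bounded bounded_subset_ballD by blast
  obtain L where L: "\<And>z. norm (D z) \<le> L"
  proof -
    have "bounded (D ` K)" 
      using D K(1) by (meson compact_continuous_image compact_imp_bounded continuous_on_subset subset_UNIV)
    then obtain L where L: "\<forall>z\<in>K. norm (D z) \<le> L" "0 < L" unfolding bounded_pos by auto
    have "norm (D z) \<le> L" for z using L K(4)[of z] by (cases "z \<in> K") auto
    then show ?thesis using that by blast
  qed
  have "L \<ge> 0" using order_trans[OF norm_ge_zero L] .
  have lip: "\<bar>\<phi> z - \<phi> w\<bar> \<le> L * norm (z - w)" for z w
  proof -
    have "norm (\<phi> z - \<phi> w) \<le> L * norm (z - w)"
    proof (rule differentiable_bound[of UNIV])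
      show "onorm (\<lambda>h. inner h (D x)) \<le> L" for x
        by (rule onorm_le) (metis Cauchy_Schwarz_ineq2 L mult.commute mult_left_mono norm_ge_zero order_trans real_norm_def)
    qed (use der in \<open>auto intro: has_derivative_at_withinI\<close>)
    then show ?thesis by simp
  qed
  have int\<phi>: "integrable lborel \<phi>"
  proof -
    have "set_integrable lborel K \<phi>" unfolding set_integrable_def
      by (rule borel_integrable_compact[OF K(1) test_function_continuous[OF \<phi>]])
    then show ?thesis unfolding set_integrable_def
      by (rule Bochner_Integration.integrable_cong[THEN iffD1, rotated -1])
         (use K(3) in \<open>auto simp: indicator_def\<close>)
  qed
  have comp: "integral\<^sup>L lborel (\<lambda>z. inner (D z) b) = 0" if b: "b \<in> Basis" for b
  proof -
    define h :: "nat \<Rightarrow> real" where "h k = inverse (real (Suc k))" for k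
    have h: "h k > 0" "h k \<le> 1" for k by (auto simp: h_def field_simps)
    have h0: "h \<longlonglongrightarrow> 0" unfolding h_def by (rule LIMSEQ_inverse_real_of_nat)
    define g where "g k z = (\<phi> (h k *\<^sub>R b + z) - \<phi> z) / h k" for k z
    have "(\<lambda>k. integral\<^sup>L lborel (g k)) \<longlonglongrightarrow> integral\<^sup>L lborel (\<lambda>z. inner (D z) b)"
    proof (rule integral_dominated_convergence)
      show "(\<lambda>z. inner (D z) b) \<in> borel_measurable lborel" "\<And>k. g k \<in> borel_measurable lborel"
        using Dm \<phi>m unfolding g_def by measurable
      show "integrable lborel (\<lambda>z::'a. indicator (cball 0 (R + 1)) z *\<^sub>R L)"
        using borel_integrable_compact[of "cball 0 (R+1)" "\<lambda>z::'a. L"] by (simp add: set_integrable_def)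
      show "AE z in lborel. (\<lambda>k. g k z) \<longlonglongrightarrow> inner (D z) b"
      proof (rule AE_I2)
        fix z
        have "((\<lambda>t. \<phi> (t *\<^sub>R b + z)) has_derivative (\<lambda>t. inner (t *\<^sub>R b) (D (0 *\<^sub>R b + z)))) (at 0)"
          by (rule has_derivative_compose[of "\<lambda>t. t *\<^sub>R b + z" "\<lambda>t. t *\<^sub>R b"])
             (auto intro!: derivative_eq_intros der)
        then have "((\<lambda>t. \<phi> (t *\<^sub>R b + z)) has_real_derivative inner (D z) b) (at 0)"
          by (simp add: has_field_derivative_def inner_commute mult.commute[of _ "inner _ _"])
        then have "((\<lambda>t. (\<phi> (t *\<^sub>R b + z) - \<phi> z) / t) \<longlongrightarrow> inner (D z) b) (at 0)"
          by (simp add: DERIV_def)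
        moreover have "filterlim h (at 0) sequentially"
          using h0 h by (auto simp: filterlim_at intro!: always_eventually) (metis less_irrefl)
        ultimately show "(\<lambda>k. g k z) \<longlonglongrightarrow> inner (D z) b"
          unfolding g_def by (rule filterlim_compose)
      qed
      show "AE z in lborel. norm (g k z) \<le> indicator (cball 0 (R + 1)) z *\<^sub>R L" for k
      proof (rule AE_I2)
        fix z :: 'a
        show "norm (g k z) \<le> indicator (cball 0 (R + 1)) z *\<^sub>R L"
        proof (cases "z \<in> cball 0 (R+1)")
          case True
          have "\<bar>\<phi> (h k *\<^sub>R b + z) - \<phi> z\<bar> \<le> L * h k"
            using lip[of "h k *\<^sub>R b + z" z] h(1)[of k] b by simp
          then show ?thesis using True h(1)[of k] by (simp add: g_def field_simps)
        next
          case False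
          have "norm z - norm (h k *\<^sub>R b) \<le> norm (h k *\<^sub>R b + z)"
            by (metis add.commute norm_diff_ineq)
          then have "norm (h k *\<^sub>R b + z) > R" "norm z > R" using False h[of k] b by auto
          then have "z \<notin> K" "h k *\<^sub>R b + z \<notin> K" using R by force+
          then show ?thesis using K False by (simp add: g_def)
        qed
      qed
    qed
    moreover have "integral\<^sup>L lborel (g k) = 0" for k
    proof -
      have "integral\<^sup>L (distr lborel borel ((+) (h k *\<^sub>R b))) \<phi> = integral\<^sup>L lborel (\<lambda>z. \<phi> (h k *\<^sub>R b + z))"
        by (rule integral_distr) (use \<phi>m in auto)
      moreover have "integrable (distr lborel borel ((+) (h k *\<^sub>R b))) \<phi>"
        using int\<phi> by (simp add: lborel_distr_plus)
      then have "integrable lborel (\<lambda>z. \<phi> (h k *\<^sub>R b + z))"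
        by (subst (asm) integrable_distr_eq) (use \<phi>m in auto)
      ultimately show ?thesis unfolding g_def using int\<phi> by (simp add: lborel_distr_plus)
    qed
    ultimately show ?thesis by (simp add: LIMSEQ_const_iff)
  qed
  have intD: "integrable lborel D"
  proof -
    have "set_integrable lborel K D" unfolding set_integrable_def
      by (rule borel_integrable_compact[OF K(1)]) (use D continuous_on_subset in blast)
    then show ?thesis unfolding set_integrable_def
      by (rule Bochner_Integration.integrable_cong[THEN iffD1, rotated -1])
         (use K in \<open>auto simp: indicator_def\<close>)
  qed
  have "inner (integral\<^sup>L lborel D) b = 0" if "b \<in> Basis" for b
    using comp[OF that] intD by (simp add: integral_inner_left)
  then have "integral\<^sup>L lborel D = 0" by (metis euclidean_all_zero_iff)
  moreover have "(LINT z:\<Omega>|lebesgue. D z) = integral\<^sup>L lebesgue D"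
    unfolding set_lebesgue_integral_def 
    by (rule Bochner_Integration.integral_cong) (use K in \<open>auto simp: indicator_def\<close>)
  moreover have "integral\<^sup>L lebesgue D = integral\<^sup>L lborel D"
    using Dm by (simp add: integral_completion)
  ultimately show ?thesis by simp
qed

section \<open>The fundamental lemma of the calculus of variations\<close>

lemma absolutely_integrable_scaleR_continuous:
  fixes f :: "'a::euclidean_space \<Rightarrow> 'b::euclidean_space"
  assumes "compact K" "continuous_on K g" "f absolutely_integrable_on K"
  shows "(\<lambda>z. g z *\<^sub>R f z) absolutely_integrable_on K"
proof (rule absolutely_integrable_bounded_measurable_product[where h = "(*\<^sub>R)"])
  show "K \<in> sets lebesgue" using assms(1) by (simp add: lmeasurable_compact fmeasurableD)
  then show "g \<in> borel_measurable (lebesgue_on K)"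
    by (rule continuous_imp_measurable_on_sets_lebesgue[OF assms(2)])
  show "bounded (g ` K)" using assms by (simp add: compact_continuous_image compact_imp_bounded)
qed (use assms in \<open>auto simp: bilinear_conv_bounded_bilinear bounded_bilinear_scaleR\<close>)

lemma absolutely_integrable_inner_continuous:
  fixes f :: "'a::euclidean_space \<Rightarrow> 'b::euclidean_space"
  assumes "compact K" "continuous_on K g" "f absolutely_integrable_on K"
  shows "(\<lambda>z. f z \<bullet> g z) absolutely_integrable_on K"
proof -
  have "(\<lambda>z. g z \<bullet> f z) absolutely_integrable_on K"
  proof (rule absolutely_integrable_bounded_measurable_product[where h = "(\<bullet>)"])
    show "K \<in> sets lebesgue" using assms(1) by (simp add: lmeasurable_compact fmeasurableD)
    then show "g \<in> borel_measurable (lebesgue_on K)"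
      by (rule continuous_imp_measurable_on_sets_lebesgue[OF assms(2)])
    show "bounded (g ` K)" using assms by (simp add: compact_continuous_image compact_imp_bounded)
  qed (use assms in \<open>auto simp: bilinear_conv_bounded_bilinear bounded_bilinear_inner\<close>)
  then show ?thesis by (simp add: inner_commute)
qed

text \<open>The two integrands, extended by 0 off their domains, are the same function.\<close>

lemma set_integral_cong_support:
  assumes "\<And>z. z \<in> A - B \<Longrightarrow> f z = 0" "\<And>z. z \<in> B - A \<Longrightarrow> f z = 0"
  shows "(LINT z:A|M. f z) = (LINT z:B|M. f z)"
  unfolding set_lebesgue_integral_def
  by (rule Bochner_Integration.integral_cong) (use assms in \<open>auto simp: indicator_def\<close>)

lemma set_integrable_cong_support:
  assumes "\<And>z. z \<in> A - B \<Longrightarrow> f z = 0" "\<And>z. z \<in> B - A \<Longrightarrow> f z = 0"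
  shows "set_integrable M A f \<longleftrightarrow> set_integrable M B f"
  unfolding set_integrable_def
  by (rule Bochner_Integration.integrable_cong) (use assms in \<open>auto simp: indicator_def\<close>)

lemma test_function_compose:
  assumes \<phi>: "test_function \<Omega> \<phi> D" and G: "\<And>t. (G has_real_derivative G' t) (at t)"
    and G': "continuous_on UNIV G'" and "G 0 = 0"
  shows "test_function \<Omega> (\<lambda>z. G (\<phi> z)) (\<lambda>z. G' (\<phi> z) *\<^sub>R D z)"
proof -
  have *: "\<And>z. GDERIV \<phi> z :> D z" "continuous_on UNIV D"
    "\<exists>K. compact K \<and> K \<subseteq> \<Omega> \<and> (\<forall>z. z \<notin> K \<longrightarrow> \<phi> z = 0)"
    using \<phi> unfolding test_function_def by blast+
  show ?thesis
    unfolding test_function_def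
  proof (intro conjI allI)
    show "GDERIV (\<lambda>z. G (\<phi> z)) z :> G' (\<phi> z) *\<^sub>R D z" for z
      by (rule GDERIV_DERIV_compose[OF *(1) G])
    show "continuous_on UNIV (\<lambda>z. G' (\<phi> z) *\<^sub>R D z)"
      by (intro continuous_intros *(2) continuous_on_compose2[OF G'] test_function_continuous[OF \<phi>]) auto
    show "\<exists>K. compact K \<and> K \<subseteq> \<Omega> \<and> (\<forall>z. z \<notin> K \<longrightarrow> G (\<phi> z) = 0)"
      using *(3) \<open>G 0 = 0\<close> by metis
  qed
qed

lemma test_function_sum:
  assumes "finite I" "\<And>i. i \<in> I \<Longrightarrow> test_function \<Omega> (\<phi> i) (D i)"
  shows "test_function \<Omega> (\<lambda>z. \<Sum>i\<in>I. \<phi> i z) (\<lambda>z. \<Sum>i\<in>I. D i z)"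
  using assms
proof (induction rule: finite_induct)
  case empty
  have "test_function \<Omega> (\<lambda>z. 0) (\<lambda>z. 0)"
    unfolding test_function_def by (auto intro: GDERIV_const intro!: exI[of _ "{}"])
  then show ?case by simp
next
  case (insert i I)
  have 1: "test_function \<Omega> (\<phi> i) (D i)" 
    and 2: "test_function \<Omega> (\<lambda>z. \<Sum>i\<in>I. \<phi> i z) (\<lambda>z. \<Sum>i\<in>I. D i z)"
    using insert by auto
  obtain K L where "compact K" "K \<subseteq> \<Omega>" "\<forall>z. z \<notin> K \<longrightarrow> \<phi> i z = 0"
    "compact L" "L \<subseteq> \<Omega>" "\<forall>z. z \<notin> L \<longrightarrow> (\<Sum>i\<in>I. \<phi> i z) = 0"
    using 1 2 unfolding test_function_def by blast
  then have "\<exists>K. compact K \<and> K \<subseteq> \<Omega> \<and> (\<forall>z. z \<notin> K \<longrightarrow> \<phi> i z + (\<Sum>i\<in>I. \<phi> i z) = 0)"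
    by (intro exI[of _ "K \<union> L"]) auto
  moreover have "GDERIV (\<lambda>z. \<phi> i z + (\<Sum>i\<in>I. \<phi> i z)) z :> D i z + (\<Sum>i\<in>I. D i z)" for z
    by (rule GDERIV_add) (use 1 2 in \<open>auto simp: test_function_def\<close>)
  moreover have "continuous_on UNIV (\<lambda>z. D i z + (\<Sum>i\<in>I. D i z))"
    by (rule continuous_on_add) (use 1 2 in \<open>auto simp: test_function_def\<close>)
  ultimately show ?case using insert.hyps unfolding test_function_def by simp
qed

text \<open>
  The function \<open>f = \<Sum>c\<in>F. (max 0 (r\<^sup>2 - \<bar>z - c\<bar>\<^sup>2))\<^sup>2\<close> is \<open>C\<^sup>1\<close> and positive exactly on the union of the balls, so the
  test functions \<open>1 - exp (- k f)\<close> increase to the indicator of the union.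
\<close>

lemma integral_Union_balls_eq_0:
  fixes g :: "'a::euclidean_space \<Rightarrow> 'b::euclidean_space"
  assumes g: "locally_integrable_on \<Omega> g"
    and zero: "\<And>\<phi> D. test_function \<Omega> \<phi> D \<Longrightarrow> (LINT z:\<Omega>|lebesgue. \<phi> z *\<^sub>R g z) = 0"
    and F: "finite F" and r: "r > 0" and sub: "(\<Union>c\<in>F. cball c r) \<subseteq> \<Omega>"
  shows "(LINT z:(\<Union>c\<in>F. ball c r)|lebesgue. g z) = 0"
proof -
  define f where "f z = (\<Sum>c\<in>F. (max 0 (r\<^sup>2 - (norm (z - c))\<^sup>2))\<^sup>2)" for z :: 'a
  define V where "V = (\<Union>c\<in>F. ball c r)"
  define K where "K = (\<Union>c\<in>F. cball c r)"
  have K: "compact K" "K \<subseteq> \<Omega>" unfolding K_def using F sub by auto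
  obtain D where fD: "test_function \<Omega> f D"
  proof -
    have "test_function \<Omega> (\<lambda>z. (max 0 (r\<^sup>2 - (norm (z - c))\<^sup>2))\<^sup>2)
      (\<lambda>z. (- 4 * max 0 (r\<^sup>2 - (norm (z - c))\<^sup>2)) *\<^sub>R (z - c))" if "c \<in> F" for c
      using test_function_cutoff[of c "r\<^sup>2" \<Omega> 0] that r sub 
      by (simp add: power2_eq_square UN_subset_iff)
    then have "test_function \<Omega> (\<lambda>z. \<Sum>c\<in>F. (max 0 (r\<^sup>2 - (norm (z - c))\<^sup>2))\<^sup>2)
      (\<lambda>z. \<Sum>c\<in>F. (- 4 * max 0 (r\<^sup>2 - (norm (z - c))\<^sup>2)) *\<^sub>R (z - c))"
      by (intro test_function_sum[OF F])
    then show ?thesis unfolding f_def[symmetric] by (rule that)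
  qed
  have f_pos: "f z > 0" if z: "z \<in> V" for z
  proof -
    obtain c where c: "c \<in> F" "dist c z < r" using z unfolding V_def by auto
    have "(norm (z - c))\<^sup>2 < r\<^sup>2" using c by (intro power_strict_mono) (auto simp: dist_norm norm_minus_commute)
    then have "(max 0 (r\<^sup>2 - (norm (z - c))\<^sup>2))\<^sup>2 > 0" by simp
    then show ?thesis unfolding f_def using c F by (intro sum_pos2) auto
  qed
  have f_nonneg: "f z \<ge> 0" for z unfolding f_def by (intro sum_nonneg) auto
  have f_0: "f z = 0" if "z \<notin> V" for z
  proof -
    have "(max 0 (r\<^sup>2 - (norm (z - c))\<^sup>2))\<^sup>2 = 0" if "c \<in> F" for c
    proof -
      have "r \<le> norm (z - c)" using \<open>z \<notin> V\<close> that by (auto simp: V_def dist_norm norm_minus_commute)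
      then have "r\<^sup>2 \<le> (norm (z - c))\<^sup>2" using r by (intro power_mono) auto
      then show ?thesis by simp
    qed
    then show ?thesis unfolding f_def by simp
  qed
  have VK: "V \<subseteq> K" unfolding V_def K_def by auto
  define \<phi> where "\<phi> k z = 1 - exp (- (real k * f z))" for k z
  have test: "\<exists>E. test_function \<Omega> (\<phi> k) E" for k
    unfolding \<phi>_def
    by (rule exI, rule test_function_compose[OF fD, where G = "\<lambda>t. 1 - exp (- (real k * t))" 
          and G' = "\<lambda>t. real k * exp (- (real k * t))"])
       (auto intro!: derivative_eq_intros continuous_intros)
  have gK: "integrable lebesgue (\<lambda>z. indicator K z *\<^sub>R g z)"
    using g K unfolding locally_integrable_on_def set_integrable_def by blast
  then have gKm: "(\<lambda>z. indicator K z *\<^sub>R g z) \<in> borel_measurable lebesgue" by simp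
  have "(\<lambda>k. LINT z|lebesgue. \<phi> k z *\<^sub>R (indicator K z *\<^sub>R g z))
     \<longlonglongrightarrow> (LINT z|lebesgue. indicator V z *\<^sub>R (indicator K z *\<^sub>R g z))"
  proof (rule integral_dominated_convergence)
    have "open V" unfolding V_def by auto
    then have "V \<in> sets lebesgue" by (intro sets_completionI_sets) auto
    then show "(\<lambda>z. indicator V z *\<^sub>R (indicator K z *\<^sub>R g z)) \<in> borel_measurable lebesgue"
      using gKm by measurable
    show "(\<lambda>z. \<phi> k z *\<^sub>R (indicator K z *\<^sub>R g z)) \<in> borel_measurable lebesgue" for k
    proof -
      have "\<phi> k \<in> borel_measurable lborel"
        using test[of k] by (auto intro!: borel_measurable_continuous_onI dest: test_function_continuous)
      then have "\<phi> k \<in> borel_measurable lebesgue" by (rule measurable_completion)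
      then show ?thesis using gKm by measurable
    qed
    show "integrable lebesgue (\<lambda>z. norm (indicator K z *\<^sub>R g z))"
      using gK by (rule integrable_norm)
    show "AE z in lebesgue. norm (\<phi> k z *\<^sub>R (indicator K z *\<^sub>R g z)) \<le> norm (indicator K z *\<^sub>R g z)" for k
    proof (rule AE_I2)
      fix z
      have "\<bar>\<phi> k z\<bar> \<le> 1" using f_nonneg[of z] by (simp add: \<phi>_def)
      then have "norm (\<phi> k z *\<^sub>R x) \<le> norm x" for x :: 'b
        by (simp add: mult_left_le_one_le)
      then show "norm (\<phi> k z *\<^sub>R (indicator K z *\<^sub>R g z)) \<le> norm (indicator K z *\<^sub>R g z)" .
    qed
    show "AE z in lebesgue. (\<lambda>k. \<phi> k z *\<^sub>R (indicator K z *\<^sub>R g z))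
       \<longlonglongrightarrow> indicator V z *\<^sub>R (indicator K z *\<^sub>R g z)"
    proof (rule AE_I2)
      fix z
      have "(\<lambda>k. \<phi> k z) \<longlonglongrightarrow> indicator V z"
      proof (cases "z \<in> V")
        case True
        have "(\<lambda>k. exp (- f z) ^ k) \<longlonglongrightarrow> 0"
          using f_pos[OF True] by (intro LIMSEQ_realpow_zero) auto
        then have "(\<lambda>k. 1 - exp (- f z) ^ k) \<longlonglongrightarrow> 1 - 0"
          by (rule tendsto_diff[OF tendsto_const])
        then show ?thesis using True by (simp add: \<phi>_def exp_of_nat_mult[symmetric])
      next
        case False
        then show ?thesis using f_0[OF False] by (simp add: \<phi>_def)
      qed
      then show "(\<lambda>k. \<phi> k z *\<^sub>R (indicator K z *\<^sub>R g z))
         \<longlonglongrightarrow> indicator V z *\<^sub>R (indicator K z *\<^sub>R g z)"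
        by (intro tendsto_scaleR tendsto_const)
    qed
  qed
  moreover have "(LINT z|lebesgue. \<phi> k z *\<^sub>R (indicator K z *\<^sub>R g z)) = 0" for k
  proof -
    have "(LINT z|lebesgue. \<phi> k z *\<^sub>R (indicator K z *\<^sub>R g z)) = (LINT z:\<Omega>|lebesgue. \<phi> k z *\<^sub>R g z)"
      unfolding set_lebesgue_integral_def
    proof (rule Bochner_Integration.integral_cong)
      fix z
      have "z \<notin> K \<Longrightarrow> \<phi> k z = 0" using f_0[of z] VK by (auto simp: \<phi>_def)
      then show "\<phi> k z *\<^sub>R indicat_real K z *\<^sub>R g z = indicat_real \<Omega> z *\<^sub>R \<phi> k z *\<^sub>R g z"
        using K(2) by (auto simp: indicator_def)
    qed auto
    moreover obtain E where "test_function \<Omega> (\<phi> k) E" using test[of k] by (rule exE)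
    ultimately show ?thesis using zero[of "\<phi> k" E] by simp
  qed
  ultimately have "(LINT z|lebesgue. indicator V z *\<^sub>R (indicator K z *\<^sub>R g z)) = 0"
    by (simp add: LIMSEQ_const_iff)
  moreover have "(\<lambda>z. indicat_real V z *\<^sub>R (indicator K z *\<^sub>R g z)) = (\<lambda>z. indicat_real V z *\<^sub>R g z)"
    using VK by (auto simp: indicator_def fun_eq_iff)
  ultimately show ?thesis by (simp add: set_lebesgue_integral_def V_def)
qed

text \<open>
  A compact set is the limit of finite unions of balls with centres in it and radii tending to 0.
\<close>

lemma integral_compact_eq_0:
  fixes g :: "'a::euclidean_space \<Rightarrow> 'b::euclidean_space"
  assumes "open \<Omega>" and g: "locally_integrable_on \<Omega> g"
    and zero: "\<And>\<phi> D. test_function \<Omega> \<phi> D \<Longrightarrow> (LINT z:\<Omega>|lebesgue. \<phi> z *\<^sub>R g z) = 0"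
    and C: "compact C" "C \<subseteq> \<Omega>"
  shows "(LINT z:C|lebesgue. g z) = 0"
proof (cases "C = {}")
  case False
  obtain \<delta> where \<delta>: "\<delta> > 0" "(\<Union>c\<in>C. cball c \<delta>) \<subseteq> \<Omega>"
    using compact_subset_open_imp_cball_epsilon_subset[OF C(1) \<open>open \<Omega>\<close> C(2)] by blast
  define r where "r n = min \<delta> (inverse (real (Suc n)))" for n
  have r: "r n > 0" "r n \<le> \<delta>" "r n \<le> inverse (real (Suc n))" for n using \<delta> by (auto simp: r_def)
  have "\<exists>F. finite F \<and> F \<subseteq> C \<and> C \<subseteq> (\<Union>c\<in>F. ball c (r n))" for n
  proof -
    have "C \<subseteq> (\<Union>c\<in>C. ball c (r n))" using r(1)[of n] by auto
    then obtain D where "D \<subseteq> C" "finite D" "C \<subseteq> (\<Union>c\<in>D. ball c (r n))"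
      by (rule compactE_image[OF C(1), of C "\<lambda>c. ball c (r n)", rotated]) auto
    then show ?thesis by (intro exI[of _ D]) simp
  qed
  then obtain F where F: "\<And>n. finite (F n)" "\<And>n. F n \<subseteq> C" "\<And>n. C \<subseteq> (\<Union>c\<in>F n. ball c (r n))"
    by metis
  define V where "V n = (\<Union>c\<in>F n. ball c (r n))" for n
  define K where "K = {z. infdist z C \<le> \<delta>}"
  have K: "compact K" unfolding K_def using False C(1) \<delta>(1) by (intro compact_infdist_le) auto
  have "K \<subseteq> (\<Union>c\<in>C. cball c \<delta>)"
  proof
    fix z assume "z \<in> K"
    moreover obtain c where "c \<in> C" "infdist z C = dist z c"
      using infdist_attains_inf[OF compact_imp_closed[OF C(1)] False] by metis
    ultimately show "z \<in> (\<Union>c\<in>C. cball c \<delta>)" by (auto simp: K_def dist_commute)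
  qed
  with \<delta> have K\<Omega>: "K \<subseteq> \<Omega>" by blast
  have near: "infdist z C < r n" if z: "z \<in> V n" for z n
  proof -
    obtain c where c: "c \<in> F n" "dist c z < r n" using z by (auto simp: V_def)
    then have "infdist z C \<le> dist z c" using F(2)[of n] by (intro infdist_le) auto
    then show ?thesis using c by (simp add: dist_commute)
  qed
  have VK: "V n \<subseteq> K" for n using near[of _ n] r(2)[of n] by (force simp: K_def)
  have gK: "integrable lebesgue (\<lambda>z. indicator K z *\<^sub>R g z)"
    using g K K\<Omega> unfolding locally_integrable_on_def set_integrable_def by blast
  then have gKm: "(\<lambda>z. indicator K z *\<^sub>R g z) \<in> borel_measurable lebesgue" by simp
  have "(\<lambda>n. LINT z|lebesgue. indicator (V n) z *\<^sub>R (indicator K z *\<^sub>R g z))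
     \<longlonglongrightarrow> (LINT z|lebesgue. indicator C z *\<^sub>R (indicator K z *\<^sub>R g z))"
  proof (rule integral_dominated_convergence)
    have "C \<in> sets lebesgue" using C(1) by (simp add: lmeasurable_compact fmeasurableD)
    then show "(\<lambda>z. indicator C z *\<^sub>R (indicator K z *\<^sub>R g z)) \<in> borel_measurable lebesgue"
      using gKm by measurable
    have "open (V n)" for n unfolding V_def by auto
    then have "V n \<in> sets lebesgue" for n by (intro sets_completionI_sets) auto
    then show "(\<lambda>z. indicator (V n) z *\<^sub>R (indicator K z *\<^sub>R g z)) \<in> borel_measurable lebesgue" for n
      using gKm by measurable
    show "integrable lebesgue (\<lambda>z. norm (indicator K z *\<^sub>R g z))"
      using gK by (rule integrable_norm)
    show "AE z in lebesgue. norm (indicator (V n) z *\<^sub>R (indicator K z *\<^sub>R g z)) \<le> norm (indicator K z *\<^sub>R g z)" for n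
      by (auto simp: indicator_def)
    show "AE z in lebesgue. (\<lambda>n. indicator (V n) z *\<^sub>R (indicator K z *\<^sub>R g z))
       \<longlonglongrightarrow> indicator C z *\<^sub>R (indicator K z *\<^sub>R g z)"
    proof (rule AE_I2)
      fix z
      have "(\<lambda>n. indicator (V n) z :: real) \<longlonglongrightarrow> indicator C z"
      proof (cases "z \<in> C")
        case True
        then show ?thesis using F(3) by (auto simp: V_def indicator_def subset_iff)
      next
        case False
        have "infdist z C \<noteq> 0"
          using in_closed_iff_infdist_zero[OF compact_imp_closed[OF C(1)] \<open>C \<noteq> {}\<close>] False by auto
        then have "infdist z C > 0" using infdist_nonneg[of z C] by linarith
        then obtain N where N: "inverse (real (Suc N)) < infdist z C" using reals_Archimedean by blast
        have "z \<notin> V n" if "n \<ge> N" for n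
        proof
          assume "z \<in> V n"
          then have "infdist z C < inverse (real (Suc n))" using near r(3)[of n] by fastforce
          also have "\<dots> \<le> inverse (real (Suc N))" using that by (simp add: field_simps)
          finally show False using N by simp
        qed
        then have "\<forall>\<^sub>F n in sequentially. (indicator (V n) z :: real) = 0"
          by (auto simp: eventually_sequentially indicator_def)
        then show ?thesis using False by (simp add: tendsto_eventually)
      qed
      then show "(\<lambda>n. indicator (V n) z *\<^sub>R (indicator K z *\<^sub>R g z))
         \<longlonglongrightarrow> indicator C z *\<^sub>R (indicator K z *\<^sub>R g z)"
        by (intro tendsto_scaleR tendsto_const)
    qed
  qed
  moreover have "(LINT z|lebesgue. indicator (V n) z *\<^sub>R (indicator K z *\<^sub>R g z)) = 0" for n
  proof -
    have "(\<Union>c\<in>F n. cball c (r n)) \<subseteq> (\<Union>c\<in>C. cball c \<delta>)" using F(2)[of n] r(2)[of n] by force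
    then have "(LINT z:V n|lebesgue. g z) = 0"
      unfolding V_def by (intro integral_Union_balls_eq_0[OF g _ F(1) r(1)] zero) (use \<delta>(2) in auto)
    moreover have "(\<lambda>z. indicat_real (V n) z *\<^sub>R (indicator K z *\<^sub>R g z)) = (\<lambda>z. indicat_real (V n) z *\<^sub>R g z)"
      using VK[of n] by (auto simp: indicator_def fun_eq_iff)
    ultimately show ?thesis by (simp add: set_lebesgue_integral_def)
  qed
  ultimately have "(LINT z|lebesgue. indicator C z *\<^sub>R (indicator K z *\<^sub>R g z)) = 0"
    by (simp add: LIMSEQ_const_iff)
  moreover have "C \<subseteq> K" using \<delta>(1) by (auto simp: K_def)
  then have "(\<lambda>z. indicat_real C z *\<^sub>R (indicator K z *\<^sub>R g z)) = (\<lambda>z. indicat_real C z *\<^sub>R g z)"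
    by (auto simp: indicator_def fun_eq_iff)
  ultimately show ?thesis by (simp add: set_lebesgue_integral_def)
qed (simp add: set_lebesgue_integral_def)

text \<open>
  The set where a component of \<open>g\<close> is positive is exhausted by compact subsets up to arbitrarily small
  measure, and the integral of \<open>g\<close> over each of these is 0.
\<close>

lemma fundamental_lemma_calculus_of_variations:
  fixes g :: "'a::euclidean_space \<Rightarrow> 'b::euclidean_space"
  assumes "open \<Omega>" and g: "locally_integrable_on \<Omega> g"
    and zero: "\<And>\<phi> D. test_function \<Omega> \<phi> D \<Longrightarrow> (LINT z:\<Omega>|lebesgue. \<phi> z *\<^sub>R g z) = 0"
  shows "negligible {z \<in> \<Omega>. g z \<noteq> 0}"
proof -
  have pos: "negligible {z \<in> K. g z \<bullet> b > 0}" if K: "compact K" "K \<subseteq> \<Omega>" for K b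
  proof -
    define S where "S = {z \<in> K. g z \<bullet> b > 0}"
    have Kl: "K \<in> sets lebesgue" using K(1) by (simp add: lmeasurable_compact fmeasurableD)
    have "g absolutely_integrable_on K" using g K by (simp add: locally_integrable_on_def)
    then have "g \<in> borel_measurable (lebesgue_on K)"
      using Kl by (rule absolutely_integrable_imp_borel_measurable)
    then have "(\<lambda>z. g z \<bullet> b) \<in> borel_measurable (lebesgue_on K)" by measurable
    with Kl have S: "S \<in> sets lebesgue"
      unfolding S_def using borel_measurable_iff_greater[of "\<lambda>z. g z \<bullet> b" "lebesgue_on K"]
      by (auto simp: sets_restrict_space_iff)
    have "emeasure lebesgue S \<le> 0 + ennreal e" if "e > 0" for e
    proof -
      obtain T where T: "closed T" "T \<subseteq> S" "S - T \<in> lmeasurable" "emeasure lebesgue (S - T) < ennreal e"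
        using sets_lebesgue_inner_closed[OF S \<open>e > 0\<close>] by blast
      have TK: "T \<subseteq> \<Omega>" "T \<subseteq> K" using T(2) K(2) by (auto simp: S_def)
      have "compact T" using compact_Int_closed[OF K(1) T(1)] TK(2) by (simp add: Int_absorb1)
      have Tl: "T \<in> sets lebesgue" using T(1) by (simp add: lebesgue_closedin)
      have gT: "integrable lebesgue (\<lambda>z. indicator T z *\<^sub>R g z)"
        using g \<open>compact T\<close> TK unfolding locally_integrable_on_def set_integrable_def by blast
      have "(LINT z:T|lebesgue. g z) = 0"
        by (rule integral_compact_eq_0[OF assms(1) g _ \<open>compact T\<close> TK(1)]) (rule zero)
      then have "(LINT z|lebesgue. (indicator T z *\<^sub>R g z) \<bullet> b) = 0"
        unfolding set_lebesgue_integral_def integral_inner_left[OF gT] by simp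
      moreover have "AE z in lebesgue. 0 \<le> (indicator T z *\<^sub>R g z) \<bullet> b"
        using T(2) by (auto simp: indicator_def S_def intro!: AE_I2)
      ultimately have "AE z in lebesgue. (indicator T z *\<^sub>R g z) \<bullet> b = 0"
        using integral_nonneg_eq_0_iff_AE[OF integrable_inner_left, of b lebesgue "\<lambda>z. indicator T z *\<^sub>R g z"] gT
        by blast
      then have "AE z in lebesgue. z \<notin> T"
        by eventually_elim (use T(2) in \<open>auto simp: indicator_def S_def split: if_splits\<close>)
      then have "emeasure lebesgue T = 0" using AE_iff_measurable[OF Tl, of "\<lambda>z. z \<notin> T"] by auto
      then have "emeasure lebesgue (T \<union> (S - T)) \<le> emeasure lebesgue (S - T)"
        using emeasure_subadditive[of T lebesgue "S - T"] Tl T(3) by auto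
      moreover have "T \<union> (S - T) = S" using T(2) by auto
      ultimately show ?thesis using T(4) by (simp add: less_imp_le order_trans)
    qed
    then have "emeasure lebesgue S = 0" 
      using ennreal_le_epsilon[of 0 "emeasure lebesgue S"] by auto
    then show ?thesis using S unfolding S_def[symmetric] by (simp add: negligible_iff_null_sets null_setsI)
  qed
  obtain C where C: "\<And>n::nat. compact (C n)" "\<And>n. C n \<subseteq> \<Omega>" "\<Union>(range C) = \<Omega>"
    using open_Union_compact_subsets[OF \<open>open \<Omega>\<close>] by metis
  have "negligible (\<Union>n. \<Union>b\<in>Basis. {z \<in> C n. g z \<bullet> b > 0} \<union> {z \<in> C n. g z \<bullet> (- b) > 0})"
    by (rule negligible_countable_Union)
       (auto simp del: inner_minus_right intro!: negligible_Union negligible_Un pos C)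
  moreover have "{z \<in> \<Omega>. g z \<noteq> 0} \<subseteq> (\<Union>n. \<Union>b\<in>Basis. {z \<in> C n. g z \<bullet> b > 0} \<union> {z \<in> C n. g z \<bullet> (- b) > 0})"
  proof clarify
    fix z assume z: "z \<in> \<Omega>" "g z \<noteq> 0"
    then obtain b where "b \<in> Basis" "g z \<bullet> b \<noteq> 0" by (metis euclidean_all_zero_iff)
    moreover obtain n where "z \<in> C n" using z C(3) by blast
    ultimately have "b \<in> Basis \<and> z \<in> {z \<in> C n. g z \<bullet> b > 0} \<union> {z \<in> C n. g z \<bullet> (- b) > 0}"
      by auto
    then show "z \<in> (\<Union>n. \<Union>b\<in>Basis. {z \<in> C n. g z \<bullet> b > 0} \<union> {z \<in> C n. g z \<bullet> (- b) > 0})"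
      by blast
  qed
  ultimately show ?thesis by (rule negligible_subset)
qed

section \<open>Weak gradients, energies and traces\<close>

lemma compact_sets_lebesgue: "compact K \<Longrightarrow> K \<in> sets lebesgue"
  by (simp add: lmeasurable_compact fmeasurableD)

lemma open_sets_lebesgue: "open K \<Longrightarrow> K \<in> sets lebesgue"
  by (intro sets_completionI_sets) auto

lemma absolutely_integrable_continuous_compact:
  fixes f :: "'a::euclidean_space \<Rightarrow> 'b::euclidean_space"
  assumes "compact K" "continuous_on K f"
  shows "f absolutely_integrable_on K"
proof -
  have K: "K \<in> sets lebesgue" using assms(1) by (rule compact_sets_lebesgue)
  have "bounded (f ` K)" using assms by (simp add: compact_continuous_image compact_imp_bounded)
  then obtain M where M: "\<And>z. z \<in> K \<Longrightarrow> norm (f z) \<le> M" unfolding bounded_iff by auto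
  show ?thesis
    by (rule measurable_bounded_by_integrable_imp_absolutely_integrable[where g = "\<lambda>_. M"])
       (use K M assms in \<open>auto intro: continuous_imp_measurable_on_sets_lebesgue integrable_on_const lmeasurable_compact\<close>)
qed

lemma locally_integrable_on_continuous:
  "continuous_on \<Omega> f \<Longrightarrow> locally_integrable_on \<Omega> f"
  unfolding locally_integrable_on_def
  by (metis absolutely_integrable_continuous_compact continuous_on_subset)

lemma locally_integrable_on_subset:
  "locally_integrable_on \<Omega> f \<Longrightarrow> \<Omega>' \<subseteq> \<Omega> \<Longrightarrow> locally_integrable_on \<Omega>' f"
  unfolding locally_integrable_on_def by (meson order_trans)

lemma locally_integrable_on_add:
  "locally_integrable_on \<Omega> f \<Longrightarrow> locally_integrable_on \<Omega> g \<Longrightarrow> locally_integrable_on \<Omega> (\<lambda>z. f z + g z)"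
  unfolding locally_integrable_on_def by (auto intro: set_integral_add)

lemma locally_integrable_on_diff:
  "locally_integrable_on \<Omega> f \<Longrightarrow> locally_integrable_on \<Omega> g \<Longrightarrow> locally_integrable_on \<Omega> (\<lambda>z. f z - g z)"
  unfolding locally_integrable_on_def by (auto intro: set_integral_diff)

lemma integrable_test_function_scaleR:
  fixes f :: "'a::euclidean_space \<Rightarrow> 'b::euclidean_space"
  assumes f: "locally_integrable_on \<Omega> f" and \<phi>: "test_function \<Omega> \<phi> D"
  shows "(\<lambda>z. \<phi> z *\<^sub>R f z) absolutely_integrable_on \<Omega>"
proof -
  obtain K where K: "compact K" "K \<subseteq> \<Omega>" "\<And>z. z \<notin> K \<Longrightarrow> \<phi> z = 0"
    using test_function_gradient_support[OF \<phi>] by metis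
  have "(\<lambda>z. \<phi> z *\<^sub>R f z) absolutely_integrable_on K"
    by (intro absolutely_integrable_scaleR_continuous test_function_continuous[OF \<phi>])
       (use f K in \<open>auto simp: locally_integrable_on_def\<close>)
  moreover have "(\<lambda>z. \<phi> z *\<^sub>R f z) absolutely_integrable_on \<Omega> \<longleftrightarrow> (\<lambda>z. \<phi> z *\<^sub>R f z) absolutely_integrable_on K"
    by (rule set_integrable_cong_support) (use K in auto)
  ultimately show ?thesis by simp
qed

lemma integrable_inner_test_gradient:
  fixes f :: "'a::euclidean_space \<Rightarrow> 'a"
  assumes f: "locally_integrable_on \<Omega> f" and \<phi>: "test_function \<Omega> \<phi> D"
  shows "(\<lambda>z. f z \<bullet> D z) absolutely_integrable_on \<Omega>"
proof -
  obtain K where K: "compact K" "K \<subseteq> \<Omega>" "\<And>z. z \<notin> K \<Longrightarrow> D z = 0"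
    using test_function_gradient_support[OF \<phi>] by metis
  have "continuous_on K D" using \<phi> continuous_on_subset unfolding test_function_def by blast
  then have "(\<lambda>z. f z \<bullet> D z) absolutely_integrable_on K"
    using f K by (intro absolutely_integrable_inner_continuous) (auto simp: locally_integrable_on_def)
  moreover have "(\<lambda>z. f z \<bullet> D z) absolutely_integrable_on \<Omega> \<longleftrightarrow> (\<lambda>z. f z \<bullet> D z) absolutely_integrable_on K"
    by (rule set_integrable_cong_support) (use K in auto)
  ultimately show ?thesis by simp
qed

lemma integrable_scaleR_test_gradient:
  fixes f :: "'a::euclidean_space \<Rightarrow> real"
  assumes f: "locally_integrable_on \<Omega> f" and \<phi>: "test_function \<Omega> \<phi> D"
  shows "(\<lambda>z. f z *\<^sub>R D z) absolutely_integrable_on \<Omega>"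
proof -
  obtain K where K: "compact K" "K \<subseteq> \<Omega>" "\<And>z. z \<notin> K \<Longrightarrow> D z = 0"
    using test_function_gradient_support[OF \<phi>] by metis
  have D: "continuous_on K D" using \<phi> continuous_on_subset unfolding test_function_def by blast
  have "(\<lambda>z. f z *\<^sub>R D z) absolutely_integrable_on K"
  proof -
    have "(\<lambda>z. (\<lambda>a b. b *\<^sub>R a) (D z) (f z)) absolutely_integrable_on K"
    proof (rule absolutely_integrable_bounded_measurable_product[where h = "\<lambda>(a::'a) b. b *\<^sub>R a"])
      show "bilinear (\<lambda>(a::'a) b. b *\<^sub>R a)"
        unfolding bilinear_conv_bounded_bilinear
        by (rule bounded_bilinear.flip[OF bounded_bilinear_scaleR])
      show "D \<in> borel_measurable (lebesgue_on K)" "K \<in> sets lebesgue"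
        using K D by (auto intro: continuous_imp_measurable_on_sets_lebesgue compact_sets_lebesgue)
      show "bounded (D ` K)" using D K by (simp add: compact_continuous_image compact_imp_bounded)
      show "f absolutely_integrable_on K" using f K by (simp add: locally_integrable_on_def)
    qed
    then show ?thesis by simp
  qed
  moreover have "(\<lambda>z. f z *\<^sub>R D z) absolutely_integrable_on \<Omega> \<longleftrightarrow> (\<lambda>z. f z *\<^sub>R D z) absolutely_integrable_on K"
    by (rule set_integrable_cong_support) (use K in auto)
  ultimately show ?thesis by simp
qed

text \<open>For a test function \<open>\<psi>\<close> the product \<open>\<psi> \<phi>\<close> is again a test function, and its gradient has integral 0.\<close>

lemma has_weak_gradient_C1:
  assumes \<phi>: "\<And>z. GDERIV \<phi> z :> D z" and D: "continuous_on UNIV D"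
  shows "has_weak_gradient \<Omega> \<phi> D"
proof -
  have \<phi>c: "continuous_on UNIV \<phi>"
    using \<phi>[unfolded gderiv_def, THEN has_derivative_continuous]
    by (simp add: continuous_at_imp_continuous_on)
  have loc: "locally_integrable_on \<Omega> \<phi>" "locally_integrable_on \<Omega> D"
    using \<phi>c D by (auto intro!: locally_integrable_on_continuous elim: continuous_on_subset)
  moreover have "(LINT z:\<Omega>|lebesgue. \<phi> z *\<^sub>R E z) = - (LINT z:\<Omega>|lebesgue. \<psi> z *\<^sub>R D z)"
    if \<psi>: "test_function \<Omega> \<psi> E" for \<psi> E
  proof -
    have "(LINT z:\<Omega>|lebesgue. \<psi> z *\<^sub>R D z + \<phi> z *\<^sub>R E z) = 0"
      by (rule test_function_integral_gradient[OF test_function_mult_C1[OF \<psi> \<phi> D]])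
    moreover have "(LINT z:\<Omega>|lebesgue. \<psi> z *\<^sub>R D z + \<phi> z *\<^sub>R E z)
      = (LINT z:\<Omega>|lebesgue. \<psi> z *\<^sub>R D z) + (LINT z:\<Omega>|lebesgue. \<phi> z *\<^sub>R E z)"
      by (intro set_integral_add(2) integrable_test_function_scaleR[OF loc(2) \<psi>] 
            integrable_scaleR_test_gradient[OF loc(1) \<psi>])
    ultimately show ?thesis by (simp add: add_eq_0_iff)
  qed
  ultimately show ?thesis unfolding has_weak_gradient_def by blast
qed

lemma has_weak_gradient_add:
  assumes u: "has_weak_gradient \<Omega> u G" and v: "has_weak_gradient \<Omega> v H"
  shows "has_weak_gradient \<Omega> (\<lambda>z. u z + v z) (\<lambda>z. G z + H z)"
proof -
  have loc: "locally_integrable_on \<Omega> u" "locally_integrable_on \<Omega> v"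
    "locally_integrable_on \<Omega> G" "locally_integrable_on \<Omega> H"
    using u v by (auto simp: has_weak_gradient_def)
  have "(LINT z:\<Omega>|lebesgue. (u z + v z) *\<^sub>R E z) = - (LINT z:\<Omega>|lebesgue. \<psi> z *\<^sub>R (G z + H z))"
    if \<psi>: "test_function \<Omega> \<psi> E" for \<psi> E
  proof -
    have "(LINT z:\<Omega>|lebesgue. u z *\<^sub>R E z + v z *\<^sub>R E z)
      = (LINT z:\<Omega>|lebesgue. u z *\<^sub>R E z) + (LINT z:\<Omega>|lebesgue. v z *\<^sub>R E z)"
      by (intro set_integral_add(2) integrable_scaleR_test_gradient[OF _ \<psi>] loc)
    moreover have "(LINT z:\<Omega>|lebesgue. \<psi> z *\<^sub>R G z + \<psi> z *\<^sub>R H z)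
      = (LINT z:\<Omega>|lebesgue. \<psi> z *\<^sub>R G z) + (LINT z:\<Omega>|lebesgue. \<psi> z *\<^sub>R H z)"
      by (intro set_integral_add(2) integrable_test_function_scaleR[OF _ \<psi>] loc)
    ultimately show ?thesis
      using u v \<psi> by (simp add: has_weak_gradient_def scaleR_add_left scaleR_add_right)
  qed
  then show ?thesis unfolding has_weak_gradient_def
    using loc by (auto intro: locally_integrable_on_add)
qed

lemma has_weak_gradient_subset:
  assumes u: "has_weak_gradient \<Omega> u G" and sub: "\<Omega>' \<subseteq> \<Omega>"
  shows "has_weak_gradient \<Omega>' u G"
proof -
  have "(LINT z:\<Omega>'|lebesgue. u z *\<^sub>R D z) = - (LINT z:\<Omega>'|lebesgue. \<phi> z *\<^sub>R G z)"
    if \<phi>: "test_function \<Omega>' \<phi> D" for \<phi> D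
  proof -
    obtain K where K: "compact K" "K \<subseteq> \<Omega>'" "\<And>z. z \<notin> K \<Longrightarrow> \<phi> z = 0" "\<And>z. z \<notin> K \<Longrightarrow> D z = 0"
      using test_function_gradient_support[OF \<phi>] by metis
    have "(LINT z:\<Omega>'|lebesgue. u z *\<^sub>R D z) = (LINT z:\<Omega>|lebesgue. u z *\<^sub>R D z)"
      "(LINT z:\<Omega>'|lebesgue. \<phi> z *\<^sub>R G z) = (LINT z:\<Omega>|lebesgue. \<phi> z *\<^sub>R G z)"
      by (rule set_integral_cong_support; use K sub in auto)+
    then show ?thesis using u test_function_mono[OF \<phi> sub] by (simp add: has_weak_gradient_def)
  qed
  moreover have "locally_integrable_on \<Omega>' u" "locally_integrable_on \<Omega>' G"
    using u by (auto simp: has_weak_gradient_def intro: locally_integrable_on_subset[OF _ sub])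
  ultimately show ?thesis unfolding has_weak_gradient_def by simp
qed

lemma has_weak_gradient_unique:
  assumes "open \<Omega>" and G: "has_weak_gradient \<Omega> u G" and H: "has_weak_gradient \<Omega> u H"
  shows "negligible {z \<in> \<Omega>. G z \<noteq> H z}"
proof -
  have loc: "locally_integrable_on \<Omega> G" "locally_integrable_on \<Omega> H"
    using G H by (auto simp: has_weak_gradient_def)
  have "negligible {z \<in> \<Omega>. G z - H z \<noteq> 0}"
  proof (rule fundamental_lemma_calculus_of_variations[OF \<open>open \<Omega>\<close> locally_integrable_on_diff[OF loc]])
    fix \<phi> :: "'a \<Rightarrow> real" and D assume \<phi>: "test_function \<Omega> \<phi> D"
    have "(LINT z:\<Omega>|lebesgue. \<phi> z *\<^sub>R G z - \<phi> z *\<^sub>R H z)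
      = (LINT z:\<Omega>|lebesgue. \<phi> z *\<^sub>R G z) - (LINT z:\<Omega>|lebesgue. \<phi> z *\<^sub>R H z)"
      by (intro set_integral_diff(2) integrable_test_function_scaleR[OF _ \<phi>] loc)
    moreover have "(LINT z:\<Omega>|lebesgue. u z *\<^sub>R D z) = - (LINT z:\<Omega>|lebesgue. \<phi> z *\<^sub>R G z)"
      using G \<phi> by (simp add: has_weak_gradient_def)
    moreover have "(LINT z:\<Omega>|lebesgue. u z *\<^sub>R D z) = - (LINT z:\<Omega>|lebesgue. \<phi> z *\<^sub>R H z)"
      using H \<phi> by (simp add: has_weak_gradient_def)
    ultimately show "(LINT z:\<Omega>|lebesgue. \<phi> z *\<^sub>R (G z - H z)) = 0"
      by (simp add: scaleR_diff_right)
  qed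
  then show ?thesis by simp
qed

lemma weak_gradient_eq:
  assumes "open \<Omega>" and "has_weak_gradient \<Omega> u G"
  shows "negligible {z \<in> \<Omega>. weak_gradient \<Omega> u z \<noteq> G z}"
  using has_weak_gradient_unique[OF assms(1) _ assms(2)] someI[of "has_weak_gradient \<Omega> u", OF assms(2)]
  unfolding weak_gradient_def by blast

text \<open>If one of the functions is not integrable, neither is the other, and both integrals have the
  default value 0.\<close>

lemma set_integral_spike:
  fixes f g :: "'a::euclidean_space \<Rightarrow> 'b::euclidean_space"
  assumes "negligible N" "\<And>z. z \<in> S - N \<Longrightarrow> f z = g z"
  shows "(LINT z:S|lebesgue. f z) = (LINT z:S|lebesgue. g z)"
proof (cases "f absolutely_integrable_on S")
  case True
  moreover have "g absolutely_integrable_on S"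
    using absolutely_integrable_spike[OF True assms(1)] assms(2) by auto
  moreover have "integral S f = integral S g" 
    by (rule integral_spike[OF assms(1)]) (use assms(2) in auto)
  ultimately show ?thesis by (simp add: set_lebesgue_integral_eq_integral)
next
  case False
  then have "\<not> g absolutely_integrable_on S"
    using absolutely_integrable_spike[where f = g and T = S and g = f, OF _ assms(1)] assms(2) by auto
  with False show ?thesis
    by (simp add: set_lebesgue_integral_def set_integrable_def not_integrable_integral_eq)
qed

lemma square_integrable_on_spike:
  assumes "negligible N" "\<And>z. z \<in> S - N \<Longrightarrow> f z = g z" "S \<in> sets lebesgue"
    and f: "square_integrable_on S f"
  shows "square_integrable_on S g"
  unfolding square_integrable_on_def
proof
  have "f measurable_on S" using f assms(3)
    by (simp add: square_integrable_on_def measurable_on_iff_borel_measurable)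
  then have "g measurable_on S" by (rule measurable_on_spike[OF _ assms(1)]) (use assms(2) in auto)
  then show "g \<in> borel_measurable (lebesgue_on S)" using assms(3)
    by (simp add: measurable_on_iff_borel_measurable)
  show "(\<lambda>z. (norm (g z))\<^sup>2) absolutely_integrable_on S"
    by (rule absolutely_integrable_spike[where f = "\<lambda>z. (norm (f z))\<^sup>2", OF _ assms(1)]) 
       (use f assms(2) in \<open>auto simp: square_integrable_on_def\<close>)
qed

lemma square_integrable_on_cong_negligible:
  assumes "negligible {z \<in> S. f z \<noteq> g z}" "S \<in> sets lebesgue"
  shows "square_integrable_on S f \<longleftrightarrow> square_integrable_on S g"
  using square_integrable_on_spike[where f = f and g = g and S = S, OF assms(1)] 
    square_integrable_on_spike[where f = g and g = f and S = S, OF assms(1)] assms(2) by auto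

text \<open>Membership in \<open>H1\<close> and the energy below may be tested on any weak gradient at hand instead of the chosen one.\<close>

lemma H1_iff:
  assumes "open \<Omega>" and v: "has_weak_gradient \<Omega> v G"
  shows "v \<in> H1 \<beta> \<Omega> \<longleftrightarrow> square_integrable_on (\<Omega> \<inter> upper_half_space) v \<and>
     square_integrable_on \<Omega> (\<lambda>z. \<bar>snd z\<bar> powr (\<beta> / 2) *\<^sub>R G z)"
proof -
  have "negligible {z \<in> \<Omega>. \<bar>snd z\<bar> powr (\<beta> / 2) *\<^sub>R weak_gradient \<Omega> v z \<noteq> \<bar>snd z\<bar> powr (\<beta> / 2) *\<^sub>R G z}"
    by (rule negligible_subset[OF weak_gradient_eq[OF assms]]) auto
  from square_integrable_on_cong_negligible[OF this open_sets_lebesgue[OF assms(1)]]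
  show ?thesis unfolding H1_def using v by auto
qed

lemma weighted_energy_eq:
  assumes "open \<Omega>" and v: "has_weak_gradient \<Omega> v G"
  shows "(LINT z:\<Omega>|lebesgue. w z * (norm (weak_gradient \<Omega> v z))\<^sup>2) = (LINT z:\<Omega>|lebesgue. w z * (norm (G z))\<^sup>2)"
  by (rule set_integral_spike[OF weak_gradient_eq[OF assms]]) auto

text \<open>
  Uniqueness of the trace comes from
  \<open>\<bar>t - v z\<bar> \<le> \<bar>v w - t\<bar> + \<bar>v w - v z\<bar>\<close>, averaged over \<open>w\<close>; both averages tend to 0.
\<close>

lemma has_trace_at_iff:
  fixes U :: "'a::euclidean_space set"
  assumes U: "open U" "bounded U" and v: "continuous_on (closure U) v" and z: "z \<in> closure U"
  shows "has_trace_at U v z t \<longleftrightarrow> t = v z"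
proof -
  define A where "A r = ball z r \<inter> U" for r
  have A_open: "open (A r)" for r unfolding A_def using U by auto
  have A_meas: "A r \<in> lmeasurable" for r
    unfolding A_def using U by (intro lmeasurable_open bounded_Int) auto
  have A_pos: "measure lebesgue (A r) > 0" if r: "r > 0" for r
  proof -
    obtain w where "w \<in> U" "dist w z < r" using z r unfolding closure_approachable by blast
    then have "w \<in> A r" by (simp add: A_def dist_commute)
    then have "A r \<noteq> {}" by blast
    then have "\<not> negligible (A r)" using A_open open_not_negligible by blast
    then show ?thesis using A_meas[of r] 
      by (simp add: negligible_iff_measure zero_less_measure_iff)
  qed
  have A_sub: "A r \<subseteq> closure U" for r unfolding A_def using closure_subset by auto
  have cc: "compact (closure U)" using U by simp
  have int: "f absolutely_integrable_on (A r)" if "continuous_on (closure U) f" for f :: "'a \<Rightarrow> real" and r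
    by (rule set_integrable_subset[OF absolutely_integrable_continuous_compact[OF cc that] _ A_sub])
       (use A_meas in \<open>auto intro: fmeasurableD\<close>)
  define Q where "Q t r = (LINT w:A r|lebesgue. \<bar>v w - t\<bar>) / measure lebesgue (A r)" for t r
  have int_abs: "(\<lambda>w. \<bar>v w - t\<bar>) absolutely_integrable_on (A r)" for t r
    by (intro int continuous_intros v)
  have const: "(LINT w:A r|lebesgue. c) = c * measure lebesgue (A r)" for c r
    using A_meas[of r] by (simp add: set_lebesgue_integral_def lmeasurable_iff_integrable)
  have const_int: "(\<lambda>w. c::real) absolutely_integrable_on (A r)" for c r
    by (intro int continuous_intros)
  have Q_nonneg: "Q t r \<ge> 0" for t r
    unfolding Q_def set_lebesgue_integral_def by (intro divide_nonneg_nonneg Bochner_Integration.integral_nonneg) auto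
  have Q0: "(Q (v z) \<longlongrightarrow> 0) (at_right 0)"
  proof (rule tendstoI)
    fix e :: real assume e: "e > 0"
    obtain d where d: "d > 0" "\<And>w. w \<in> closure U \<Longrightarrow> dist w z < d \<Longrightarrow> dist (v w) (v z) < e / 2"
      using v z e unfolding continuous_on_iff by (meson half_gt_zero)
    have "dist (Q (v z) r) 0 < e" if r: "r > 0" "r < d" for r
    proof -
      have "(LINT w:A r|lebesgue. \<bar>v w - v z\<bar>) \<le> (LINT w:A r|lebesgue. e / 2)"
      proof (rule set_integral_mono[OF int_abs const_int])
        fix w assume "w \<in> A r"
        then have "dist w z < d" "w \<in> closure U" using r A_sub[of r] by (auto simp: A_def dist_commute subset_iff)
        then show "\<bar>v w - v z\<bar> \<le> e / 2" using d(2)[of w] by (simp add: dist_real_def)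
      qed
      then have "Q (v z) r \<le> e / 2" using A_pos[OF r(1)] const[of r "e/2"] 
        by (simp add: Q_def divide_le_eq)
      then show ?thesis using Q_nonneg[of "v z" r] e by simp
    qed
    then show "\<forall>\<^sub>F r in at_right 0. dist (Q (v z) r) 0 < e"
      by (rule eventually_at_rightI[OF _ d(1)]) auto
  qed
  have uniq: "t = v z" if t: "(Q t \<longlongrightarrow> 0) (at_right 0)"
  proof -
    have "\<bar>t - v z\<bar> \<le> Q t r + Q (v z) r" if r: "r > 0" for r
    proof -
      have "(LINT w:A r|lebesgue. \<bar>t - v z\<bar>) \<le> (LINT w:A r|lebesgue. \<bar>v w - t\<bar> + \<bar>v w - v z\<bar>)"
        by (rule set_integral_mono[OF const_int set_integral_add(1)[OF int_abs int_abs]]) auto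
      also have "\<dots> = (LINT w:A r|lebesgue. \<bar>v w - t\<bar>) + (LINT w:A r|lebesgue. \<bar>v w - v z\<bar>)"
        by (rule set_integral_add(2)[OF int_abs int_abs])
      finally show ?thesis using A_pos[OF r] unfolding const Q_def
        by (simp add: add_divide_distrib[symmetric] le_divide_eq)
    qed
    then have ev: "\<forall>\<^sub>F r in at_right 0. \<bar>t - v z\<bar> \<le> Q t r + Q (v z) r"
      by (intro eventually_at_rightI[of 0 1]) auto
    have "((\<lambda>r. Q t r + Q (v z) r) \<longlongrightarrow> 0 + 0) (at_right 0)"
      by (intro tendsto_intros t Q0)
    then have "\<bar>t - v z\<bar> \<le> 0 + 0" by (rule tendsto_lowerbound[OF _ ev]) simp
    then show ?thesis by simp
  qed
  have "has_trace_at U v z t \<longleftrightarrow> (Q t \<longlongrightarrow> 0) (at_right 0)"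
    unfolding has_trace_at_def Q_def A_def[symmetric] using int[OF v] by simp
  then show ?thesis using Q0 uniq by auto
qed

section \<open>The weight and weighted harmonic functions\<close>

lemma powr_abs_absolutely_integrable:
  assumes "-1 < \<beta>" "0 \<le> R"
  shows "(\<lambda>y::real. \<bar>y\<bar> powr \<beta>) absolutely_integrable_on {- R..R}"
proof -
  have "(\<lambda>y. y powr \<beta>) absolutely_integrable_on {0..R}"
    by (intro nonnegative_absolutely_integrable_1 integrable_on_powr_from_0 assms) auto
  moreover have "(\<lambda>y. y powr \<beta>) absolutely_integrable_on {0..R} \<longleftrightarrow>
      (\<lambda>y. \<bar>y\<bar> powr \<beta>) absolutely_integrable_on {0..R}"
    by (rule set_integrable_cong) auto
  ultimately have 1: "(\<lambda>y. \<bar>y\<bar> powr \<beta>) absolutely_integrable_on {0..R}" by simp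
  then have "(\<lambda>y. \<bar>- y\<bar> powr \<beta>) absolutely_integrable_on {- R..- 0}"
    using absolutely_integrable_reflect_real[where f = "\<lambda>y. \<bar>y\<bar> powr \<beta>" and a = 0 and b = R] by blast
  then have "(\<lambda>y. \<bar>y\<bar> powr \<beta>) absolutely_integrable_on {- R..0}" by simp
  from set_integrable_Un[OF this 1] have "(\<lambda>y. \<bar>y\<bar> powr \<beta>) absolutely_integrable_on {- R..0} \<union> {0..R}"
    by simp
  moreover have "{- R..0} \<union> {0..R} = {- R..R}" using assms by auto
  ultimately show ?thesis by simp
qed

lemma weight_absolutely_integrable:
  fixes S :: "('a::euclidean_space \<times> real) set"
  assumes "-1 < \<beta>" "bounded S" "S \<in> sets lebesgue"
  shows "(\<lambda>z. \<bar>snd z\<bar> powr \<beta>) absolutely_integrable_on S"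
proof -
  obtain R where R: "R > 0" "\<And>z. z \<in> S \<Longrightarrow> norm z \<le> R"
    using assms(2) unfolding bounded_pos by auto
  define f :: "'a \<times> real \<Rightarrow> real" 
    where "f z = indicator (cball 0 R) (fst z) * (indicator {- R..R} (snd z) * \<bar>snd z\<bar> powr \<beta>)" for z
  have "(\<lambda>y::real. indicator {- R..R} y * \<bar>y\<bar> powr \<beta>) \<in> borel_measurable borel" 
    by (intro borel_measurable_times borel_measurable_indicator) auto
  moreover have "(indicator (cball (0::'a) R) :: 'a \<Rightarrow> real) \<in> borel_measurable borel" 
    by (intro borel_measurable_indicator) auto
  ultimately have "f \<in> borel_measurable (borel \<Otimes>\<^sub>M borel)" unfolding f_def
    using measurable_compose[OF measurable_snd, of "\<lambda>y::real. indicator {- R..R} y * \<bar>y\<bar> powr \<beta>"]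
    by (intro borel_measurable_times[of "\<lambda>z. indicator (cball 0 R) (fst z)"] measurable_compose[OF measurable_fst]) auto
  then have fm: "f \<in> borel_measurable borel" by (simp add: borel_prod)
  have 1: "integrable lborel (\<lambda>y. indicator {- R..R} y * \<bar>y\<bar> powr \<beta>)"
    using powr_abs_absolutely_integrable[OF assms(1), of R] R(1)
    unfolding set_integrable_def by (simp add: integrable_completion)
  have 2: "integrable lborel (\<lambda>x::'a. indicator (cball 0 R) x :: real)"
    using borel_integrable_compact[of "cball (0::'a) R" "\<lambda>_. 1::real"] by simp
  have "integrable (lborel \<Otimes>\<^sub>M lborel) f"
  proof (rule lborel_pair.Fubini_integrable)
    show "f \<in> borel_measurable (lborel \<Otimes>\<^sub>M lborel)"
      using fm by (simp add: lborel_prod)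
    show "integrable lborel (\<lambda>x. \<integral>y. norm (f (x, y)) \<partial>lborel)"
      using 2 by (simp add: f_def abs_mult)
    show "AE x in lborel. integrable lborel (\<lambda>y. f (x, y))"
      using 1 by (simp add: f_def)
  qed
  then have "integrable lborel f" by (simp add: lborel_prod)
  then have "integrable lebesgue f" using fm by (simp add: integrable_completion)
  then have "set_integrable lebesgue UNIV f" by (simp add: set_integrable_def)
  then have "f absolutely_integrable_on S"
    by (rule set_integrable_subset) (use assms(3) in auto)
  moreover have "f absolutely_integrable_on S \<longleftrightarrow> (\<lambda>z. \<bar>snd z\<bar> powr \<beta>) absolutely_integrable_on S"
  proof (rule set_integrable_cong)
    fix z assume "z \<in> S"
    then have "norm z \<le> R" by (rule R(2))
    then have "norm (fst z) \<le> R" "norm (snd z) \<le> R"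
      using norm_fst_le[of "fst z" "snd z"] norm_snd_le[of "snd z" "fst z"] by auto
    then show "f z = \<bar>snd z\<bar> powr \<beta>" by (auto simp: f_def indicator_def)
  qed auto
  ultimately show ?thesis by simp
qed

lemma negligible_snd_0: "negligible {z::'a::euclidean_space \<times> real. snd z = 0}"
proof -
  have "negligible {z::'a \<times> real. (0, 1) \<bullet> z = 0}" by (rule negligible_hyperplane) (simp add: zero_prod_def)
  then show ?thesis by (simp add: inner_prod_def)
qed

lemma AE_snd_nonzero: "AE z::'a::euclidean_space \<times> real in lebesgue. snd z \<noteq> 0"
proof -
  have "{z::'a \<times> real. snd z = 0} \<in> null_sets lebesgue"
    using negligible_snd_0 by (simp add: negligible_iff_null_sets)
  then show ?thesis by (rule AE_I') auto
qed

text \<open>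
  A weak solution of \<open>div (\<bar>y\<bar>\<^sup>\<beta> \<nabla>u) = 0\<close>, required to be continuous because its values on the null set
  \<open>{y = 0}\<close> matter.  The local integrability of \<open>\<bar>y\<bar>\<^sup>\<beta> G\<close> gives the integrals against test gradients a
  meaning; if \<open>\<beta> < 0\<close>, the weight is unbounded and this does not follow from that of \<open>G\<close>.
\<close>

definition weighted_harmonic ::
  "real \<Rightarrow> ('a::euclidean_space \<times> real) set \<Rightarrow> ('a \<times> real \<Rightarrow> real) \<Rightarrow> bool" where
  "weighted_harmonic \<beta> \<Omega> u \<longleftrightarrow> continuous_on \<Omega> u \<and>
     (\<exists>G. has_weak_gradient \<Omega> u G \<and> locally_integrable_on \<Omega> (\<lambda>z. \<bar>snd z\<bar> powr \<beta> *\<^sub>R G z) \<and>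
       (\<forall>\<phi> D. test_function \<Omega> \<phi> D \<longrightarrow> (LINT z:\<Omega>|lebesgue. (\<bar>snd z\<bar> powr \<beta> *\<^sub>R G z) \<bullet> D z) = 0))"

lemma weighted_harmonic_const: "weighted_harmonic \<beta> \<Omega> (\<lambda>z. c)"
proof -
  have "has_weak_gradient \<Omega> (\<lambda>z. c) (\<lambda>z. 0)"
    by (rule has_weak_gradient_C1) (auto intro: GDERIV_const)
  then show ?thesis unfolding weighted_harmonic_def
    by (auto intro!: exI[of _ "\<lambda>z. 0"] locally_integrable_on_continuous)
qed

text \<open>
  The weak form of the divergence theorem for the vector field \<open>g(z) (z - \<zeta>)\<close>, whose divergence is
  \<open>\<nabla>g \<bullet> (z - \<zeta>) + DIM * g\<close>; it is obtained by testing with the components of the field.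
\<close>

lemma weak_gradient_radial_field:
  fixes u g :: "'a::euclidean_space \<Rightarrow> real"
  assumes u: "has_weak_gradient \<Omega> u G" and g: "test_function \<Omega> g E"
  shows "(LINT z:\<Omega>|lebesgue. u z * (E z \<bullet> (z - \<zeta>) + DIM('a) * g z)) = 
    - (LINT z:\<Omega>|lebesgue. g z * (G z \<bullet> (z - \<zeta>)))"
proof -
  define \<psi> where "\<psi> b z = g z * ((z - \<zeta>) \<bullet> b)" for b z
  define D where "D b z = g z *\<^sub>R b + ((z - \<zeta>) \<bullet> b) *\<^sub>R E z" for b z
  have t: "test_function \<Omega> (\<psi> b) (D b)" for b
    unfolding \<psi>_def D_def
  proof (rule test_function_mult_C1[OF g])
    show "GDERIV (\<lambda>z. (z - \<zeta>) \<bullet> b) z :> b" for z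
      unfolding gderiv_def by (auto intro!: derivative_eq_intros)
  qed auto
  have loc: "locally_integrable_on \<Omega> u" "locally_integrable_on \<Omega> G"
    using u by (auto simp: has_weak_gradient_def)
  have iu: "(\<lambda>z. u z *\<^sub>R D b z) absolutely_integrable_on \<Omega>" for b
    by (rule integrable_scaleR_test_gradient[OF loc(1) t])
  have iG: "(\<lambda>z. \<psi> b z *\<^sub>R G z) absolutely_integrable_on \<Omega>" for b
    by (rule integrable_test_function_scaleR[OF loc(2) t])
  have "(\<integral>z. (indicator \<Omega> z *\<^sub>R (u z *\<^sub>R D b z)) \<bullet> b \<partial>lebesgue) = 
      - (\<integral>z. (indicator \<Omega> z *\<^sub>R (\<psi> b z *\<^sub>R G z)) \<bullet> b \<partial>lebesgue)" for b
    using u t[of b] iu[of b] iG[of b] 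
    unfolding has_weak_gradient_def set_lebesgue_integral_def set_integrable_def
    by (simp only: integral_inner_left) simp
  then have "(\<Sum>b\<in>Basis. \<integral>z. (indicator \<Omega> z *\<^sub>R (u z *\<^sub>R D b z)) \<bullet> b \<partial>lebesgue) = 
      - (\<Sum>b\<in>Basis. \<integral>z. (indicator \<Omega> z *\<^sub>R (\<psi> b z *\<^sub>R G z)) \<bullet> b \<partial>lebesgue)"
    by (simp only: sum_negf)
  moreover have "(\<Sum>b\<in>Basis. \<integral>z. (indicator \<Omega> z *\<^sub>R (u z *\<^sub>R D b z)) \<bullet> b \<partial>lebesgue)
     = (\<integral>z. (\<Sum>b\<in>Basis. (indicator \<Omega> z *\<^sub>R (u z *\<^sub>R D b z)) \<bullet> b) \<partial>lebesgue)"
    using iu by (intro Bochner_Integration.integral_sum[symmetric] integrable_inner_left) (auto simp: set_integrable_def)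
  moreover have "(\<Sum>b\<in>Basis. \<integral>z. (indicator \<Omega> z *\<^sub>R (\<psi> b z *\<^sub>R G z)) \<bullet> b \<partial>lebesgue)
     = (\<integral>z. (\<Sum>b\<in>Basis. (indicator \<Omega> z *\<^sub>R (\<psi> b z *\<^sub>R G z)) \<bullet> b) \<partial>lebesgue)"
    using iG by (intro Bochner_Integration.integral_sum[symmetric] integrable_inner_left) (auto simp: set_integrable_def)
  moreover have "(\<Sum>b\<in>Basis. (indicator \<Omega> z *\<^sub>R (u z *\<^sub>R D b z)) \<bullet> b) = 
     indicator \<Omega> z *\<^sub>R (u z * (E z \<bullet> (z - \<zeta>) + DIM('a) * g z))" for z
  proof -
    have "(\<Sum>b\<in>Basis. D b z \<bullet> b) = (\<Sum>b\<in>(Basis::'a set). g z * (b \<bullet> b)) + (\<Sum>b\<in>Basis. (E z \<bullet> b) * ((z - \<zeta>) \<bullet> b))"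
      unfolding D_def by (simp add: inner_add_left sum.distrib mult.commute)
    also have "\<dots> = DIM('a) * g z + E z \<bullet> (z - \<zeta>)"
      by (simp add: euclidean_inner[of "E z" "z - \<zeta>"])
    finally show ?thesis by (simp add: sum_distrib_left[symmetric] add.commute)
  qed
  moreover have "(\<Sum>b\<in>Basis. (indicator \<Omega> z *\<^sub>R (\<psi> b z *\<^sub>R G z)) \<bullet> b) = 
     indicator \<Omega> z *\<^sub>R (g z * (G z \<bullet> (z - \<zeta>)))" for z
    by (simp add: euclidean_inner[of "G z" "z - \<zeta>"] sum_distrib_left \<psi>_def mult_ac)
  ultimately show ?thesis unfolding set_lebesgue_integral_def by simp
qed

text \<open>
  The weight \<open>\<bar>y\<bar>\<^sup>\<beta>\<close> is not \<open>C\<^sup>1\<close> across \<open>{y = 0}\<close>, so it cannot be a factor of a test function.  It is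
  replaced by smooth functions of \<open>y\<close>; the bound, valid for \<open>\<beta>\<close> of either sign, is the dominating
  function for the passage to the limit.
\<close>

lemma integral_tendsto_weighted_integral:
  fixes f :: "'a::euclidean_space \<times> real \<Rightarrow> real"
  assumes f: "f absolutely_integrable_on K" and wf: "(\<lambda>z. \<bar>snd z\<bar> powr \<beta> * f z) absolutely_integrable_on K"
    and K: "compact K"
    and cm: "\<And>k. c k \<in> borel_measurable borel"
    and bd: "\<And>k z. snd z \<noteq> 0 \<Longrightarrow> \<bar>c k z\<bar> \<le> \<bar>snd z\<bar> powr \<beta> + ((snd z)\<^sup>2 + 1) powr \<bar>\<beta> / 2\<bar>"
    and lim: "\<And>z. snd z \<noteq> 0 \<Longrightarrow> (\<lambda>k. c k z) \<longlonglongrightarrow> \<bar>snd z\<bar> powr \<beta>"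
  shows "(\<lambda>k. LINT z:K|lebesgue. c k z * f z) \<longlonglongrightarrow> (LINT z:K|lebesgue. \<bar>snd z\<bar> powr \<beta> * f z)"
    and "(\<lambda>z. c k z * f z) absolutely_integrable_on K"
proof -
  define F where "F z = indicator K z * f z" for z
  define w where "w z = norm (\<bar>snd z\<bar> powr \<beta> * F z) + norm (((snd z)\<^sup>2 + 1) powr \<bar>\<beta> / 2\<bar> * F z)" for z
  have F: "integrable lebesgue F" 
    using f by (simp add: F_def[abs_def] set_integrable_def)
  have wF: "integrable lebesgue (\<lambda>z. \<bar>snd z\<bar> powr \<beta> * F z)"
    using wf by (simp add: F_def[abs_def] set_integrable_def mult_ac)
  have "(\<lambda>z. (((snd z)\<^sup>2 + 1) powr \<bar>\<beta> / 2\<bar>) *\<^sub>R f z) absolutely_integrable_on K"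
    by (rule absolutely_integrable_scaleR_continuous[OF K _ f]) 
      (intro continuous_intros, auto simp: add_nonneg_eq_0_iff)
  then have cF: "integrable lebesgue (\<lambda>z. ((snd z)\<^sup>2 + 1) powr \<bar>\<beta> / 2\<bar> * F z)"
    by (simp add: F_def[abs_def] set_integrable_def mult_ac)
  have w: "integrable lebesgue w" unfolding w_def by (intro Bochner_Integration.integrable_add integrable_norm wF cF)
  have cm': "c k \<in> borel_measurable lebesgue" for k
    using cm[of k] by (intro measurable_completion) auto
  have m: "(\<lambda>z. c k z * F z) \<in> borel_measurable lebesgue" for k
    using cm' F by (intro borel_measurable_times) auto
  have le: "AE z in lebesgue. norm (c k z * F z) \<le> w z" for k
    using AE_snd_nonzero
  proof eventually_elim
    case (elim z)
    have "norm (c k z * F z) \<le> (\<bar>snd z\<bar> powr \<beta> + ((snd z)\<^sup>2 + 1) powr \<bar>\<beta> / 2\<bar>) * norm (F z)"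
      unfolding norm_mult using bd[OF elim] by (intro mult_right_mono) auto
    then show ?case by (simp add: w_def abs_mult algebra_simps)
  qed
  have "(\<lambda>k. LINT z|lebesgue. c k z * F z) \<longlonglongrightarrow> (LINT z|lebesgue. \<bar>snd z\<bar> powr \<beta> * F z)"
  proof (rule integral_dominated_convergence[OF _ m w _ le])
    show "(\<lambda>z. \<bar>snd z\<bar> powr \<beta> * F z) \<in> borel_measurable lebesgue" using wF by auto
    show "AE z in lebesgue. (\<lambda>k. c k z * F z) \<longlonglongrightarrow> \<bar>snd z\<bar> powr \<beta> * F z"
      using AE_snd_nonzero by eventually_elim (intro tendsto_mult tendsto_const lim)
  qed
  then show "(\<lambda>k. LINT z:K|lebesgue. c k z * f z) \<longlonglongrightarrow> (LINT z:K|lebesgue. \<bar>snd z\<bar> powr \<beta> * f z)"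
    by (simp add: F_def set_lebesgue_integral_def mult_ac)
  have "integrable lebesgue (\<lambda>z. c k z * F z)"
    by (rule Bochner_Integration.integrable_bound[OF w m]) (use le[of k] in \<open>eventually_elim, force\<close>)
  then show "(\<lambda>z. c k z * f z) absolutely_integrable_on K"
    by (simp add: F_def set_integrable_def mult_ac)
qed

lemma power2_powr_half: "(y\<^sup>2) powr (\<beta> / 2) = \<bar>y\<bar> powr \<beta>" for y \<beta> :: real
proof (cases "y = 0")
  case False
  then have "y\<^sup>2 = \<bar>y\<bar> powr 2" by simp
  then show ?thesis by (simp only: powr_powr) simp
qed simp

lemma regularised_weight_bound:
  fixes y e \<beta> :: real
  assumes "y \<noteq> 0" "0 < e" "e \<le> 1"
  shows "(y\<^sup>2 + e) powr (\<beta> / 2) \<le> \<bar>y\<bar> powr \<beta> + (y\<^sup>2 + 1) powr \<bar>\<beta> / 2\<bar>"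
proof (cases "\<beta> \<ge> 0")
  case True
  have "(y\<^sup>2 + e) powr (\<beta> / 2) \<le> (y\<^sup>2 + 1) powr (\<beta> / 2)"
    using True assms by (intro powr_mono2) auto
  then show ?thesis using True by (simp add: add_increasing)
next
  case False
  have "(y\<^sup>2 + e) powr (\<beta> / 2) \<le> (y\<^sup>2) powr (\<beta> / 2)"
    using False assms by (intro powr_mono2') auto
  also have "\<dots> = \<bar>y\<bar> powr \<beta>"
    by (rule power2_powr_half)
  finally show ?thesis using powr_ge_zero[of "y\<^sup>2 + 1" "\<bar>\<beta> / 2\<bar>"] by linarith
qed

lemma regularised_weight_limit:
  fixes y \<beta> :: real
  assumes "y \<noteq> 0"
  shows "(\<lambda>k. (y\<^sup>2 + inverse (real (Suc k))) powr b) \<longlonglongrightarrow> (y\<^sup>2) powr b"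
proof -
  have "(\<lambda>k. (y\<^sup>2 + inverse (real (Suc k))) powr b) \<longlonglongrightarrow> (y\<^sup>2 + 0) powr b"
    using assms by (intro tendsto_powr tendsto_add tendsto_const LIMSEQ_inverse_real_of_nat) auto
  then show ?thesis by simp
qed

lemma weight_scaled_continuous_integrable:
  fixes f :: "'a::euclidean_space \<times> real \<Rightarrow> real"
  assumes "-1 < \<beta>" "compact K" "continuous_on K f"
  shows "(\<lambda>z. \<bar>snd z\<bar> powr \<beta> * f z) absolutely_integrable_on K"
proof -
  have "(\<lambda>z. f z *\<^sub>R (\<bar>snd z\<bar> powr \<beta>)) absolutely_integrable_on K"
    by (rule absolutely_integrable_scaleR_continuous[OF assms(2,3)])
       (rule weight_absolutely_integrable[OF assms(1) compact_imp_bounded[OF assms(2)] compact_sets_lebesgue[OF assms(2)]])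
  then show ?thesis by (simp add: mult.commute)
qed

text \<open>
  For \<open>m = max 0 (\<tau> - q)\<close> the field \<open>\<bar>y\<bar>\<^sup>\<beta> m\<^sup>2 (z - \<zeta>)\<close> has divergence \<open>\<bar>y\<bar>\<^sup>\<beta> ((\<beta> + DIM) m\<^sup>2 - 4 q m)\<close>: the
  weight contributes the factor \<open>\<beta>\<close> because \<open>z - \<zeta>\<close> has last component \<open>y\<close>.  The field is a multiple of
  \<open>\<bar>y\<bar>\<^sup>\<beta> \<nabla>(m\<^sup>3)\<close>, so the integral of \<open>u\<close> times this divergence is 0 for a weighted harmonic \<open>u\<close>.  Substituting
  \<open>q m = \<tau> m - m\<^sup>2\<close> gives the claim.
\<close>

lemma radial_identity:
  fixes u :: "'a::euclidean_space \<times> real \<Rightarrow> real"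
  assumes \<beta>: "-1 < \<beta>" and u: "weighted_harmonic \<beta> \<Omega> u" and \<zeta>: "snd \<zeta> = 0"
    and sub: "cball \<zeta> (sqrt \<tau>) \<subseteq> \<Omega>" 
  defines "q \<equiv> \<lambda>z. (norm (z - \<zeta>))\<^sup>2"
  shows "(\<beta> + DIM('a \<times> real) + 4) * 
       (LINT z:cball \<zeta> (sqrt \<tau>)|lebesgue. \<bar>snd z\<bar> powr \<beta> * (u z * (max 0 (\<tau> - q z))\<^sup>2))
    = 4 * \<tau> * (LINT z:cball \<zeta> (sqrt \<tau>)|lebesgue. \<bar>snd z\<bar> powr \<beta> * (u z * max 0 (\<tau> - q z)))"
proof -
  define K where "K = cball \<zeta> (sqrt \<tau>)"
  have K: "compact K" "K \<subseteq> \<Omega>" using sub by (auto simp: K_def)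
  have uc: "continuous_on \<Omega> u" using u by (simp add: weighted_harmonic_def)
  obtain G where G: "has_weak_gradient \<Omega> u G" "locally_integrable_on \<Omega> (\<lambda>z. \<bar>snd z\<bar> powr \<beta> *\<^sub>R G z)"
    and EL: "\<forall>\<phi> D. test_function \<Omega> \<phi> D \<longrightarrow> (LINT z:\<Omega>|lebesgue. (\<bar>snd z\<bar> powr \<beta> *\<^sub>R G z) \<bullet> D z) = 0"
    using u unfolding weighted_harmonic_def by (elim conjE exE)
  define m where "m z = max 0 (\<tau> - q z)" for z
  define H where "H z = (m z)\<^sup>2" for z
  have off: "m z = 0" if "z \<notin> K" for z
    using that sqrt_le_D[of \<tau> "norm (z - \<zeta>)"] 
    by (auto simp: K_def m_def q_def dist_norm norm_minus_commute)
  have qm: "q z * m z = \<tau> * m z - H z" for z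
    by (auto simp: m_def H_def max_def power2_eq_square algebra_simps)
  define n where "n = real DIM('a \<times> real)"
  define f0 where "f0 z = u z * m z" for z
  define f1 where "f1 z = u z * H z" for z
  define f2 where "f2 z = u z * (n * H z - 4 * q z * m z)" for z
  define f3 where "f3 z = H z * (G z \<bullet> (z - \<zeta>))" for z
  have cont: "continuous_on S q" "continuous_on S m" "continuous_on S H" for S
    unfolding q_def H_def m_def by (intro continuous_intros)+
  have uK: "continuous_on K u" using uc K(2) continuous_on_subset by blast
  have fc: "continuous_on K f0" "continuous_on K f1" "continuous_on K f2"
    unfolding f0_def f1_def f2_def by (intro continuous_intros cont uK)+
  note wint = weight_scaled_continuous_integrable[OF \<beta> K(1)]
  note cint = absolutely_integrable_continuous_compact[OF K(1)]
  have f3_int: "f3 absolutely_integrable_on K" 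
    and f3_wint: "(\<lambda>z. \<bar>snd z\<bar> powr \<beta> * f3 z) absolutely_integrable_on K"
  proof -
    have c: "continuous_on K (\<lambda>z. H z *\<^sub>R (z - \<zeta>))" by (intro continuous_intros cont)
    have "G absolutely_integrable_on K" 
      using G(1) K by (auto simp: has_weak_gradient_def locally_integrable_on_def)
    from absolutely_integrable_inner_continuous[OF K(1) c this]
    show "f3 absolutely_integrable_on K" by (simp add: f3_def[abs_def])
    have "(\<lambda>z. \<bar>snd z\<bar> powr \<beta> *\<^sub>R G z) absolutely_integrable_on K" 
      using G(2) K by (auto simp: locally_integrable_on_def)
    from absolutely_integrable_inner_continuous[OF K(1) c this]
    show "(\<lambda>z. \<bar>snd z\<bar> powr \<beta> * f3 z) absolutely_integrable_on K" by (simp add: f3_def mult_ac)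
  qed
  define W where "W f = (LINT z:K|lebesgue. \<bar>snd z\<bar> powr \<beta> * f z)" for f :: "'a \<times> real \<Rightarrow> real"
  have testH: "test_function \<Omega> H (\<lambda>z. (- 4 * m z) *\<^sub>R (z - \<zeta>))"
    using test_function_cutoff[OF sub, of 0] by (simp add: H_def[abs_def] m_def q_def power2_eq_square)
  have W3: "W f3 = 0"
  proof -
    have "test_function \<Omega> (\<lambda>z. (m z) ^ 3) (\<lambda>z. (- 6 * H z) *\<^sub>R (z - \<zeta>))"
      using test_function_cutoff[OF sub, of 1] 
      by (simp add: H_def m_def q_def power2_eq_square power3_eq_cube eval_nat_numeral)
    with EL have "(LINT z:\<Omega>|lebesgue. (\<bar>snd z\<bar> powr \<beta> *\<^sub>R G z) \<bullet> ((- 6 * H z) *\<^sub>R (z - \<zeta>))) = 0"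
      by (elim allE impE)
    then have "(LINT z:\<Omega>|lebesgue. (- 6) * (\<bar>snd z\<bar> powr \<beta> * f3 z)) = 0"
      by (simp add: f3_def mult_ac)
    moreover have "(LINT z:\<Omega>|lebesgue. (- 6) * (\<bar>snd z\<bar> powr \<beta> * f3 z)) = 
        (LINT z:K|lebesgue. (- 6) * (\<bar>snd z\<bar> powr \<beta> * f3 z))"
      by (rule set_integral_cong_support) (use K(2) off in \<open>auto simp: f3_def H_def\<close>)
    ultimately show ?thesis unfolding W_def by (simp only: set_integral_mult_right)
  qed
  \<comment> \<open>\<open>a k\<close> is the regularised weight, and \<open>\<beta> * b k\<close> is the product of \<open>y\<close> and its \<open>y\<close>-derivative; both
    \<open>a k\<close> and \<open>b k\<close> tend to \<open>\<bar>y\<bar>\<^sup>\<beta>\<close>.\<close>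
  define e where "e k = inverse (real (Suc k))" for k
  have e: "e k > 0" "e k \<le> 1" for k by (auto simp: e_def field_simps)
  define a where "a k z = ((snd z)\<^sup>2 + e k) powr (\<beta> / 2)" for k and z :: "'a \<times> real"
  define b where "b k z = (snd z)\<^sup>2 * ((snd z)\<^sup>2 + e k) powr (\<beta> / 2 - 1)" for k and z :: "'a \<times> real"
  have pos: "(snd z)\<^sup>2 + e k > 0" for k and z :: "'a \<times> real" using e(1)[of k] by (simp add: add_nonneg_pos)
  have ab_cont: "continuous_on UNIV (a k)" "continuous_on UNIV (b k)" for k
    unfolding a_def b_def by (intro continuous_intros, use pos in \<open>auto simp: less_imp_neq[symmetric]\<close>)+
  have a_bd: "\<bar>a k z\<bar> \<le> \<bar>snd z\<bar> powr \<beta> + ((snd z)\<^sup>2 + 1) powr \<bar>\<beta> / 2\<bar>" if "snd z \<noteq> 0" for k z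
    using regularised_weight_bound[OF that e] by (simp add: a_def)
  have "b k z \<le> a k z" for k z
  proof -
    have "b k z \<le> ((snd z)\<^sup>2 + e k) * ((snd z)\<^sup>2 + e k) powr (\<beta> / 2 - 1)"
      unfolding b_def using e(1)[of k] by (intro mult_right_mono) auto
    also have "\<dots> = a k z" using pos[of z k] by (simp add: a_def powr_mult_base)
    finally show ?thesis .
  qed
  moreover have "b k z \<ge> 0" for k z by (simp add: b_def)
  ultimately have b_bd: "\<bar>b k z\<bar> \<le> \<bar>snd z\<bar> powr \<beta> + ((snd z)\<^sup>2 + 1) powr \<bar>\<beta> / 2\<bar>" if "snd z \<noteq> 0" for k z
    using a_bd[OF that, of k] by (metis abs_ge_self abs_of_nonneg order_trans)
  have a_lim: "(\<lambda>k. a k z) \<longlonglongrightarrow> \<bar>snd z\<bar> powr \<beta>" if "snd z \<noteq> 0" for z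
    using regularised_weight_limit[OF that, of "\<beta> / 2"] by (simp add: a_def e_def power2_powr_half)
  have b_lim: "(\<lambda>k. b k z) \<longlonglongrightarrow> \<bar>snd z\<bar> powr \<beta>" if "snd z \<noteq> 0" for z
  proof -
    have "(\<lambda>k. b k z) \<longlonglongrightarrow> (snd z)\<^sup>2 * ((snd z)\<^sup>2) powr (\<beta> / 2 - 1)"
      unfolding b_def e_def by (intro tendsto_mult tendsto_const regularised_weight_limit that)
    moreover have "(snd z)\<^sup>2 * ((snd z)\<^sup>2) powr (\<beta> / 2 - 1) = ((snd z)\<^sup>2) powr (\<beta> / 2)"
      using that by (simp add: powr_mult_base)
    ultimately show ?thesis by (simp add: power2_powr_half)
  qed
  have ab_meas: "a k \<in> borel_measurable borel" "b k \<in> borel_measurable borel" for k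
    using ab_cont by (auto intro: borel_measurable_continuous_onI)
  note b1 = integral_tendsto_weighted_integral[OF cint[OF fc(2)] wint[OF fc(2)] K(1) ab_meas(2) b_bd b_lim]
  note a2 = integral_tendsto_weighted_integral[OF cint[OF fc(3)] wint[OF fc(3)] K(1) ab_meas(1) a_bd a_lim]
  note a3 = integral_tendsto_weighted_integral[OF f3_int f3_wint K(1) ab_meas(1) a_bd a_lim]
  have key: "\<beta> * (LINT z:K|lebesgue. b k z * f1 z) + (LINT z:K|lebesgue. a k z * f2 z)
      = - (LINT z:K|lebesgue. a k z * f3 z)" for k
  proof -
    define E where "E z = (\<beta> / 2 * ((snd z)\<^sup>2 + e k) powr (\<beta> / 2 - 1)) *\<^sub>R (0::'a, 2 * snd z)" for z :: "'a \<times> real"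
    have Ea: "GDERIV (a k) z :> E z" for z
    proof -
      have "GDERIV (\<lambda>z::'a \<times> real. (snd z)\<^sup>2) z :> (0::'a, 2 * snd z)"
        unfolding gderiv_def by (auto intro!: derivative_eq_intros simp: inner_prod_def)
      moreover have "((\<lambda>t. (t + e k) powr (\<beta> / 2)) has_real_derivative 
           \<beta> / 2 * ((snd z)\<^sup>2 + e k) powr (\<beta> / 2 - 1)) (at ((snd z)\<^sup>2))"
        using pos[of z k] by (auto intro!: derivative_eq_intros)
      ultimately show ?thesis unfolding a_def[abs_def] E_def by (rule GDERIV_DERIV_compose)
    qed
    have Ec: "continuous_on UNIV E"
      unfolding E_def by (intro continuous_intros) (use pos in \<open>auto simp: less_imp_neq[symmetric]\<close>)
    have "test_function \<Omega> (\<lambda>z. H z * a k z) (\<lambda>z. H z *\<^sub>R E z + a k z *\<^sub>R (- 4 * m z) *\<^sub>R (z - \<zeta>))"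
      by (rule test_function_mult_C1[OF testH Ea Ec])
    from weak_gradient_radial_field[OF G(1) this, of \<zeta>]
    have "(LINT z:\<Omega>|lebesgue. u z * ((H z *\<^sub>R E z + a k z *\<^sub>R (- 4 * m z) *\<^sub>R (z - \<zeta>)) \<bullet> (z - \<zeta>) + n * (H z * a k z)))
       = - (LINT z:\<Omega>|lebesgue. H z * a k z * (G z \<bullet> (z - \<zeta>)))"
      by (simp add: n_def)
    moreover have "u z * ((H z *\<^sub>R E z + a k z *\<^sub>R (- 4 * m z) *\<^sub>R (z - \<zeta>)) \<bullet> (z - \<zeta>) + n * (H z * a k z))
        = \<beta> * (b k z * f1 z) + a k z * f2 z" for z
    proof -
      have "E z \<bullet> (z - \<zeta>) = \<beta> * b k z"
        using \<zeta> by (simp add: E_def b_def inner_prod_def power2_eq_square)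
      moreover have "(z - \<zeta>) \<bullet> (z - \<zeta>) = q z" by (simp add: q_def power2_norm_eq_inner)
      ultimately show ?thesis by (simp only: inner_add_left inner_scaleR_left f1_def f2_def) (simp add: algebra_simps)
    qed
    moreover have "H z * a k z * (G z \<bullet> (z - \<zeta>)) = a k z * f3 z" for z by (simp add: f3_def)
    ultimately have "(LINT z:\<Omega>|lebesgue. \<beta> * (b k z * f1 z) + a k z * f2 z) = - (LINT z:\<Omega>|lebesgue. a k z * f3 z)"
      by simp
    moreover have "(LINT z:\<Omega>|lebesgue. \<beta> * (b k z * f1 z) + a k z * f2 z) =
        (LINT z:K|lebesgue. \<beta> * (b k z * f1 z) + a k z * f2 z)"
      by (rule set_integral_cong_support) (use K(2) off in \<open>auto simp: f1_def f2_def H_def\<close>)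
    moreover have "(LINT z:\<Omega>|lebesgue. a k z * f3 z) = (LINT z:K|lebesgue. a k z * f3 z)"
      by (rule set_integral_cong_support) (use K(2) off in \<open>auto simp: f3_def H_def\<close>)
    moreover have "(LINT z:K|lebesgue. \<beta> * (b k z * f1 z) + a k z * f2 z) =
       (LINT z:K|lebesgue. \<beta> * (b k z * f1 z)) + (LINT z:K|lebesgue. a k z * f2 z)"
      by (rule set_integral_add(2)[OF set_integrable_mult_right[OF b1(2)] a2(2)])
    ultimately show ?thesis by (simp only: set_integral_mult_right)
  qed
  have "(\<lambda>k. \<beta> * (LINT z:K|lebesgue. b k z * f1 z) + (LINT z:K|lebesgue. a k z * f2 z)) \<longlonglongrightarrow> \<beta> * W f1 + W f2"
    unfolding W_def by (intro tendsto_add tendsto_mult tendsto_const b1(1) a2(1))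
  moreover have "(\<lambda>k. - (LINT z:K|lebesgue. a k z * f3 z)) \<longlonglongrightarrow> - W f3"
    unfolding W_def by (intro tendsto_minus a3(1))
  ultimately have lim: "\<beta> * W f1 + W f2 = - W f3" unfolding key by (rule LIMSEQ_unique)
  have "f2 z = (n + 4) * f1 z - 4 * \<tau> * f0 z" for z
    unfolding f0_def f1_def f2_def mult.assoc qm by (simp add: algebra_simps)
  then have "\<bar>snd z\<bar> powr \<beta> * f2 z = (n + 4) * (\<bar>snd z\<bar> powr \<beta> * f1 z) - 4 * \<tau> * (\<bar>snd z\<bar> powr \<beta> * f0 z)" for z
    by (simp only:) (simp add: algebra_simps)
  then have "W f2 = (LINT z:K|lebesgue. (n + 4) * (\<bar>snd z\<bar> powr \<beta> * f1 z) - 4 * \<tau> * (\<bar>snd z\<bar> powr \<beta> * f0 z))"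
    unfolding W_def by (simp only:)
  also have "\<dots> = (LINT z:K|lebesgue. (n + 4) * (\<bar>snd z\<bar> powr \<beta> * f1 z)) - (LINT z:K|lebesgue. 4 * \<tau> * (\<bar>snd z\<bar> powr \<beta> * f0 z))"
    by (rule set_integral_diff(2)[OF set_integrable_mult_right[OF wint[OF fc(2)]] set_integrable_mult_right[OF wint[OF fc(1)]]])
  also have "\<dots> = (n + 4) * W f1 - 4 * \<tau> * W f0"
    unfolding W_def by (simp only: set_integral_mult_right)
  finally have "(\<beta> + n + 4) * W f1 = 4 * \<tau> * W f0"
    using lim W3 by (simp add: algebra_simps)
  then show ?thesis unfolding W_def f0_def f1_def H_def m_def K_def n_def by simp
qed

section \<open>Weighted mean values\<close>

lemma pos_part_square_expansion:
  fixes a h :: real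
  shows "\<bar>(max 0 (a + h))\<^sup>2 - (max 0 a)\<^sup>2 - 2 * h * max 0 a\<bar> \<le> h\<^sup>2"
proof -
  consider "a \<ge> 0" "a + h \<ge> 0" | "a \<ge> 0" "a + h < 0" | "a < 0" "a + h \<ge> 0" | "a < 0" "a + h < 0"
    by linarith
  then show ?thesis
  proof cases
    case 1
    then show ?thesis by (simp add: power2_sum)
  next
    case 2
    have "a * (- (a + 2 * h)) \<ge> 0" using 2 by (intro mult_nonneg_nonneg) auto
    moreover have "(a + h)\<^sup>2 \<ge> 0" by simp
    ultimately show ?thesis using 2 by (simp add: power2_eq_square algebra_simps)
  next
    case 3
    then have "(a + h)\<^sup>2 \<le> h\<^sup>2" by (intro power_mono) auto
    then show ?thesis using 3 by simp
  qed simp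
qed

text \<open>
  The expansion of \<open>(max 0 (t + h - q))\<^sup>2\<close> to first order in \<open>h\<close> has an error of at most \<open>h\<^sup>2\<close>, uniformly in
  \<open>q\<close>, so the integral can be differentiated directly.
\<close>

lemma has_derivative_pos_part_integral:
  fixes f q :: "'a::euclidean_space \<Rightarrow> real"
  assumes f: "f absolutely_integrable_on K" and K: "compact K" and q: "continuous_on K q"
  shows "((\<lambda>t. LINT z:K|lebesgue. f z * (max 0 (t - q z))\<^sup>2) has_real_derivative
     2 * (LINT z:K|lebesgue. f z * max 0 (t - q z))) (at t)"
proof -
  define A where "A t = (LINT z:K|lebesgue. f z * (max 0 (t - q z))\<^sup>2)" for t
  define B where "B = (LINT z:K|lebesgue. f z * max 0 (t - q z))"
  define C where "C = (LINT z:K|lebesgue. \<bar>f z\<bar>)"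
  have int: "(\<lambda>z. f z * g z) absolutely_integrable_on K" if "continuous_on K g" for g :: "'a \<Rightarrow> real"
    using absolutely_integrable_scaleR_continuous[OF K that f] by (simp add: mult.commute)
  have Ai: "(\<lambda>z. f z * (max 0 (t - q z))\<^sup>2) absolutely_integrable_on K" for t
    by (intro int continuous_intros q)
  have Bi: "(\<lambda>z. f z * max 0 (t - q z)) absolutely_integrable_on K"
    by (intro int continuous_intros q)
  have fi: "(\<lambda>z. \<bar>f z\<bar>) absolutely_integrable_on K" by (rule set_integrable_abs[OF f])
  have est: "\<bar>A (t + h) - A t - 2 * h * B\<bar> \<le> h\<^sup>2 * C" for h
  proof -
    define r where "r z = f z * (max 0 (t + h - q z))\<^sup>2 - f z * (max 0 (t - q z))\<^sup>2 - 2 * h * (f z * max 0 (t - q z))" for z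
    have ri: "r absolutely_integrable_on K"
      unfolding r_def[abs_def] by (intro set_integral_diff set_integrable_mult_right Ai Bi)
    have "(LINT z:K|lebesgue. r z) = A (t + h) - A t - 2 * h * B"
      unfolding r_def A_def B_def 
      by (simp only: set_integral_diff(2)[OF set_integral_diff(1)[OF Ai Ai] set_integrable_mult_right[OF Bi]]
          set_integral_diff(2)[OF Ai Ai] set_integral_mult_right)
    moreover have "\<bar>LINT z:K|lebesgue. r z\<bar> \<le> (LINT z:K|lebesgue. h\<^sup>2 * \<bar>f z\<bar>)"
    proof -
      have "\<bar>LINT z:K|lebesgue. r z\<bar> \<le> (LINT z:K|lebesgue. \<bar>r z\<bar>)"
        using set_integral_norm_bound[OF ri] by simp
      also have "\<dots> \<le> (LINT z:K|lebesgue. h\<^sup>2 * \<bar>f z\<bar>)"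
      proof (rule set_integral_mono[OF set_integrable_abs[OF ri] set_integrable_mult_right[OF fi]])
        fix z
        have "r z = f z * ((max 0 (t - q z + h))\<^sup>2 - (max 0 (t - q z))\<^sup>2 - 2 * h * max 0 (t - q z))"
          unfolding r_def by (simp add: algebra_simps)
        then have "\<bar>r z\<bar> = \<bar>f z\<bar> * \<bar>(max 0 (t - q z + h))\<^sup>2 - (max 0 (t - q z))\<^sup>2 - 2 * h * max 0 (t - q z)\<bar>"
          by (simp only: abs_mult)
        also have "\<dots> \<le> \<bar>f z\<bar> * h\<^sup>2" by (intro mult_left_mono pos_part_square_expansion) simp
        finally show "\<bar>r z\<bar> \<le> h\<^sup>2 * \<bar>f z\<bar>" by (simp add: mult.commute)
      qed
      finally show ?thesis .
    qed
    ultimately show ?thesis unfolding C_def by simp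
  qed
  have "((\<lambda>h. (A (t + h) - A t) / h - 2 * B) \<longlongrightarrow> 0) (at 0)"
  proof (rule Lim_null_comparison)
    show "\<forall>\<^sub>F h in at 0. norm ((A (t + h) - A t) / h - 2 * B) \<le> \<bar>h\<bar> * C"
    proof (rule eventually_at_topological[THEN iffD2], intro exI[of _ UNIV] conjI ballI impI)
      fix h :: real assume "h \<noteq> 0"
      then have "(A (t + h) - A t) / h - 2 * B = (A (t + h) - A t - 2 * h * B) / h"
        by (simp add: field_simps)
      then have "norm ((A (t + h) - A t) / h - 2 * B) = \<bar>A (t + h) - A t - 2 * h * B\<bar> / \<bar>h\<bar>" by simp
      also have "\<dots> \<le> h\<^sup>2 * C / \<bar>h\<bar>" by (intro divide_right_mono est) simp
      also have "\<dots> = \<bar>h\<bar> * C" using \<open>h \<noteq> 0\<close> by (simp add: field_simps power2_eq_square)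
      finally show "norm ((A (t + h) - A t) / h - 2 * B) \<le> \<bar>h\<bar> * C" .
    qed auto
    have "((\<lambda>h. \<bar>h\<bar> * C) \<longlongrightarrow> \<bar>0\<bar> * C) (at 0)" by (intro tendsto_intros)
    then show "((\<lambda>h. \<bar>h\<bar> * C) \<longlongrightarrow> 0) (at 0)" by simp
  qed
  then have "((\<lambda>h. (A (t + h) - A t) / h) \<longlongrightarrow> 2 * B) (at 0)" by (rule LIM_zero_cancel)
  then show ?thesis unfolding DERIV_def A_def B_def .
qed

text \<open>The Euler equation \<open>\<gamma> A = t A'\<close> says that \<open>A(t) t\<^sup>-\<^sup>\<gamma>\<close> has derivative 0.\<close>

lemma power_law_of_Euler_equation:
  fixes A B :: "real \<Rightarrow> real"
  assumes A: "\<And>t. 0 < t \<Longrightarrow> t < T \<Longrightarrow> (A has_real_derivative B t) (at t)"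
    and AB: "\<And>t. 0 < t \<Longrightarrow> t < T \<Longrightarrow> \<gamma> * A t = t * B t"
  shows "\<exists>c. \<forall>t. 0 < t \<longrightarrow> t < T \<longrightarrow> A t = c * t powr \<gamma>"
proof -
  have "\<exists>c. \<forall>t\<in>{0<..<T}. A t * t powr (- \<gamma>) = c"
  proof (rule has_field_derivative_zero_constant)
    fix t assume t: "t \<in> {0<..<T}"
    have "((\<lambda>t. A t * t powr (- \<gamma>)) has_real_derivative A t * (- \<gamma> * t powr (- \<gamma> - 1)) + B t * t powr (- \<gamma>)) (at t)"
      using t by (intro DERIV_mult' A has_real_derivative_powr) auto
    moreover have "A t * (- \<gamma> * t powr (- \<gamma> - 1)) + B t * t powr (- \<gamma>) = t powr (- \<gamma> - 1) * (t * B t - \<gamma> * A t)"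
    proof -
      have "t powr (- \<gamma>) = t * t powr (- \<gamma> - 1)" using t by (simp add: powr_mult_base)
      then show ?thesis by (simp only:) (simp add: algebra_simps)
    qed
    ultimately show "((\<lambda>t. A t * t powr (- \<gamma>)) has_real_derivative 0) (at t within {0<..<T})"
      using AB[of t] t by (simp add: has_field_derivative_at_within)
  qed simp
  then obtain c where c: "\<And>t. t \<in> {0<..<T} \<Longrightarrow> A t * t powr (- \<gamma>) = c" by blast
  have "A t = c * t powr \<gamma>" if "0 < t" "t < T" for t
    using c[of t] that by (simp add: powr_minus field_simps)
  then show ?thesis by blast
qed

lemma weighted_harmonic_power_law:
  fixes u :: "'a::euclidean_space \<times> real \<Rightarrow> real"
  assumes \<beta>: "-1 < \<beta>" and u: "weighted_harmonic \<beta> \<Omega> u" and \<zeta>: "snd \<zeta> = 0"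
    and sub: "cball \<zeta> r \<subseteq> \<Omega>" and r: "0 < r"
  shows "\<exists>c. \<forall>t. 0 < t \<longrightarrow> t < r\<^sup>2 \<longrightarrow>
     (LINT z:cball \<zeta> r|lebesgue. \<bar>snd z\<bar> powr \<beta> * (u z * (max 0 (t - (norm (z - \<zeta>))\<^sup>2))\<^sup>2))
       = c * t powr ((\<beta> + DIM('a \<times> real) + 4) / 2)"
proof -
  define K where "K = cball \<zeta> r"
  define f where "f z = \<bar>snd z\<bar> powr \<beta> * u z" for z
  define q where "q z = (norm (z - \<zeta>))\<^sup>2" for z
  have K: "compact K" by (simp add: K_def)
  have "continuous_on K u" using u sub continuous_on_subset unfolding weighted_harmonic_def K_def by blast
  then have f: "f absolutely_integrable_on K"
    unfolding f_def[abs_def] by (rule weight_scaled_continuous_integrable[OF \<beta> K])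
  have q: "continuous_on K q" unfolding q_def by (intro continuous_intros)
  define A where "A t = (LINT z:K|lebesgue. f z * (max 0 (t - q z))\<^sup>2)" for t
  define B where "B t = 2 * (LINT z:K|lebesgue. f z * max 0 (t - q z))" for t
  have "\<exists>c. \<forall>t. 0 < t \<longrightarrow> t < r\<^sup>2 \<longrightarrow> A t = c * t powr ((\<beta> + DIM('a \<times> real) + 4) / 2)"
  proof (rule power_law_of_Euler_equation)
    show "(A has_real_derivative B t) (at t)" for t
      unfolding A_def[abs_def] B_def by (rule has_derivative_pos_part_integral[OF f K q])
    fix t assume t: "0 < t" "t < r\<^sup>2"
    have "sqrt t < r" using t r by (simp add: real_less_lsqrt)
    then have sub': "cball \<zeta> (sqrt t) \<subseteq> K" unfolding K_def by (auto intro: subset_cball)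
    have off: "max 0 (t - q z) = 0" if "z \<notin> cball \<zeta> (sqrt t)" for z
      using that sqrt_le_D[of t "norm (z - \<zeta>)"] by (auto simp: q_def dist_norm norm_minus_commute)
    have "A t = (LINT z:cball \<zeta> (sqrt t)|lebesgue. f z * (max 0 (t - q z))\<^sup>2)"
      unfolding A_def by (rule set_integral_cong_support) (use sub' off in auto)
    moreover have "B t = 2 * (LINT z:cball \<zeta> (sqrt t)|lebesgue. f z * max 0 (t - q z))"
      unfolding B_def by (rule arg_cong[where f = "(*) 2"], rule set_integral_cong_support) (use sub' off in auto)
    ultimately show "(\<beta> + DIM('a \<times> real) + 4) / 2 * A t = t * B t"
      using radial_identity[OF \<beta> u \<zeta>, of t] sub' sub unfolding f_def q_def K_def 
      by (simp add: mult.assoc)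
  qed
  then show ?thesis unfolding A_def f_def q_def K_def by (simp only: mult.assoc)
qed

lemma weight_cutoff_integral_pos:
  fixes \<zeta> :: "'a::euclidean_space \<times> real"
  assumes "-1 < \<beta>" "t > 0"
  shows "(LINT z|lebesgue. \<bar>snd z\<bar> powr \<beta> * (max 0 (t - (norm (z - \<zeta>))\<^sup>2))\<^sup>2) > 0" (is "integral\<^sup>L _ ?f > 0")
    and "integrable lebesgue (\<lambda>z. \<bar>snd z\<bar> powr \<beta> * (max 0 (t - (norm (z - \<zeta>))\<^sup>2))\<^sup>2)"
proof -
  have off: "max 0 (t - (norm (z - \<zeta>))\<^sup>2) = 0" if "z \<notin> cball \<zeta> (sqrt t)" for z
    using that sqrt_le_D[of t "norm (z - \<zeta>)"] by (auto simp: dist_norm norm_minus_commute)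
  have "set_integrable lebesgue (cball \<zeta> (sqrt t)) ?f"
    by (intro weight_scaled_continuous_integrable assms continuous_intros) auto
  moreover have "set_integrable lebesgue (cball \<zeta> (sqrt t)) ?f \<longleftrightarrow> set_integrable lebesgue UNIV ?f"
    by (rule set_integrable_cong_support) (use off in auto)
  ultimately show int: "integrable lebesgue ?f" by (simp add: set_integrable_def)
  have "integral\<^sup>L lebesgue ?f \<noteq> 0"
  proof
    assume "integral\<^sup>L lebesgue ?f = 0"
    then have "AE z in lebesgue. ?f z = 0"
      using integral_nonneg_eq_0_iff_AE[OF int] by simp
    then have "AE z in lebesgue. z \<notin> ball \<zeta> (sqrt t)"
      using AE_snd_nonzero
    proof eventually_elim
      case (elim z)
      then have "t \<le> (norm (z - \<zeta>))\<^sup>2" by auto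
      then have "sqrt t \<le> norm (z - \<zeta>)" by (simp add: real_le_lsqrt)
      then show ?case by (simp add: dist_norm norm_minus_commute)
    qed
    then have "ball \<zeta> (sqrt t) \<in> null_sets lebesgue"
      using AE_iff_null[of lebesgue "\<lambda>z. z \<notin> ball \<zeta> (sqrt t)"] by (simp add: ball_def)
    then have "negligible (ball \<zeta> (sqrt t))" by (simp add: negligible_iff_null_sets)
    then show False using open_not_negligible[of "ball \<zeta> (sqrt t)"] assms(2) by simp
  qed
  moreover have "integral\<^sup>L lebesgue ?f \<ge> 0" by (intro Bochner_Integration.integral_nonneg) auto
  ultimately show "integral\<^sup>L lebesgue ?f > 0" by linarith
qed

lemma weight_cutoff_integral_translate:
  fixes \<zeta> :: "'a::euclidean_space \<times> real"
  assumes "snd \<zeta> = 0"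
  shows "(LINT z|lebesgue. \<bar>snd z\<bar> powr \<beta> * (max 0 (t - (norm (z - \<zeta>))\<^sup>2))\<^sup>2)
    = (LINT z::'a \<times> real|lebesgue. \<bar>snd z\<bar> powr \<beta> * (max 0 (t - (norm z)\<^sup>2))\<^sup>2)"
proof -
  define f where "f z = \<bar>snd z\<bar> powr \<beta> * (max 0 (t - (norm (z - \<zeta>))\<^sup>2))\<^sup>2" for z :: "'a \<times> real"
  have snd: "(snd :: 'a \<times> real \<Rightarrow> real) \<in> borel_measurable borel"
    by (intro borel_measurable_continuous_onI continuous_intros)
  have w: "(\<lambda>z::'a \<times> real. \<bar>snd z\<bar> powr \<beta>) \<in> borel_measurable borel"
    by (rule measurable_compose[OF snd, of "\<lambda>y. \<bar>y\<bar> powr \<beta>"]) measurable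
  have fm: "f \<in> borel_measurable borel" unfolding f_def
    by (intro borel_measurable_times w borel_measurable_continuous_onI continuous_intros)
  have gm: "(\<lambda>z::'a \<times> real. \<bar>snd z\<bar> powr \<beta> * (max 0 (t - (norm z)\<^sup>2))\<^sup>2) \<in> borel_measurable borel"
    by (intro borel_measurable_times w borel_measurable_continuous_onI continuous_intros)
  have "integral\<^sup>L lborel f = integral\<^sup>L (distr lborel borel ((+) \<zeta>)) f" by (simp add: lborel_distr_plus)
  also have "\<dots> = (LINT z|lborel. f (\<zeta> + z))" by (rule integral_distr) (use fm in auto)
  also have "(\<lambda>z. f (\<zeta> + z)) = (\<lambda>z. \<bar>snd z\<bar> powr \<beta> * (max 0 (t - (norm z)\<^sup>2))\<^sup>2)"
    using assms by (simp add: f_def)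
  finally show ?thesis using fm gm unfolding f_def by (simp add: integral_completion)
qed

text \<open>
  The scaling law for the weighted volume of a ball, in a form smoothed by the cutoff: it is the power
  law of the constant function 1, which is weighted harmonic.
\<close>

lemma weight_cutoff_power_law:
  assumes \<beta>: "-1 < \<beta>"
  obtains c where "c > 0" and
    "\<And>\<zeta>::'a::euclidean_space \<times> real. \<And>t. snd \<zeta> = 0 \<Longrightarrow> t > 0 \<Longrightarrow> 
      (LINT z|lebesgue. \<bar>snd z\<bar> powr \<beta> * (max 0 (t - (norm (z - \<zeta>))\<^sup>2))\<^sup>2) = c * t powr ((\<beta> + DIM('a \<times> real) + 4) / 2)"
proof -
  define \<gamma> where "\<gamma> = (\<beta> + DIM('a \<times> real) + 4) / 2"
  define J where "J t = (LINT z::'a \<times> real|lebesgue. \<bar>snd z\<bar> powr \<beta> * (max 0 (t - (norm z)\<^sup>2))\<^sup>2)" for t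
  have law: "J t = J 1 * t powr \<gamma>" if t: "t > 0" for t
  proof -
    define r where "r = t + 2"
    have r: "r > 0" "t < r\<^sup>2" "1 < r\<^sup>2" using t by (auto simp: r_def power2_eq_square algebra_simps add_pos_pos)
    obtain c where c: "\<And>s. 0 < s \<Longrightarrow> s < r\<^sup>2 \<Longrightarrow>
      (LINT z:cball (0::'a \<times> real) r|lebesgue. \<bar>snd z\<bar> powr \<beta> * (max 0 (s - (norm z)\<^sup>2))\<^sup>2) = c * s powr \<gamma>"
      using weighted_harmonic_power_law[OF \<beta> weighted_harmonic_const[of \<beta> UNIV 1], of "0::'a \<times> real" r] r(1)
      by (auto simp: \<gamma>_def)
    have "J s = c * s powr \<gamma>" if s: "0 < s" "s < r\<^sup>2" for s
    proof -
      have "max 0 (s - (norm z)\<^sup>2) = 0" if "z \<notin> cball (0::'a \<times> real) r" for z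
      proof -
        have "r \<le> norm z" using that by simp
        then have "r\<^sup>2 \<le> (norm z)\<^sup>2" using r(1) by (intro power_mono) auto
        then show ?thesis using s by simp
      qed
      then have "(LINT z:UNIV|lebesgue. \<bar>snd z\<bar> powr \<beta> * (max 0 (s - (norm (z::'a \<times> real))\<^sup>2))\<^sup>2) = 
         (LINT z:cball (0::'a \<times> real) r|lebesgue. \<bar>snd z\<bar> powr \<beta> * (max 0 (s - (norm z)\<^sup>2))\<^sup>2)"
        by (intro set_integral_cong_support) auto
      then show ?thesis using c[OF s] by (simp add: J_def set_lebesgue_integral_def)
    qed
    from this[of 1] this[of t] show ?thesis using r t by simp
  qed
  have "(LINT z|lebesgue. \<bar>snd z\<bar> powr \<beta> * (max 0 (t - (norm (z - \<zeta>))\<^sup>2))\<^sup>2) = J 1 * t powr \<gamma>"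
    if "snd \<zeta> = 0" "t > 0" for \<zeta> :: "'a \<times> real" and t
    by (rule trans[OF weight_cutoff_integral_translate[OF that(1), of \<beta> t, folded J_def] law[OF that(2)]])
  moreover have "J 1 > 0" unfolding J_def using weight_cutoff_integral_pos(1)[OF \<beta>, of 1 "0::'a \<times> real"] by simp
  ultimately show ?thesis using that[of "J 1"] unfolding \<gamma>_def by blast
qed

text \<open>
  Both integrals are multiples \<open>c t\<^sup>\<gamma>\<close> and \<open>d t\<^sup>\<gamma>\<close> of the same power.  For small \<open>t\<close> only points near \<open>\<zeta>\<close>
  contribute, where \<open>u\<close> is close to \<open>u \<zeta>\<close>; hence \<open>\<bar>c - u \<zeta> * d\<bar> \<le> e * d\<close> for every \<open>e > 0\<close>.
\<close>

lemma weighted_mean_value: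
  fixes u :: "'a::euclidean_space \<times> real \<Rightarrow> real"
  assumes \<beta>: "-1 < \<beta>" and u: "weighted_harmonic \<beta> \<Omega> u" and \<zeta>: "snd \<zeta> = 0"
    and sub: "cball \<zeta> r \<subseteq> \<Omega>" and r: "0 < r" and t: "0 < t" "t < r\<^sup>2"
  shows "(LINT z:\<Omega>|lebesgue. \<bar>snd z\<bar> powr \<beta> * (u z * (max 0 (t - (norm (z - \<zeta>))\<^sup>2))\<^sup>2))
     = u \<zeta> * (LINT z|lebesgue. \<bar>snd z\<bar> powr \<beta> * (max 0 (t - (norm (z - \<zeta>))\<^sup>2))\<^sup>2)"
proof -
  define K where "K = cball \<zeta> r"
  define q where "q z = (norm (z - \<zeta>))\<^sup>2" for z
  define \<gamma> where "\<gamma> = (\<beta> + DIM('a \<times> real) + 4) / 2"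
  define w where "w z = \<bar>snd z\<bar> powr \<beta>" for z :: "'a \<times> real"
  define A where "A s = (LINT z:K|lebesgue. w z * (u z * (max 0 (s - q z))\<^sup>2))" for s
  define J where "J s = (LINT z:K|lebesgue. w z * (max 0 (s - q z))\<^sup>2)" for s
  have uK: "continuous_on K u" using u sub continuous_on_subset unfolding weighted_harmonic_def K_def by blast
  have K: "compact K" "\<zeta> \<in> K" using r by (auto simp: K_def)
  have off: "max 0 (s - q z) = 0" if "s < r\<^sup>2" "z \<notin> K" for s z
  proof -
    have "r \<le> norm (z - \<zeta>)" using that by (simp add: K_def dist_norm norm_minus_commute)
    then have "r\<^sup>2 \<le> q z" using r unfolding q_def by (intro power_mono) auto
    then show ?thesis using that by simp
  qed
  have J_eq: "(LINT z|lebesgue. w z * (max 0 (s - q z))\<^sup>2) = J s" if "s < r\<^sup>2" for s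
  proof -
    have "(LINT z:UNIV|lebesgue. w z * (max 0 (s - q z))\<^sup>2) = J s" unfolding J_def
      by (rule set_integral_cong_support) (use off[OF that] in auto)
    then show ?thesis by (simp add: set_lebesgue_integral_def)
  qed
  have A_eq: "(LINT z:\<Omega>|lebesgue. w z * (u z * (max 0 (s - q z))\<^sup>2)) = A s" if "s < r\<^sup>2" for s
    unfolding A_def by (rule set_integral_cong_support) (use off[OF that] sub in \<open>auto simp: K_def\<close>)
  obtain c where c: "\<And>s. 0 < s \<Longrightarrow> s < r\<^sup>2 \<Longrightarrow> A s = c * s powr \<gamma>"
    using weighted_harmonic_power_law[OF \<beta> u \<zeta> sub r] unfolding A_def K_def w_def q_def \<gamma>_def by blast
  obtain d where d: "\<And>s. 0 < s \<Longrightarrow> s < r\<^sup>2 \<Longrightarrow> J s = d * s powr \<gamma>"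
    using weighted_harmonic_power_law[OF \<beta> weighted_harmonic_const[of \<beta> UNIV 1] \<zeta> _ r]
    unfolding J_def K_def w_def q_def \<gamma>_def by auto
  have J_pos: "J s > 0" if "0 < s" "s < r\<^sup>2" for s
    using weight_cutoff_integral_pos(1)[OF \<beta> that(1), of \<zeta>] J_eq[OF that(2)] by (simp add: w_def q_def)
  have "d > 0" using J_pos[OF t] d[OF t] t(1) by (simp add: zero_less_mult_iff)
  have qc: "continuous_on K q" unfolding q_def by (intro continuous_intros)
  have wint: "(\<lambda>z. w z * g z) absolutely_integrable_on K" if "continuous_on K g" for g
    unfolding w_def by (rule weight_scaled_continuous_integrable[OF \<beta> K(1) that])
  have est: "\<bar>c - u \<zeta> * d\<bar> \<le> e * d" if e: "e > 0" for e
  proof -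
    obtain \<delta> where \<delta>: "\<delta> > 0" "\<And>z. z \<in> K \<Longrightarrow> dist z \<zeta> < \<delta> \<Longrightarrow> dist (u z) (u \<zeta>) < e"
      using uK K(2) e unfolding continuous_on_iff by meson
    define s where "s = min (\<delta>\<^sup>2) (r\<^sup>2) / 2"
    have "\<delta>\<^sup>2 > 0" "r\<^sup>2 > 0" using \<delta>(1) r by auto
    then have s: "0 < s" "s < r\<^sup>2" "s < \<delta>\<^sup>2" unfolding s_def by linarith+
    define h where "h z = (max 0 (s - q z))\<^sup>2" for z
    have hc: "continuous_on K h" unfolding h_def by (intro continuous_intros qc)
    have i1: "(\<lambda>z. w z * (u z * h z)) absolutely_integrable_on K" by (intro wint continuous_intros uK hc)
    have i2: "(\<lambda>z. w z * h z) absolutely_integrable_on K" by (intro wint hc)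
    define \<rho> where "\<rho> z = w z * (u z * h z) - u \<zeta> * (w z * h z)" for z
    have \<rho>i: "\<rho> absolutely_integrable_on K" unfolding \<rho>_def[abs_def]
      by (intro set_integral_diff set_integrable_mult_right i1 i2)
    have "A s - u \<zeta> * J s = (LINT z:K|lebesgue. \<rho> z)"
      unfolding A_def J_def h_def[symmetric] \<rho>_def
      by (simp only: set_integral_diff(2)[OF i1 set_integrable_mult_right[OF i2]] set_integral_mult_right)
    also have "\<bar>\<dots>\<bar> \<le> (LINT z:K|lebesgue. \<bar>\<rho> z\<bar>)"
      using set_integral_norm_bound[OF \<rho>i] by simp
    also have "\<dots> \<le> (LINT z:K|lebesgue. e * (w z * h z))"
    proof (rule set_integral_mono[OF set_integrable_abs[OF \<rho>i] set_integrable_mult_right[OF i2]])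
      fix z assume z: "z \<in> K"
      have \<rho>: "\<bar>\<rho> z\<bar> = \<bar>u z - u \<zeta>\<bar> * (w z * h z)"
      proof -
        have "\<rho> z = (u z - u \<zeta>) * (w z * h z)" by (simp add: \<rho>_def algebra_simps)
        moreover have "w z * h z \<ge> 0" by (simp add: w_def h_def)
        ultimately show ?thesis by (simp only: abs_mult[of "u z - u \<zeta>"] abs_of_nonneg)
      qed
      show "\<bar>\<rho> z\<bar> \<le> e * (w z * h z)"
      proof (cases "q z < s")
        case True
        then have "(norm (z - \<zeta>))\<^sup>2 < \<delta>\<^sup>2" using s(3) by (simp add: q_def)
        then have "dist z \<zeta> < \<delta>" using \<delta>(1) by (simp add: dist_norm power2_less_imp_less)
        then have "\<bar>u z - u \<zeta>\<bar> \<le> e" using \<delta>(2)[OF z] by (simp add: dist_real_def)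
        then show ?thesis unfolding \<rho> by (intro mult_right_mono) (auto simp: w_def h_def)
      next
        case False
        then have "h z = 0" by (simp add: h_def)
        then show ?thesis unfolding \<rho> by simp
      qed
    qed
    also have "\<dots> = e * J s" unfolding J_def h_def by (rule set_integral_mult_right)
    finally have "\<bar>A s - u \<zeta> * J s\<bar> \<le> e * J s" by simp
    then have "\<bar>(c - u \<zeta> * d) * s powr \<gamma>\<bar> \<le> (e * d) * s powr \<gamma>"
      unfolding c[OF s(1,2)] d[OF s(1,2)] by (simp add: algebra_simps)
    then show ?thesis using s(1) by (simp add: abs_mult)
  qed
  have "\<bar>c - u \<zeta> * d\<bar> \<le> 0 + e" if "e > 0" for e
    using that \<open>d > 0\<close> est[of "e / d"] by simp
  then have "\<bar>c - u \<zeta> * d\<bar> \<le> 0" by (rule field_le_epsilon)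
  then have "c = u \<zeta> * d" by simp
  then have "A t = u \<zeta> * J t" using c[OF t] d[OF t] by simp
  then show ?thesis using A_eq[OF t(2)] J_eq[OF t(2)] by (simp add: w_def q_def)
qed

section \<open>Competitors of a local minimizer\<close>

lemma square_integrable_on_continuous:
  fixes f :: "'a::euclidean_space \<Rightarrow> real"
  assumes "compact K" "continuous_on K f" "S \<subseteq> K" "S \<in> sets lebesgue"
  shows "square_integrable_on S f"
  unfolding square_integrable_on_def
proof
  show "f \<in> borel_measurable (lebesgue_on S)"
    by (rule continuous_imp_measurable_on_sets_lebesgue[OF continuous_on_subset[OF assms(2,3)] assms(4)])
  have "(\<lambda>z. (norm (f z))\<^sup>2) absolutely_integrable_on K"
    by (intro absolutely_integrable_continuous_compact assms continuous_intros)
  then show "(\<lambda>z. (norm (f z))\<^sup>2) absolutely_integrable_on S"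
    by (rule set_integrable_subset) (use assms in auto)
qed

lemma square_integrable_on_subset:
  assumes "square_integrable_on S f" "T \<subseteq> S" "T \<in> sets lebesgue"
  shows "square_integrable_on T f"
  unfolding square_integrable_on_def
proof
  show "f \<in> borel_measurable (lebesgue_on T)"
    using assms by (auto simp: square_integrable_on_def intro: measurable_restrict_mono)
  show "(\<lambda>z. (norm (f z))\<^sup>2) absolutely_integrable_on T"
    by (rule set_integrable_subset[OF _ assms(3,2)]) (use assms in \<open>simp add: square_integrable_on_def\<close>)
qed

lemma square_integrable_on_add:
  fixes f g :: "'a::euclidean_space \<Rightarrow> 'b::euclidean_space"
  assumes S: "S \<in> sets lebesgue" and f: "square_integrable_on S f" and g: "square_integrable_on S g"
  shows "square_integrable_on S (\<lambda>z. f z + g z)"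
  unfolding square_integrable_on_def
proof
  have m: "f \<in> borel_measurable (lebesgue_on S)" "g \<in> borel_measurable (lebesgue_on S)"
    using f g by (auto simp: square_integrable_on_def)
  then show mfg: "(\<lambda>z. f z + g z) \<in> borel_measurable (lebesgue_on S)" by measurable
  have i: "(\<lambda>z. 2 * (norm (f z))\<^sup>2 + 2 * (norm (g z))\<^sup>2) absolutely_integrable_on S"
    using f g by (intro set_integral_add set_integrable_mult_right) (auto simp: square_integrable_on_def)
  show "(\<lambda>z. (norm (f z + g z))\<^sup>2) absolutely_integrable_on S"
  proof (rule measurable_bounded_by_integrable_imp_absolutely_integrable[OF _ S])
    show "(\<lambda>z. (norm (f z + g z))\<^sup>2) \<in> borel_measurable (lebesgue_on S)" using mfg by measurable
    show "(\<lambda>z. 2 * (norm (f z))\<^sup>2 + 2 * (norm (g z))\<^sup>2) integrable_on S"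
      using i by (rule set_lebesgue_integral_eq_integral(1))
    fix z
    have "norm (f z + g z) \<le> norm (f z) + norm (g z)" by (rule norm_triangle_ineq)
    then have "(norm (f z + g z))\<^sup>2 \<le> (norm (f z) + norm (g z))\<^sup>2" by (intro power_mono) auto
    also have "\<dots> \<le> 2 * (norm (f z))\<^sup>2 + 2 * (norm (g z))\<^sup>2"
      using sum_squares_bound[of "norm (f z)" "norm (g z)"] by (simp add: power2_sum)
    finally show "norm ((norm (f z + g z))\<^sup>2) \<le> 2 * (norm (f z))\<^sup>2 + 2 * (norm (g z))\<^sup>2" by simp
  qed
qed

lemma norm_weight_half_power2: "(norm (\<bar>y\<bar> powr (\<beta> / 2) *\<^sub>R x))\<^sup>2 = \<bar>y\<bar> powr \<beta> * (norm x)\<^sup>2"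
proof -
  have "(\<bar>y\<bar> powr (\<beta> / 2))\<^sup>2 = \<bar>y\<bar> powr \<beta>"
    by (simp add: power2_eq_square powr_add[symmetric])
  then show ?thesis by (simp add: power_mult_distrib)
qed

lemma weight_measurable: "(\<lambda>z. \<bar>snd z\<bar> powr \<beta>) \<in> borel_measurable (lebesgue_on (S :: ('a::euclidean_space \<times> real) set))"
proof -
  have snd: "(snd :: 'a \<times> real \<Rightarrow> real) \<in> borel_measurable borel"
    by (intro borel_measurable_continuous_onI continuous_intros)
  have "(\<lambda>z::'a \<times> real. \<bar>snd z\<bar> powr \<beta>) \<in> borel_measurable borel"
    by (rule measurable_compose[OF snd, of "\<lambda>y. \<bar>y\<bar> powr \<beta>"]) measurable
  then have "(\<lambda>z::'a \<times> real. \<bar>snd z\<bar> powr \<beta>) \<in> borel_measurable lebesgue"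
    by (intro measurable_completion) auto
  then show ?thesis by (rule measurable_restrict_space1)
qed

lemma square_integrable_weighted_continuous:
  fixes D :: "'a::euclidean_space \<times> real \<Rightarrow> 'a \<times> real"
  assumes "-1 < \<beta>" "compact K" "continuous_on K D" "S \<subseteq> K" "S \<in> sets lebesgue"
  shows "square_integrable_on S (\<lambda>z. \<bar>snd z\<bar> powr (\<beta> / 2) *\<^sub>R D z)"
  unfolding square_integrable_on_def
proof
  have "D \<in> borel_measurable (lebesgue_on S)"
    by (rule continuous_imp_measurable_on_sets_lebesgue[OF continuous_on_subset[OF assms(3,4)] assms(5)])
  then show "(\<lambda>z. \<bar>snd z\<bar> powr (\<beta> / 2) *\<^sub>R D z) \<in> borel_measurable (lebesgue_on S)"
    by (intro borel_measurable_scaleR weight_measurable)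
  have "(\<lambda>z. \<bar>snd z\<bar> powr \<beta> * (norm (D z))\<^sup>2) absolutely_integrable_on K"
    by (intro weight_scaled_continuous_integrable continuous_intros assms)
  then show "(\<lambda>z. (norm (\<bar>snd z\<bar> powr (\<beta> / 2) *\<^sub>R D z))\<^sup>2) absolutely_integrable_on S"
    unfolding norm_weight_half_power2 by (rule set_integrable_subset) (use assms in auto)
qed

text \<open>The bound \<open>\<bar>G\<bar> \<le> 1 + \<bar>G\<bar>\<^sup>2\<close> and the integrability of the weight reduce this to the finite energy.\<close>

lemma weighted_gradient_integrable:
  fixes G :: "'a::euclidean_space \<times> real \<Rightarrow> 'a \<times> real"
  assumes \<beta>: "-1 < \<beta>" and S: "bounded S" "S \<in> sets lebesgue"
    and G: "square_integrable_on S (\<lambda>z. \<bar>snd z\<bar> powr (\<beta> / 2) *\<^sub>R G z)"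
  shows "(\<lambda>z. \<bar>snd z\<bar> powr \<beta> *\<^sub>R G z) absolutely_integrable_on S"
proof (rule measurable_bounded_by_integrable_imp_absolutely_integrable[OF _ S(2)])
  have split: "\<bar>snd z\<bar> powr \<beta> *\<^sub>R G z = \<bar>snd z\<bar> powr (\<beta> / 2) *\<^sub>R (\<bar>snd z\<bar> powr (\<beta> / 2) *\<^sub>R G z)" for z
    by (simp add: powr_add[symmetric])
  have m: "(\<lambda>z. \<bar>snd z\<bar> powr (\<beta> / 2) *\<^sub>R G z) \<in> borel_measurable (lebesgue_on S)"
    and i: "(\<lambda>z. \<bar>snd z\<bar> powr \<beta> * (norm (G z))\<^sup>2) absolutely_integrable_on S"
    using G unfolding square_integrable_on_def norm_weight_half_power2 by auto
  show "(\<lambda>z. \<bar>snd z\<bar> powr \<beta> *\<^sub>R G z) \<in> borel_measurable (lebesgue_on S)"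
    unfolding split by (intro borel_measurable_scaleR weight_measurable m)
  show "(\<lambda>z. \<bar>snd z\<bar> powr \<beta> + \<bar>snd z\<bar> powr \<beta> * (norm (G z))\<^sup>2) integrable_on S"
    by (intro set_lebesgue_integral_eq_integral(1) set_integral_add(1) i weight_absolutely_integrable \<beta> S)
  fix z
  have "norm (G z) \<le> 1 + (norm (G z))\<^sup>2"
    using sum_squares_bound[of 1 "norm (G z)"] norm_ge_zero[of "G z"] unfolding power_one by linarith
  then have "\<bar>snd z\<bar> powr \<beta> * norm (G z) \<le> \<bar>snd z\<bar> powr \<beta> * (1 + (norm (G z))\<^sup>2)"
    by (rule mult_left_mono) simp
  then show "norm (\<bar>snd z\<bar> powr \<beta> *\<^sub>R G z) \<le> \<bar>snd z\<bar> powr \<beta> + \<bar>snd z\<bar> powr \<beta> * (norm (G z))\<^sup>2"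
    by (simp add: algebra_simps)
qed

lemma energy_expansion:
  fixes G D :: "'a::euclidean_space \<times> real \<Rightarrow> 'a \<times> real"
  assumes \<beta>: "-1 < \<beta>" and B: "open B" "bounded B" 
    and G: "square_integrable_on B (\<lambda>z. \<bar>snd z\<bar> powr (\<beta> / 2) *\<^sub>R G z)"
    and \<phi>: "test_function B \<phi> D"
  shows "(LINT z:B|lebesgue. \<bar>snd z\<bar> powr \<beta> * (norm (G z + t *\<^sub>R D z))\<^sup>2) =
    (LINT z:B|lebesgue. \<bar>snd z\<bar> powr \<beta> * (norm (G z))\<^sup>2)
    + 2 * t * (LINT z:B|lebesgue. (\<bar>snd z\<bar> powr \<beta> *\<^sub>R G z) \<bullet> D z)
    + t\<^sup>2 * (LINT z:B|lebesgue. \<bar>snd z\<bar> powr \<beta> * (norm (D z))\<^sup>2)"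
proof -
  have Bl: "B \<in> sets lebesgue" using B(1) by (rule open_sets_lebesgue)
  have i1: "(\<lambda>z. \<bar>snd z\<bar> powr \<beta> * (norm (G z))\<^sup>2) absolutely_integrable_on B"
    using G unfolding square_integrable_on_def norm_weight_half_power2 by auto
  have "(\<lambda>z. \<bar>snd z\<bar> powr \<beta> *\<^sub>R G z) absolutely_integrable_on B"
    by (rule weighted_gradient_integrable[OF \<beta> B(2) Bl G])
  then have "locally_integrable_on B (\<lambda>z. \<bar>snd z\<bar> powr \<beta> *\<^sub>R G z)"
    unfolding locally_integrable_on_def using set_integrable_subset compact_sets_lebesgue by blast
  then have i2: "(\<lambda>z. (\<bar>snd z\<bar> powr \<beta> *\<^sub>R G z) \<bullet> D z) absolutely_integrable_on B"
    by (rule integrable_inner_test_gradient[OF _ \<phi>])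
  have "continuous_on (closure B) D" using \<phi> continuous_on_subset unfolding test_function_def by blast
  then have "square_integrable_on B (\<lambda>z. \<bar>snd z\<bar> powr (\<beta> / 2) *\<^sub>R D z)"
    using B(2) by (intro square_integrable_weighted_continuous[OF \<beta> _ _ closure_subset Bl]) auto
  then have i3: "(\<lambda>z. \<bar>snd z\<bar> powr \<beta> * (norm (D z))\<^sup>2) absolutely_integrable_on B"
    unfolding square_integrable_on_def norm_weight_half_power2 by auto
  have "\<bar>snd z\<bar> powr \<beta> * (norm (G z + t *\<^sub>R D z))\<^sup>2 = \<bar>snd z\<bar> powr \<beta> * (norm (G z))\<^sup>2
     + 2 * t * ((\<bar>snd z\<bar> powr \<beta> *\<^sub>R G z) \<bullet> D z) + t\<^sup>2 * (\<bar>snd z\<bar> powr \<beta> * (norm (D z))\<^sup>2)" for z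
  proof -
    have "(norm (G z + t *\<^sub>R D z))\<^sup>2 = (norm (G z))\<^sup>2 + 2 * t * (G z \<bullet> D z) + t\<^sup>2 * (norm (D z))\<^sup>2"
      unfolding power2_norm_eq_inner
      by (simp only: inner_add_left inner_add_right inner_scaleR_left inner_scaleR_right inner_commute[of "D z" "G z"])
         (simp add: algebra_simps power2_eq_square)
    then show ?thesis by (simp only: inner_scaleR_left) (simp add: algebra_simps)
  qed
  then show ?thesis
    by (simp only: set_integral_add(2)[OF set_integral_add(1)[OF i1 set_integrable_mult_right[OF i2]] set_integrable_mult_right[OF i3]]
        set_integral_add(2)[OF i1 set_integrable_mult_right[OF i2]] set_integral_mult_right)
qed

lemma positivity_trace_continuous:
  assumes "open B" "bounded B" "continuous_on (closure B) v"
  shows "positivity_trace B v = {x. (x, 0) \<in> B \<and> v (x, 0) > 0}"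
proof -
  have "(\<exists>t>0. has_trace_at B v (x, 0) t) \<longleftrightarrow> v (x, 0) > 0" if "(x, 0) \<in> B" for x
    using has_trace_at_iff[OF assms subsetD[OF closure_subset that]] by simp
  then show ?thesis unfolding positivity_trace_def by auto
qed

text \<open>
  Minimality tested with \<open>u + \<phi>\<close>.  As the closed ball lies in the domain, \<open>u\<close> is continuous up to the
  sphere, so all traces are point values; and \<open>\<phi>\<close> vanishes near the sphere, so the boundary values
  agree at every point of it.
\<close>

lemma minimizer_competitor:
  fixes u :: "(real ^ 'n) \<times> real \<Rightarrow> real"
  assumes lm: "local_minimizer \<beta> \<omega> \<epsilon> u" and u: "continuous_on (ball 0 1) u" and \<beta>: "-1 < \<beta>"
    and B: "cball c \<rho> \<subseteq> ball 0 1" "0 < \<rho>"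
  obtains G where "has_weak_gradient (ball c \<rho>) u G"
    "square_integrable_on (ball c \<rho>) (\<lambda>z. \<bar>snd z\<bar> powr (\<beta> / 2) *\<^sub>R G z)"
    "\<And>\<phi> D. test_function (ball c \<rho>) \<phi> D \<Longrightarrow>
      (LINT z:ball c \<rho>|lebesgue. \<bar>snd z\<bar> powr \<beta> * (norm (G z))\<^sup>2) 
        + f_eps \<omega> \<epsilon> (measure lebesgue {x. (x, 0) \<in> ball c \<rho> \<and> u (x, 0) > 0})
      \<le> (LINT z:ball c \<rho>|lebesgue. \<bar>snd z\<bar> powr \<beta> * (norm (G z + D z))\<^sup>2) 
        + f_eps \<omega> \<epsilon> (measure lebesgue {x. (x, 0) \<in> ball c \<rho> \<and> u (x, 0) + \<phi> (x, 0) > 0})"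
proof -
  define B where "B = ball c \<rho>"
  have B_props: "open B" "bounded B" "B \<subseteq> ball 0 1" "B \<in> sets lebesgue" "closure B = cball c \<rho>"
    using B ball_subset_cball[of c \<rho>] by (auto simp: B_def open_sets_lebesgue)
  define G where "G = weak_gradient (ball 0 1) u"
  have uH: "u \<in> H1 \<beta> (ball 0 1)" using lm by (simp add: local_minimizer_def)
  then have "\<exists>G. has_weak_gradient (ball 0 1) u G" unfolding H1_def by simp
  then have "has_weak_gradient (ball 0 1) u G" unfolding G_def weak_gradient_def by (rule someI_ex)
  then have G: "has_weak_gradient B u G" by (rule has_weak_gradient_subset[OF _ B_props(3)])
  have G2: "square_integrable_on B (\<lambda>z. \<bar>snd z\<bar> powr (\<beta> / 2) *\<^sub>R G z)"
    using uH by (intro square_integrable_on_subset[OF _ B_props(3,4)]) (simp add: H1_def G_def)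
  have uc: "continuous_on (closure B) u" 
    unfolding B_props(5) by (rule continuous_on_subset[OF u B(1)])
  have min: "(LINT z:B|lebesgue. \<bar>snd z\<bar> powr \<beta> * (norm (G z))\<^sup>2) 
        + f_eps \<omega> \<epsilon> (measure lebesgue {x. (x, 0) \<in> B \<and> u (x, 0) > 0})
      \<le> (LINT z:B|lebesgue. \<bar>snd z\<bar> powr \<beta> * (norm (G z + D z))\<^sup>2) 
        + f_eps \<omega> \<epsilon> (measure lebesgue {x. (x, 0) \<in> B \<and> u (x, 0) + \<phi> (x, 0) > 0})"
    if \<phi>: "test_function B \<phi> D" for \<phi> D
  proof -
    define v where "v z = u z + \<phi> z" for z
    have Dc: "continuous_on (closure B) D" and \<phi>D: "\<And>z. GDERIV \<phi> z :> D z" "continuous_on UNIV D"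
      using \<phi> unfolding test_function_def by (auto intro: continuous_on_subset)
    have vc: "continuous_on (closure B) v"
      unfolding v_def by (intro continuous_intros uc test_function_continuous[OF \<phi>])
    have v: "has_weak_gradient B v (\<lambda>z. G z + D z)"
      unfolding v_def by (intro has_weak_gradient_add G has_weak_gradient_C1 \<phi>D)
    have "v \<in> H1 \<beta> B"
      unfolding H1_iff[OF B_props(1) v]
    proof
      have "open (upper_half_space :: 'n pt set)" 
        unfolding upper_half_space_def by (intro open_Collect_less continuous_intros)
      then have "B \<inter> upper_half_space \<in> sets lebesgue" using B_props(1) by (intro open_sets_lebesgue open_Int)
      then show "square_integrable_on (B \<inter> upper_half_space) v"
        using closure_subset B_props(2) 
        by (intro square_integrable_on_continuous[OF _ vc]) auto
      have "square_integrable_on B (\<lambda>z. \<bar>snd z\<bar> powr (\<beta> / 2) *\<^sub>R G z + \<bar>snd z\<bar> powr (\<beta> / 2) *\<^sub>R D z)"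
        using B_props(2)
        by (intro square_integrable_on_add[OF B_props(4) G2] 
              square_integrable_weighted_continuous[OF \<beta> _ Dc closure_subset B_props(4)]) auto
      then show "square_integrable_on B (\<lambda>z. \<bar>snd z\<bar> powr (\<beta> / 2) *\<^sub>R (G z + D z))"
        by (simp add: scaleR_add_right)
    qed
    moreover have "eq_on_sphere c \<rho> v u"
    proof -
      have "has_trace_at B v z (u z) \<and> has_trace_at B u z (u z)" if z: "z \<in> sphere c \<rho>" for z
      proof -
        obtain K where K: "K \<subseteq> B" "\<And>z. z \<notin> K \<Longrightarrow> \<phi> z = 0"
          using \<phi> unfolding test_function_def by blast
        have "z \<notin> K" using K(1) z by (auto simp: B_def)
        then have "v z = u z" using K(2) by (simp add: v_def)
        moreover have "z \<in> closure B" using z by (simp add: B_props(5))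
        ultimately show ?thesis
          using has_trace_at_iff[OF B_props(1,2) vc] has_trace_at_iff[OF B_props(1,2) uc] by simp
      qed
      then have "{z \<in> sphere c \<rho>. \<not> (\<exists>t. has_trace_at B v z t \<and> has_trace_at B u z t)} = {}" by blast
      then show ?thesis unfolding eq_on_sphere_def B_def[symmetric] by (simp only:) (simp add: surface_null_def)
    qed
    ultimately have "I_eps \<beta> \<omega> \<epsilon> u B \<le> I_eps \<beta> \<omega> \<epsilon> v B"
      using lm B(2) B_props(3) unfolding local_minimizer_def B_def by blast
    then show ?thesis
      unfolding I_eps_def weighted_energy_eq[OF B_props(1) G] weighted_energy_eq[OF B_props(1) v]
        positivity_trace_continuous[OF B_props(1,2) uc] positivity_trace_continuous[OF B_props(1,2) vc]
      by (simp add: v_def)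
  qed
  show ?thesis by (rule that[OF G[unfolded B_def] G2[unfolded B_def] min[unfolded B_def]])
qed

text \<open>Both slopes of the penalty are at least \<open>min \<epsilon> (1 / \<epsilon>)\<close>; a decrease of volume is rewarded at this
  rate, whatever the volume is compared with \<open>\<omega>\<close>.\<close>

lemma f_eps_increment:
  assumes "\<epsilon> > 0" "s' \<le> s"
  shows "min \<epsilon> (1 / \<epsilon>) * (s - s') \<le> f_eps \<omega> \<epsilon> s - f_eps \<omega> \<epsilon> s'"
proof -
  define k where "k = min \<epsilon> (1 / \<epsilon>)"
  have k: "k \<le> \<epsilon>" "k \<le> 1 / \<epsilon>" by (auto simp: k_def)
  have *: "k * a \<le> \<epsilon> * a" "k * a \<le> 1 / \<epsilon> * a" if "a \<ge> 0" for a
    using k that by (intro mult_right_mono; simp)+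
  consider "s' \<ge> \<omega>" | "s' < \<omega>" "s \<ge> \<omega>" | "s < \<omega>" by linarith
  then have "k * (s - s') \<le> f_eps \<omega> \<epsilon> s - f_eps \<omega> \<epsilon> s'"
  proof cases
    case 1
    then show ?thesis using *(2)[of "s - s'"] assms by (simp add: f_eps_def diff_divide_distrib algebra_simps)
  next
    case 2
    have "k * (s - s') = k * (s - \<omega>) + k * (\<omega> - s')" by (simp add: algebra_simps)
    also have "\<dots> \<le> 1 / \<epsilon> * (s - \<omega>) + \<epsilon> * (\<omega> - s')" using 2 by (intro add_mono *) auto
    also have "\<dots> = f_eps \<omega> \<epsilon> s - f_eps \<omega> \<epsilon> s'" using 2 by (simp add: f_eps_def algebra_simps)
    finally show ?thesis .
  next
    case 3
    then show ?thesis using *(1)[of "s - s'"] assms by (simp add: f_eps_def algebra_simps)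
  qed
  then show ?thesis by (simp add: k_def)
qed

lemma quadratic_nonneg_imp_linear_zero:
  fixes X Y :: real
  assumes "\<And>t. 0 \<le> 2 * t * X + t\<^sup>2 * Y"
  shows "X = 0"
proof (rule ccontr)
  assume "X \<noteq> 0"
  \<comment> \<open>With \<open>t = - X / k\<close> the quadratic expression equals \<open>X\<^sup>2 / k\<^sup>2 * (Y - 2 * k)\<close>, which is negative once \<open>2 * k > Y\<close>.\<close>
  define k where "k = 1 + \<bar>Y\<bar>"
  have k: "k > 0" "Y - 2 * k < 0" by (auto simp: k_def)
  define t where "t = - X / k"
  have "2 * t * X + t\<^sup>2 * Y = X\<^sup>2 / k\<^sup>2 * (Y - 2 * k)"
    using k(1) by (simp add: t_def power2_eq_square field_simps)
  moreover have "X\<^sup>2 / k\<^sup>2 > 0" using \<open>X \<noteq> 0\<close> k(1) by simp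
  ultimately have "2 * t * X + t\<^sup>2 * Y < 0" using k(2) by (simp only: mult_pos_neg)
  with assms[of t] show False by simp
qed

lemma positivity_slice_lmeasurable:
  fixes v :: "(real ^ 'n) \<times> real \<Rightarrow> real"
  assumes "open B" "bounded B" "continuous_on B v"
  shows "{x. (x, 0) \<in> B \<and> v (x, 0) > 0} \<in> lmeasurable"
proof (rule lmeasurable_open)
  define S where "S = {x :: real ^ 'n. (x, 0::real) \<in> B}"
  have emb: "continuous_on UNIV (\<lambda>x :: real ^ 'n. (x, 0::real))" by (intro continuous_intros)
  have "S = (\<lambda>x. (x, 0)) -` B" by (auto simp: S_def)
  then have S: "open S" using open_vimage[OF assms(1) emb] by simp
  have "continuous_on S (\<lambda>x. v (x, 0))"
    by (rule continuous_on_compose2[OF assms(3) continuous_on_subset[OF emb]]) (auto simp: S_def)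
  then have "open (S \<inter> (\<lambda>x. v (x, 0)) -` {0<..})" by (rule continuous_open_preimage[OF _ S]) simp
  moreover have "S \<inter> (\<lambda>x. v (x, 0)) -` {0<..} = {x. (x, 0) \<in> B \<and> v (x, 0) > 0}" by (auto simp: S_def)
  ultimately show "open {x. (x, 0) \<in> B \<and> v (x, 0) > 0}" by simp
  have "bounded (fst ` B)" using assms(2) by (rule bounded_fst)
  then show "bounded {x. (x, 0) \<in> B \<and> v (x, 0) > 0}" by (rule bounded_subset) force
qed

section \<open>Nondegeneracy\<close>

text \<open>
  The disc already consists of points of positivity, so no variation \<open>u + t \<phi>\<close> pays for additional volume.
  The energy alone is therefore minimal at \<open>t = 0\<close>, for \<open>t\<close> of both signs.
\<close>

lemma minimizer_weighted_harmonic: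
  fixes u :: "(real ^ 'n) \<times> real \<Rightarrow> real"
  assumes \<beta>: "-1 < \<beta>" and "\<epsilon> > 0" and u: "continuous_on (ball c \<rho>) u"
    and G: "has_weak_gradient (ball c \<rho>) u G"
    and G2: "square_integrable_on (ball c \<rho>) (\<lambda>z. \<bar>snd z\<bar> powr (\<beta> / 2) *\<^sub>R G z)"
    and min: "\<And>\<phi> D. test_function (ball c \<rho>) \<phi> D \<Longrightarrow>
      (LINT z:ball c \<rho>|lebesgue. \<bar>snd z\<bar> powr \<beta> * (norm (G z))\<^sup>2) 
        + f_eps \<omega> \<epsilon> (measure lebesgue {x. (x, 0) \<in> ball c \<rho> \<and> u (x, 0) > 0})
      \<le> (LINT z:ball c \<rho>|lebesgue. \<bar>snd z\<bar> powr \<beta> * (norm (G z + D z))\<^sup>2) 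
        + f_eps \<omega> \<epsilon> (measure lebesgue {x. (x, 0) \<in> ball c \<rho> \<and> u (x, 0) + \<phi> (x, 0) > 0})"
    and pos: "\<And>x. (x, 0) \<in> ball c \<rho> \<Longrightarrow> u (x, 0) > 0"
  shows "weighted_harmonic \<beta> (ball c \<rho>) u"
    and "test_function (ball c \<rho>) \<phi> D \<Longrightarrow> (LINT z:ball c \<rho>|lebesgue. (\<bar>snd z\<bar> powr \<beta> *\<^sub>R G z) \<bullet> D z) = 0"
proof -
  define B where "B = ball c \<rho>"
  have B: "open B" "bounded B" "B \<in> sets lebesgue" by (auto simp: B_def open_sets_lebesgue)
  have EL: "(LINT z:B|lebesgue. (\<bar>snd z\<bar> powr \<beta> *\<^sub>R G z) \<bullet> D z) = 0" if \<phi>: "test_function B \<phi> D" for \<phi> D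
  proof (rule quadratic_nonneg_imp_linear_zero)
    fix t
    define P where "P v = {x. (x, 0) \<in> B \<and> v (x, 0) > 0}" for v :: "(real ^ 'n) \<times> real \<Rightarrow> real"
    have P_meas: "P v \<in> lmeasurable" if "continuous_on B v" for v
      unfolding P_def by (rule positivity_slice_lmeasurable[OF B(1,2) that])
    have "continuous_on B (\<lambda>z. u z + t * \<phi> z)"
      using u unfolding B_def by (intro continuous_intros test_function_continuous[OF \<phi>])
    then have "P (\<lambda>z. u z + t * \<phi> z) \<in> lmeasurable" by (rule P_meas)
    moreover have "P u \<in> lmeasurable" using u by (intro P_meas) (simp add: B_def)
    moreover have "P (\<lambda>z. u z + t * \<phi> z) \<subseteq> P u" using pos by (auto simp: P_def B_def)
    ultimately have "measure lebesgue (P (\<lambda>z. u z + t * \<phi> z)) \<le> measure lebesgue (P u)"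
      by (intro measure_mono_fmeasurable) auto
    then have "f_eps \<omega> \<epsilon> (measure lebesgue (P (\<lambda>z. u z + t * \<phi> z))) \<le> f_eps \<omega> \<epsilon> (measure lebesgue (P u))"
    proof -
      assume le: "measure lebesgue (P (\<lambda>z. u z + t * \<phi> z)) \<le> measure lebesgue (P u)"
      have "0 \<le> min \<epsilon> (1 / \<epsilon>) * (measure lebesgue (P u) - measure lebesgue (P (\<lambda>z. u z + t * \<phi> z)))"
        using le \<open>\<epsilon> > 0\<close> by (intro mult_nonneg_nonneg) auto
      then show ?thesis using f_eps_increment[OF \<open>\<epsilon> > 0\<close> le, of \<omega>] by linarith
    qed
    moreover have "(LINT z:B|lebesgue. \<bar>snd z\<bar> powr \<beta> * (norm (G z))\<^sup>2) + f_eps \<omega> \<epsilon> (measure lebesgue (P u))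
      \<le> (LINT z:B|lebesgue. \<bar>snd z\<bar> powr \<beta> * (norm (G z + t *\<^sub>R D z))\<^sup>2) 
        + f_eps \<omega> \<epsilon> (measure lebesgue (P (\<lambda>z. u z + t * \<phi> z)))"
      unfolding P_def B_def by (rule min[OF test_function_cmult[OF \<phi>[unfolded B_def]]])
    ultimately show "0 \<le> 2 * t * (LINT z:B|lebesgue. (\<bar>snd z\<bar> powr \<beta> *\<^sub>R G z) \<bullet> D z)
        + t\<^sup>2 * (LINT z:B|lebesgue. \<bar>snd z\<bar> powr \<beta> * (norm (D z))\<^sup>2)"
      unfolding energy_expansion[OF \<beta> B(1,2) G2[folded B_def] \<phi>] by linarith
  qed
  have "(\<lambda>z. \<bar>snd z\<bar> powr \<beta> *\<^sub>R G z) absolutely_integrable_on B"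
    by (rule weighted_gradient_integrable[OF \<beta> B(2,3) G2[folded B_def]])
  then have "locally_integrable_on B (\<lambda>z. \<bar>snd z\<bar> powr \<beta> *\<^sub>R G z)"
    unfolding locally_integrable_on_def using set_integrable_subset compact_sets_lebesgue by blast
  then show "weighted_harmonic \<beta> (ball c \<rho>) u"
    unfolding weighted_harmonic_def using u G EL by (auto simp: B_def)
  show "test_function (ball c \<rho>) \<phi> D \<Longrightarrow> (LINT z:ball c \<rho>|lebesgue. (\<bar>snd z\<bar> powr \<beta> *\<^sub>R G z) \<bullet> D z) = 0"
    using EL by (simp only: B_def)
qed

text \<open>
  With \<open>\<tau> = (\<rho>/4)\<^sup>2\<close>, the kernel \<open>p(\<tau> - \<bar>z - (x,0)\<bar>\<^sup>2)\<close> lives in a ball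
  of radius \<open>\<rho>/4\<close>, which is contained in the ball of radius \<open>\<rho>/2\<close> about \<open>(x\<^sub>0,0)\<close>; there
  \<open>p(8 \<tau> - \<bar>z - (x\<^sub>0,0)\<bar>\<^sup>2)\<close> is at least \<open>(8 \<tau> - 4 \<tau>)\<^sup>2 = 16 \<tau>\<^sup>2\<close>.  Since \<open>u \<ge> 0\<close>, the mean values compare as the kernels do.
\<close>

lemma weighted_harmonic_sup_bound:
  fixes u :: "'a::euclidean_space \<times> real \<Rightarrow> real"
  assumes \<beta>: "-1 < \<beta>" and u: "weighted_harmonic \<beta> (ball (x0, 0) \<rho>) u" 
    and nonneg: "\<And>z. z \<in> ball (x0, 0) \<rho> \<Longrightarrow> u z \<ge> 0"
    and \<rho>: "\<rho> > 0" and x: "dist x x0 \<le> \<rho> / 4"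
  shows "u (x, 0) \<le> 8 powr ((\<beta> + DIM('a \<times> real) + 4) / 2) / 16 * u (x0, 0)"
proof -
  define B where "B = ball (x0, 0::real) \<rho>"
  define \<gamma> where "\<gamma> = (\<beta> + DIM('a \<times> real) + 4) / 2"
  define \<tau> where "\<tau> = \<rho>\<^sup>2 / 16"
  define k where "k y s z = \<bar>snd z\<bar> powr \<beta> * (max 0 (s - (norm (z - (y, 0)))\<^sup>2))\<^sup>2" for y :: 'a and s and z :: "'a \<times> real"
  have \<tau>: "\<tau> > 0" "8 * \<tau> > 0" using \<rho> by (auto simp: \<tau>_def)
  obtain c where c: "c > 0" 
    "\<And>\<zeta>::'a \<times> real. \<And>t. snd \<zeta> = 0 \<Longrightarrow> t > 0 \<Longrightarrow> 
      (LINT z|lebesgue. \<bar>snd z\<bar> powr \<beta> * (max 0 (t - (norm (z - \<zeta>))\<^sup>2))\<^sup>2) = c * t powr \<gamma>"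
    using weight_cutoff_power_law[OF \<beta>] unfolding \<gamma>_def by blast
  have mv: "(LINT z:B|lebesgue. u z * k y s z) = u (y, 0) * (c * s powr \<gamma>)"
    if "0 < s" "s < r\<^sup>2" "0 < r" "cball (y, 0) r \<subseteq> B" for y s r
    using weighted_mean_value[OF \<beta> u _ that(4)[unfolded B_def] that(3,1,2)] c(2)[of "(y, 0)" s] that(1)
    by (simp add: k_def B_def mult_ac)
  have "cball (x, 0) (\<rho> / 2) \<subseteq> B"
  proof
    fix z assume z: "z \<in> cball (x, 0::real) (\<rho> / 2)"
    have "dist (x0, 0) z \<le> dist (x0, 0) (x, 0::real) + dist (x, 0) z" by (rule dist_triangle)
    then show "z \<in> B" using z x \<rho> by (simp add: B_def dist_Pair_Pair dist_commute)
  qed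
  then have 1: "(LINT z:B|lebesgue. u z * k x \<tau> z) = u (x, 0) * (c * \<tau> powr \<gamma>)"
    using \<rho> by (intro mv[of \<tau> "\<rho> / 2"]) (auto simp: \<tau>_def power2_eq_square)
  \<comment> \<open>The radius \<open>9/10 * \<rho>\<close> leaves the closed ball inside \<open>B\<close> and exceeds \<open>sqrt (8 * \<tau>) = \<rho> / sqrt 2\<close>.\<close>
  have 2: "(LINT z:B|lebesgue. u z * k x0 (8 * \<tau>) z) = u (x0, 0) * (c * (8 * \<tau>) powr \<gamma>)"
    using \<rho> by (intro mv[of "8 * \<tau>" "9 / 10 * \<rho>"]) (auto simp: \<tau>_def B_def power2_eq_square subset_iff)
  have int: "(\<lambda>z. u z * k y s z) absolutely_integrable_on B" if "cball (y, 0) (sqrt s) \<subseteq> B" for y s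
  proof -
    define K where "K = cball (y, 0::real) (sqrt s)"
    have "continuous_on K u" using u that continuous_on_subset unfolding weighted_harmonic_def K_def B_def by blast
    then have "(\<lambda>z. \<bar>snd z\<bar> powr \<beta> * (u z * (max 0 (s - (norm (z - (y, 0)))\<^sup>2))\<^sup>2)) absolutely_integrable_on K"
      by (intro weight_scaled_continuous_integrable \<beta> continuous_intros) (auto simp: K_def)
    then have "(\<lambda>z. u z * k y s z) absolutely_integrable_on K" by (simp add: k_def mult_ac)
    moreover have "k y s z = 0" if "z \<notin> K" for z
      using that sqrt_le_D[of s "norm (z - (y, 0))"] by (auto simp: k_def K_def dist_norm norm_minus_commute)
    then have "(\<lambda>z. u z * k y s z) absolutely_integrable_on B \<longleftrightarrow> (\<lambda>z. u z * k y s z) absolutely_integrable_on K"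
      using that by (intro set_integrable_cong_support) (auto simp: K_def)
    ultimately show ?thesis by simp
  qed
  have sqrt\<tau>: "sqrt \<tau> = \<rho> / 4" using \<rho> by (simp add: \<tau>_def real_sqrt_divide)
  have le: "k x \<tau> z \<le> 1 / 16 * k x0 (8 * \<tau>) z" for z
  proof (cases "norm (z - (x, 0)) < \<rho> / 4")
    case True
    have "norm (z - (x0, 0)) \<le> norm (z - (x, 0)) + norm ((x, 0) - (x0, 0::real))"
      using dist_triangle[of z "(x0, 0)" "(x, 0)"] by (simp only: dist_norm)
    also have "norm ((x, 0) - (x0, 0::real)) = dist x x0" by (simp add: dist_norm norm_Pair)
    finally have "norm (z - (x0, 0)) \<le> \<rho> / 2" using True x by simp
    then have "(norm (z - (x0, 0)))\<^sup>2 \<le> (\<rho> / 2)\<^sup>2" by (intro power_mono) auto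
    then have "4 * \<tau> \<le> 8 * \<tau> - (norm (z - (x0, 0)))\<^sup>2" by (simp add: \<tau>_def power2_eq_square)
    then have "4 * \<tau> \<le> max 0 (8 * \<tau> - (norm (z - (x0, 0)))\<^sup>2)" by simp
    then have "(4 * \<tau>)\<^sup>2 \<le> (max 0 (8 * \<tau> - (norm (z - (x0, 0)))\<^sup>2))\<^sup>2" using \<tau> by (intro power_mono) auto
    moreover have "(max 0 (\<tau> - (norm (z - (x, 0)))\<^sup>2))\<^sup>2 \<le> \<tau>\<^sup>2" using \<tau> by (intro power_mono) auto
    ultimately have "(max 0 (\<tau> - (norm (z - (x, 0)))\<^sup>2))\<^sup>2 \<le> 1 / 16 * (max 0 (8 * \<tau> - (norm (z - (x0, 0)))\<^sup>2))\<^sup>2"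
      by (simp add: power_mult_distrib)
    then have "\<bar>snd z\<bar> powr \<beta> * (max 0 (\<tau> - (norm (z - (x, 0)))\<^sup>2))\<^sup>2 
        \<le> \<bar>snd z\<bar> powr \<beta> * (1 / 16 * (max 0 (8 * \<tau> - (norm (z - (x0, 0)))\<^sup>2))\<^sup>2)"
      by (rule mult_left_mono) simp
    then show ?thesis unfolding k_def by (simp only: mult.left_commute)
  next
    case False
    then have "(\<rho> / 4)\<^sup>2 \<le> (norm (z - (x, 0)))\<^sup>2" using \<rho> by (intro power_mono) auto
    then have "k x \<tau> z = 0" by (simp add: k_def \<tau>_def power2_eq_square)
    moreover have "k x0 (8 * \<tau>) z \<ge> 0" by (simp add: k_def)
    ultimately show ?thesis by simp
  qed
  have "cball (x, 0::real) (sqrt \<tau>) \<subseteq> B" 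
    using \<open>cball (x, 0) (\<rho> / 2) \<subseteq> B\<close> \<rho> subset_cball[of "\<rho> / 4" "\<rho> / 2" "(x, 0::real)"]
    unfolding sqrt\<tau> by auto
  then have i1: "(\<lambda>z. u z * k x \<tau> z) absolutely_integrable_on B" by (rule int)
  have "sqrt (8 * \<tau>) < \<rho>" using \<rho> by (intro real_less_lsqrt) (auto simp: \<tau>_def power2_eq_square)
  then have "cball (x0, 0::real) (sqrt (8 * \<tau>)) \<subseteq> B" by (auto simp: B_def)
  then have i2: "(\<lambda>z. u z * k x0 (8 * \<tau>) z) absolutely_integrable_on B" by (rule int)
  have "(LINT z:B|lebesgue. u z * k x \<tau> z) \<le> (LINT z:B|lebesgue. 1 / 16 * (u z * k x0 (8 * \<tau>) z))"
  proof (rule set_integral_mono[OF i1 set_integrable_mult_right[OF i2]])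
    fix z assume "z \<in> B"
    then have "u z * k x \<tau> z \<le> u z * (1 / 16 * k x0 (8 * \<tau>) z)" 
      using nonneg le by (intro mult_left_mono) (auto simp: B_def)
    then show "u z * k x \<tau> z \<le> 1 / 16 * (u z * k x0 (8 * \<tau>) z)" by (simp only: mult.left_commute)
  qed
  also have "\<dots> = 1 / 16 * (LINT z:B|lebesgue. u z * k x0 (8 * \<tau>) z)" by (rule set_integral_mult_right)
  finally have "u (x, 0) * (c * \<tau> powr \<gamma>) \<le> (8 powr \<gamma> / 16 * u (x0, 0)) * (c * \<tau> powr \<gamma>)"
    unfolding 1 2 using \<tau> by (simp add: powr_mult mult_ac)
  moreover have "c * \<tau> powr \<gamma> > 0" using c(1) \<tau> by simp
  ultimately show ?thesis unfolding \<gamma>_def by (simp only: mult_le_cancel_right_pos)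
qed

text \<open>
  The competitor is \<open>u - C\<^sub>1 M \<eta>\<close> with \<open>\<eta> = 4 (max 0 (\<tau> - q))\<^sup>2 / \<tau>\<^sup>2\<close> and \<open>\<tau> = (\<rho>/4)\<^sup>2\<close>.  It may become
  negative, so that any bump exceeding \<open>u\<close> on the small disc serves the purpose.
  The energy of \<open>\<eta>\<close> is controlled by the same integral \<open>\<integral> \<bar>y\<bar>\<^sup>\<beta> p(\<tau> - q) = c \<tau>\<^sup>\<gamma>\<close> as the mean values, because
  \<open>\<bar>\<nabla>\<eta>\<bar>\<^sup>2 \<le> 256 p(\<tau> - q) / \<tau>\<^sup>3\<close>.
\<close>

lemma minimizer_scale_estimate:
  fixes u :: "(real ^ 'n) \<times> real \<Rightarrow> real"
  assumes \<alpha>: "0 < \<alpha>" "\<alpha> < 1" and \<epsilon>: "\<epsilon> > 0"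
    and lm: "local_minimizer (1 - 2 * \<alpha>) \<omega> \<epsilon> u" and u: "continuous_on (ball 0 1) u"
    and nonneg: "\<And>z. z \<in> ball 0 1 \<Longrightarrow> u z \<ge> 0"
  obtains C where "C > 0" 
    "\<And>x \<rho>. \<rho> > 0 \<Longrightarrow> cball (x, 0::real) \<rho> \<subseteq> ball 0 1 \<Longrightarrow> (\<And>y. y \<in> ball x \<rho> \<Longrightarrow> u (y, 0) > 0)
      \<Longrightarrow> C * \<rho> powr \<alpha> \<le> u (x, 0)"
proof -
  define \<beta> where "\<beta> = 1 - 2 * \<alpha>"
  have \<beta>: "-1 < \<beta>" using \<alpha> by (simp add: \<beta>_def)
  define n where "n = CARD('n)"
  define \<gamma> where "\<gamma> = (\<beta> + DIM((real ^ 'n) \<times> real) + 4) / 2"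
  have \<gamma>: "\<gamma> - 3 = n / 2 - \<alpha>" by (simp add: \<gamma>_def \<beta>_def n_def field_simps)
  obtain c where c: "c > 0" 
    "\<And>\<zeta>::(real ^ 'n) \<times> real. \<And>t. snd \<zeta> = 0 \<Longrightarrow> t > 0 \<Longrightarrow> 
      (LINT z|lebesgue. \<bar>snd z\<bar> powr \<beta> * (max 0 (t - (norm (z - \<zeta>))\<^sup>2))\<^sup>2) = c * t powr \<gamma>"
    using weight_cutoff_power_law[OF \<beta>] unfolding \<gamma>_def by blast
  define C1 where "C1 = 8 powr \<gamma> / 16"
  have C1: "C1 > 0" by (simp add: C1_def)
  define V where "V = measure lebesgue (ball (0 :: real ^ 'n) 1)"
  have V: "V > 0" unfolding V_def by (simp add: content_ball_pos)
  define \<kappa> where "\<kappa> = min \<epsilon> (1 / \<epsilon>)"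
  have \<kappa>: "\<kappa> > 0" using \<epsilon> by (simp add: \<kappa>_def)
  define Q where "Q = 256 * C1\<^sup>2 * c * (1 / 16) powr (n / 2 - \<alpha>)"
  have Q: "Q > 0" using C1 c(1) by (simp add: Q_def)
  define C where "C = sqrt (\<kappa> * V / 8 ^ n / Q)"
  have C: "C > 0" "C\<^sup>2 = \<kappa> * V / 8 ^ n / Q" using \<kappa> V Q by (auto simp: C_def)
  have main: "C * \<rho> powr \<alpha> \<le> u (x, 0)"
    if \<rho>: "\<rho> > 0" and sub: "cball (x, 0::real) \<rho> \<subseteq> ball 0 1" and pos: "\<And>y. y \<in> ball x \<rho> \<Longrightarrow> u (y, 0) > 0" for x \<rho>
  proof -
    define B where "B = ball (x, 0::real) \<rho>"
    have B: "open B" "bounded B" "B \<in> sets lebesgue" by (auto simp: B_def open_sets_lebesgue)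
    have slice: "(y, 0) \<in> B \<longleftrightarrow> y \<in> ball x \<rho>" for y by (simp add: B_def dist_Pair_Pair)
    have B1: "B \<subseteq> ball 0 1" using sub ball_subset_cball unfolding B_def by blast
    have uB: "continuous_on B u" by (rule continuous_on_subset[OF u B1])
    obtain G where G: "has_weak_gradient B u G"
      "square_integrable_on B (\<lambda>z. \<bar>snd z\<bar> powr (\<beta> / 2) *\<^sub>R G z)"
      and min: "\<And>\<phi> D. test_function B \<phi> D \<Longrightarrow>
        (LINT z:B|lebesgue. \<bar>snd z\<bar> powr \<beta> * (norm (G z))\<^sup>2) 
          + f_eps \<omega> \<epsilon> (measure lebesgue {y. (y, 0) \<in> B \<and> u (y, 0) > 0})
        \<le> (LINT z:B|lebesgue. \<bar>snd z\<bar> powr \<beta> * (norm (G z + D z))\<^sup>2) 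
          + f_eps \<omega> \<epsilon> (measure lebesgue {y. (y, 0) \<in> B \<and> u (y, 0) + \<phi> (y, 0) > 0})"
      using minimizer_competitor[OF lm[folded \<beta>_def] u \<beta> sub \<rho>] unfolding B_def by blast
    have posB: "u (y, 0) > 0" if "(y, 0) \<in> ball (x, 0::real) \<rho>" for y using pos slice that by (simp add: B_def)
    have harm: "weighted_harmonic \<beta> (ball (x, 0) \<rho>) u"
      by (rule minimizer_weighted_harmonic(1)[OF \<beta> \<epsilon> uB[unfolded B_def] G[unfolded B_def]];
          (erule min[unfolded B_def] | erule posB))
    define M where "M = u (x, 0)"
    have M: "M > 0" using pos[of x] \<rho> by (simp add: M_def)
    have sup: "u (y, 0) \<le> C1 * M" if "dist y x \<le> \<rho> / 4" for y
      unfolding C1_def \<gamma>_def M_def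
      by (rule weighted_harmonic_sup_bound[OF \<beta> harm _ \<rho> that]) (use nonneg B1 in \<open>auto simp: B_def\<close>)
    define \<tau> where "\<tau> = \<rho>\<^sup>2 / 16"
    have \<tau>: "\<tau> > 0" "sqrt \<tau> = \<rho> / 4" using \<rho> by (auto simp: \<tau>_def real_sqrt_divide)
    define p where "p z = max 0 (\<tau> - (norm (z - (x, 0)))\<^sup>2)" for z :: "(real ^ 'n) \<times> real"
    \<comment> \<open>The factor 4 makes the bump at least \<open>C1 * M\<close> where \<open>q \<le> \<tau> / 2\<close>, in particular on the disc of radius \<open>\<rho> / 8\<close>.\<close>
    define k where "k = - 4 * C1 * M / \<tau>\<^sup>2"
    define \<phi> where "\<phi> z = k * (p z)\<^sup>2" for z
    define D where "D z = k *\<^sub>R ((- 4 * p z) *\<^sub>R (z - (x, 0)))" for z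
    have \<phi>D: "test_function B \<phi> D"
    proof -
      have "cball (x, 0::real) (sqrt \<tau>) \<subseteq> B" using \<rho> unfolding \<tau>(2) by (auto simp: B_def)
      from test_function_cmult[OF test_function_cutoff[OF this, of 0], of k]
      show ?thesis by (simp add: \<phi>_def[abs_def] D_def[abs_def] p_def power2_eq_square)
    qed
    have EL: "(LINT z:B|lebesgue. (\<bar>snd z\<bar> powr \<beta> *\<^sub>R G z) \<bullet> D z) = 0"
      unfolding B_def
      by (rule minimizer_weighted_harmonic(2)[OF \<beta> \<epsilon> uB[unfolded B_def] G[unfolded B_def]];
          (rule \<phi>D[unfolded B_def] | erule min[unfolded B_def] | erule posB))
    define Y where "Y = (LINT z:B|lebesgue. \<bar>snd z\<bar> powr \<beta> * (norm (D z))\<^sup>2)"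
    define P where "P = {y. (y, 0) \<in> B \<and> u (y, 0) > 0}"
    define P' where "P' = {y. (y, 0) \<in> B \<and> u (y, 0) + \<phi> (y, 0) > 0}"
    have cmp: "f_eps \<omega> \<epsilon> (measure lebesgue P) \<le> Y + f_eps \<omega> \<epsilon> (measure lebesgue P')"
      using min[OF \<phi>D] energy_expansion[OF \<beta> B(1,2) G(2) \<phi>D, of 1] EL
      unfolding P_def P'_def Y_def by simp
    have meas: "P \<in> lmeasurable" "P' \<in> lmeasurable"
    proof -
      show "P \<in> lmeasurable" unfolding P_def by (rule positivity_slice_lmeasurable[OF B(1,2) uB])
      have "continuous_on B (\<lambda>z. u z + \<phi> z)" by (intro continuous_intros uB test_function_continuous[OF \<phi>D])
      from positivity_slice_lmeasurable[OF B(1,2) this] show "P' \<in> lmeasurable" unfolding P'_def .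
    qed
    have lost: "P' \<subseteq> P - ball x (\<rho> / 8)"
    proof
      fix y assume y: "y \<in> P'"
      then have yB: "y \<in> ball x \<rho>" by (simp add: P'_def slice)
      have "y \<notin> ball x (\<rho> / 8)"
      proof
        assume "y \<in> ball x (\<rho> / 8)"
        then have d: "dist y x \<le> \<rho> / 8" by (simp add: dist_commute)
        then have "(dist y x)\<^sup>2 \<le> (\<rho> / 8)\<^sup>2" by (intro power_mono) auto
        moreover have "(\<rho> / 8)\<^sup>2 \<le> \<tau> / 2" by (simp add: \<tau>_def power2_eq_square)
        ultimately have "\<tau> / 2 \<le> \<tau> - (norm ((y, 0) - (x, 0::real)))\<^sup>2" 
          unfolding dist_norm[symmetric] by (simp add: dist_Pair_Pair)
        also have "\<dots> \<le> p (y, 0)" unfolding p_def by (rule max.cobounded2)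
        finally have "\<tau> / 2 \<le> p (y, 0)" .
        then have "(\<tau> / 2)\<^sup>2 \<le> (p (y, 0))\<^sup>2" using \<tau>(1) by (intro power_mono) auto
        then have "(4 * C1 * M / \<tau>\<^sup>2) * (\<tau> / 2)\<^sup>2 \<le> (4 * C1 * M / \<tau>\<^sup>2) * (p (y, 0))\<^sup>2"
          using C1 M by (intro mult_left_mono) auto
        then have "C1 * M \<le> - \<phi> (y, 0)" using \<tau>(1) by (simp add: \<phi>_def k_def power2_eq_square)
        moreover have "u (y, 0) \<le> C1 * M" using sup[of y] d \<rho> by simp
        ultimately show False using y by (simp add: P'_def)
      qed
      then show "y \<in> P - ball x (\<rho> / 8)" using yB pos by (simp add: P_def slice)
    qed
    have "ball x (\<rho> / 8) \<subseteq> P" using \<rho> pos by (auto simp: P_def slice)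
    then have gap: "measure lebesgue (ball x (\<rho> / 8)) \<le> measure lebesgue P - measure lebesgue P'"
    proof -
      assume b: "ball x (\<rho> / 8) \<subseteq> P"
      have "measure lebesgue P' \<le> measure lebesgue (P - ball x (\<rho> / 8))"
        using lost meas by (intro measure_mono_fmeasurable) auto
      also have "\<dots> = measure lebesgue P - measure lebesgue (ball x (\<rho> / 8))"
        by (rule measurable_measure_Diff) (use meas b in auto)
      finally show ?thesis by simp
    qed
    have "measure lebesgue P' \<le> measure lebesgue P" using gap measure_nonneg[of lebesgue "ball x (\<rho> / 8)"] by linarith
    from f_eps_increment[OF \<epsilon> this, of \<omega>]
    have "\<kappa> * (measure lebesgue P - measure lebesgue P') \<le> Y"
      using cmp by (simp add: \<kappa>_def)
    moreover have "\<kappa> * measure lebesgue (ball x (\<rho> / 8)) \<le> \<kappa> * (measure lebesgue P - measure lebesgue P')"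
      using gap \<kappa> by (intro mult_left_mono) auto
    moreover have "\<kappa> * measure lebesgue (ball x (\<rho> / 8)) = \<kappa> * (V / 8 ^ n * \<rho> ^ n)"
      unfolding V_def n_def using \<rho> by (simp add: content_ball power_divide)
    moreover have "Y \<le> Q * M\<^sup>2 * \<rho> powr (n - 2 * \<alpha>)"
    proof -
      define J where "J z = \<bar>snd z\<bar> powr \<beta> * (p z)\<^sup>2" for z
      have Ji: "integrable lebesgue J" unfolding J_def[abs_def] p_def
        by (rule weight_cutoff_integral_pos(2)[OF \<beta> \<tau>(1)])
      have le: "\<bar>snd z\<bar> powr \<beta> * (norm (D z))\<^sup>2 \<le> 16 * k\<^sup>2 * \<tau> * J z" for z
      proof -
        have "(p z)\<^sup>2 * (norm (z - (x, 0)))\<^sup>2 \<le> (p z)\<^sup>2 * \<tau>"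
        proof (cases "(norm (z - (x, 0)))\<^sup>2 \<le> \<tau>")
          case True
          then show ?thesis by (intro mult_left_mono) auto
        qed (simp add: p_def)
        then have "16 * k\<^sup>2 * \<bar>snd z\<bar> powr \<beta> * ((p z)\<^sup>2 * (norm (z - (x, 0)))\<^sup>2) \<le> 16 * k\<^sup>2 * \<bar>snd z\<bar> powr \<beta> * ((p z)\<^sup>2 * \<tau>)"
          by (rule mult_left_mono) simp
        moreover have "(norm (D z))\<^sup>2 = 16 * k\<^sup>2 * ((p z)\<^sup>2 * (norm (z - (x, 0)))\<^sup>2)"
          by (simp add: D_def power_mult_distrib)
        ultimately show ?thesis by (simp add: J_def mult_ac)
      qed
      have "Y \<le> (LINT z|lebesgue. 16 * k\<^sup>2 * \<tau> * J z)"
      proof -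
        have "Y = (LINT z:UNIV|lebesgue. \<bar>snd z\<bar> powr \<beta> * (norm (D z))\<^sup>2)"
        proof -
          have "D z = 0" if "z \<notin> B" for z
          proof (rule test_function_gradient_support[OF \<phi>D])
            fix K assume "K \<subseteq> B" "\<And>z. z \<notin> K \<Longrightarrow> D z = 0"
            with that show ?thesis by blast
          qed
          then show ?thesis unfolding Y_def by (intro set_integral_cong_support) auto
        qed
        also have "\<dots> = (LINT z|lebesgue. \<bar>snd z\<bar> powr \<beta> * (norm (D z))\<^sup>2)" 
          by (simp add: set_lebesgue_integral_def)
        also have "\<dots> \<le> (LINT z|lebesgue. 16 * k\<^sup>2 * \<tau> * J z)"
          by (rule integral_mono'[OF integrable_mult_right[OF Ji]]) (use le in \<open>auto simp: J_def \<tau>(1) less_imp_le\<close>)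
        finally show ?thesis .
      qed
      also have "\<dots> = 16 * k\<^sup>2 * \<tau> * (c * \<tau> powr \<gamma>)"
        unfolding J_def p_def using c(2)[of "(x, 0)" \<tau>] \<tau>(1) by simp
      also have "\<dots> = 256 * C1\<^sup>2 * c * M\<^sup>2 * (\<tau> powr \<gamma> / \<tau> ^ 3)"
        using \<tau>(1) by (simp add: k_def power2_eq_square power3_eq_cube field_simps)
      also have "\<tau> powr \<gamma> / \<tau> ^ 3 = \<tau> powr (n / 2 - \<alpha>)"
        using \<tau>(1) by (simp add: \<gamma>[symmetric] powr_diff)
      also have "\<dots> = (1 / 16) powr (n / 2 - \<alpha>) * \<rho> powr (n - 2 * \<alpha>)"
      proof -
        have "\<tau> powr (n / 2 - \<alpha>) = (1 / 16) powr (n / 2 - \<alpha>) * (\<rho>\<^sup>2) powr (n / 2 - \<alpha>)"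
          using powr_mult[of "1 / 16" "\<rho>\<^sup>2" "n / 2 - \<alpha>"] by (simp add: \<tau>_def)
        moreover have "(\<rho>\<^sup>2) powr (n / 2 - \<alpha>) = \<rho> powr (n - 2 * \<alpha>)"
          using power2_powr_half[of \<rho> "n - 2 * \<alpha>"] \<rho> by (simp add: diff_divide_distrib)
        ultimately show ?thesis by simp
      qed
      finally show ?thesis by (simp add: Q_def mult_ac)
    qed
    ultimately have "\<kappa> * (V / 8 ^ n * \<rho> ^ n) \<le> Q * M\<^sup>2 * \<rho> powr (n - 2 * \<alpha>)" by linarith
    then have "(\<kappa> * V / 8 ^ n) * \<rho> powr n \<le> Q * M\<^sup>2 * (\<rho> powr n / (\<rho> powr \<alpha>)\<^sup>2)"
    proof -
      assume a: "\<kappa> * (V / 8 ^ n * \<rho> ^ n) \<le> Q * M\<^sup>2 * \<rho> powr (n - 2 * \<alpha>)"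
      have "\<rho> powr (n - 2 * \<alpha>) = \<rho> powr n / (\<rho> powr \<alpha>)\<^sup>2"
        using \<rho> by (simp add: powr_diff power2_eq_square powr_add[symmetric])
      then show ?thesis using a \<rho> by (simp add: powr_realpow)
    qed
    then have "(\<kappa> * V / 8 ^ n) * (\<rho> powr \<alpha>)\<^sup>2 \<le> Q * M\<^sup>2" using \<rho> by (simp add: field_simps)
    then have "(C * \<rho> powr \<alpha>)\<^sup>2 \<le> M\<^sup>2" using Q by (simp add: power_mult_distrib C(2) field_simps)
    then have "C * \<rho> powr \<alpha> \<le> M" by (rule power2_le_imp_le) (use M in simp)
    then show ?thesis by (simp only: M_def)
  qed
  show ?thesis by (rule that[OF C(1) main])
qed

text \<open>
  If the free boundary is empty or contains \<open>x\<close>, then \<open>infdist\<close> is 0 and the claim is trivial, as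
  \<open>0 powr \<alpha> = 0\<close>.  Otherwise the disc about \<open>x\<close> whose radius is the distance to the free boundary is
  connected and hence lies in the positivity set.
\<close>

theorem theorem2p2:
  fixes \<alpha> \<omega> \<epsilon> :: real and u :: "(real ^ 'n) \<times> real \<Rightarrow> real"
  assumes "0 < \<alpha>" "\<alpha> < 1" and "\<omega> > 0" and "\<epsilon> > 0"
    and "local_minimizer (1 - 2 * \<alpha>) \<omega> \<epsilon> u"
    and "continuous_on (ball 0 1) u"
    and "\<forall>z \<in> ball 0 1. u z \<ge> 0"
  shows "\<exists>C\<^sub>0>0. \<forall>x \<in> ball 0 (1/2) \<inter> positivity_set u.
           u (x, 0) \<ge> C\<^sub>0 * infdist x (frontier (positivity_set u)) powr \<alpha>"
proof -
  define P where "P = positivity_set u"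
  obtain C where C: "C > 0" 
    "\<And>x \<rho>. \<rho> > 0 \<Longrightarrow> cball (x, 0::real) \<rho> \<subseteq> ball 0 1 \<Longrightarrow> (\<And>y. y \<in> ball x \<rho> \<Longrightarrow> u (y, 0) > 0)
      \<Longrightarrow> C * \<rho> powr \<alpha> \<le> u (x, 0)"
    using minimizer_scale_estimate[OF assms(1,2,4,5,6)] assms(7) by blast
  have "C * (1 / 4) powr \<alpha> * infdist x (frontier P) powr \<alpha> \<le> u (x, 0)" 
    if x: "x \<in> ball 0 (1 / 2)" "x \<in> P" for x
  proof -
    define d where "d = infdist x (frontier P)"
    have ux: "u (x, 0) > 0" using x(2) by (simp add: P_def positivity_set_def)
    show ?thesis
    proof (cases "d > 0")
      case False
      then have "d = 0" using infdist_nonneg[of x "frontier P"] by (simp add: d_def)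
      then show ?thesis using ux by (simp add: d_def)
    next
      case True
      then have ne: "frontier P \<noteq> {}" by (auto simp: d_def infdist_def)
      have "ball x d \<inter> frontier P = {}"
      proof (rule ccontr)
        assume "ball x d \<inter> frontier P \<noteq> {}"
        then obtain y where "y \<in> frontier P" "dist x y < d" by auto
        then show False using infdist_le[of y "frontier P" x] by (simp add: d_def)
      qed
      moreover have "ball x d \<inter> P \<noteq> {}" using x(2) centre_in_ball[of x d] True by blast
      ultimately have sub: "ball x d \<subseteq> P"
        using connected_Int_frontier[OF connected_ball, of x d P] by blast
      obtain y where y: "y \<in> frontier P" using ne by blast
      \<comment> \<open>The free boundary lies in the closed unit ball, so \<open>d < 3 / 2\<close> and the ball of radius \<open>d / 4\<close> about
        \<open>(x, 0)\<close> stays in the domain.\<close>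
      have "closure P \<subseteq> cball 0 1"
        by (rule closure_minimal) (auto simp: P_def positivity_set_def)
      then have "norm y \<le> 1" using y by (auto simp: frontier_def)
      moreover have "d \<le> dist x y" unfolding d_def by (rule infdist_le[OF y])
      moreover have "dist x y \<le> norm x + norm y" using norm_triangle_ineq4[of x y] by (simp add: dist_norm)
      ultimately have "d < 3 / 2" using x(1) by simp
      have "cball (x, 0::real) (d / 4) \<subseteq> ball 0 1"
      proof
        fix z assume z: "z \<in> cball (x, 0::real) (d / 4)"
        have "norm z \<le> norm (x, 0::real) + dist (x, 0) z"
          using norm_triangle_ineq[of "(x, 0)" "z - (x, 0)"] by (simp add: dist_norm norm_minus_commute)
        also have "norm (x, 0::real) = norm x" by (simp add: norm_Pair)
        finally show "z \<in> ball 0 1" using z x(1) \<open>d < 3 / 2\<close> by simp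
      qed
      moreover have "u (y, 0) > 0" if "y \<in> ball x (d / 4)" for y
      proof -
        have "y \<in> ball x d" using that True by simp
        then show ?thesis using sub by (auto simp: P_def positivity_set_def)
      qed
      ultimately have "C * (d / 4) powr \<alpha> \<le> u (x, 0)" using C(2)[of "d / 4" x] True by simp
      moreover have "(d / 4) powr \<alpha> = (1 / 4) powr \<alpha> * d powr \<alpha>"
        using powr_mult[of "1 / 4" d \<alpha>] by simp
      ultimately show ?thesis by (simp add: d_def mult.assoc)
    qed
  qed
  moreover have "C * (1 / 4) powr \<alpha> > 0" using C(1) by simp
  ultimately show ?thesis unfolding P_def by blast
qed

end
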